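(* Let $\mathcal{M}$ be a complete connected Riemannian manifold and let $f:\mathcal{M}\to\mathbb{R}$ be continuously differentiable. Assume that $\operatorname{grad} f$ is $L$-Lipschitz continuous on $\mathcal{M}$ ($L>0$) and that there is $f_*\in\mathbb{R}$ with $f(x)\ge f_*$ for all $x\in\mathcal{M}$. Let $\{x_n\}$ (together with $\{w_n\},\{\alpha_n\},\{\tilde\mu_n\}$) be generated by the RIAG-R algorithm with parameters $\eta>0$, $\varepsilon>0$, $\mu\in(0,1)$ and initial points $x_0,x_1\in\mathcal{M}$. Then for every $n\ge 1$, $$f(x_{n+1})\;\le\; f(x_n)-\alpha_n\Bigl(1-\frac{L\alpha_n}{2}\Bigr)\lVert \operatorname{grad} f(w_n)\rVert^2+\frac{L\tilde\mu_n^2}{2}\,d(x_n,x_{n-1})^2 .$$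
   Context: Notation: $\langle\cdot,\cdot\rangle$ and $\lVert\cdot\rVert$ are the Riemannian inner product and norm on the relevant tangent space, $d$ is the Riemannian distance, $\exp_x:T_x\mathcal{M}\to\mathcal{M}$ is the exponential map, and $\log_x(y)\in T_x\mathcal{M}$ denotes the logarithmic map, satisfying $\exp_x(\log_x(y))=y$ and $\lVert\log_x(y)\rVert=d(x,y)$. $\operatorname{grad} f$ is the Riemannian gradient. $L$-Lipschitz gradient: for any $x,y\in\mathcal{M}$ joined by a minimising geodesic $\gamma:[0,1]\to\mathcal{M}$ from $x$ to $y$, $\lVert \mathcal{P}_{\gamma,0,1}\operatorname{grad} f(x)-\operatorname{grad} f(y)\rVert\le L\,d(x,y)$, where $\mathcal{P}_{\gamma,0,1}:T_x\mathcal{M}\to T_y\mathcal{M}$ is parallel transport along $\gamma$. RIAG-R algorithm (parameters $\eta>0$, $\varepsilon>0$, $\mu\in(0,1)$; initial points $x_0,x_1\in\mathcal{M}$): set $G_0=0$, and for $n=1,2,3,\dots$: (1) $\bar\mu_n=\min\{\mu,\ \mu\, d(x_n,x_{n-1})\}$ if $x_n\ne x_{n-1}$, and $\bar\mu_n=\mu$ otherwise; (2) $d_n=-\log_{x_n}(x_{n-1})\in T_{x_n}\mathcal{M}$; (3) $\tilde\mu_n=0$ if $\langle\operatorname{grad} f(x_n),d_n\rangle>0$, and $\tilde\mu_n=\bar\mu_n$ otherwise; (4) $w_n=\exp_{x_n}(\tilde\mu_n d_n)$; (5) $G_n=G_{n-1}+\lVert\operatorname{grad} f(w_n)\rVert^2$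 and $\alpha_n=\eta/(\sqrt{G_n}+\varepsilon)$; (6) $x_{n+1}=\exp_{w_n}(-\alpha_n\operatorname{grad} f(w_n))$. The iteration is run indefinitely, producing infinite sequences. *)

theory Defs
  imports "HOL-Analysis.Analysis"
begin

section \<open>Smooth functions on open subsets of Euclidean spaces\<close>

text \<open>The set \<open>S\<close> is meant to be open.  In finite dimension, continuity of all directional
  derivatives of order at most \<open>k\<close> is the usual notion of \<open>C\<^sup>k\<close>.\<close>

fun Ck_on :: "nat \<Rightarrow> 'a::euclidean_space set \<Rightarrow> ('a \<Rightarrow> 'b::real_normed_vector) \<Rightarrow> bool" where
  "Ck_on 0 S f \<longleftrightarrow> continuous_on S f"
| "Ck_on (Suc k) S f \<longleftrightarrow>
     (\<forall>z\<in>S. f differentiable at z) \<and> (\<forall>v. Ck_on k S (\<lambda>z. frechet_derivative f (at z) v))"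

definition smooth_on :: "'a::euclidean_space set \<Rightarrow> ('a \<Rightarrow> 'b::real_normed_vector) \<Rightarrow> bool" where
  "smooth_on S f \<longleftrightarrow> (\<forall>k. Ck_on k S f)"


section \<open>Smooth manifolds\<close>

text \<open>The points of the manifold are all elements of a Hausdorff, second countable type \<open>'m\<close>,
  whose topology is the manifold topology; charts take values in \<open>'e\<close>, so the dimension
  is \<open>DIM('e)\<close>.\<close>

record ('m, 'e) chart =
  cdom :: "'m set"
  cmap :: "'m \<Rightarrow> 'e"

definition cimg :: "('m, 'e) chart \<Rightarrow> 'e set" where
  "cimg c = cmap c ` cdom c"

definition cinv :: "('m, 'e) chart \<Rightarrow> 'e \<Rightarrow> 'm" where
  "cinv c = inv_into (cdom c) (cmap c)"

definition transition :: "('m, 'e) chart \<Rightarrow> ('m, 'e) chart \<Rightarrow> 'e \<Rightarrow> 'e" where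
  "transition c c' = cmap c' \<circ> cinv c"

definition is_chart :: "('m::topological_space, 'e::euclidean_space) chart \<Rightarrow> bool" where
  "is_chart c \<longleftrightarrow> open (cdom c) \<and> open (cimg c) \<and>
     homeomorphism (cdom c) (cimg c) (cmap c) (cinv c)"

definition smooth_atlas ::
    "('m::{t2_space, second_countable_topology}, 'e::euclidean_space) chart set \<Rightarrow> bool" where
  "smooth_atlas A \<longleftrightarrow>
     (\<forall>c\<in>A. is_chart c) \<and> (\<Union>c\<in>A. cdom c) = UNIV \<and>
     (\<forall>c\<in>A. \<forall>c'\<in>A. smooth_on (cmap c ` (cdom c \<inter> cdom c')) (transition c c'))"


section \<open>Tangent vectors and Riemannian metrics\<close>

text \<open>A tangent vector at \<open>x\<close> is the family of its coordinate representations in the charts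
  around \<open>x\<close>, transforming under the derivatives of the transition maps, and set to \<open>0\<close>
  elsewhere so that equality of vectors is equality of functions.\<close>

type_synonym ('m, 'e) tvec = "('m, 'e) chart \<Rightarrow> 'e"

record ('m, 'e) rmfd =
  atlas :: "('m, 'e) chart set"
  metric :: "'m \<Rightarrow> ('m, 'e) tvec \<Rightarrow> ('m, 'e) tvec \<Rightarrow> real"

definition charts_at :: "('m, 'e) rmfd \<Rightarrow> 'm \<Rightarrow> ('m, 'e) chart set" where
  "charts_at M x = {c \<in> atlas M. x \<in> cdom c}"

definition tangent_space :: "('m, 'e::euclidean_space) rmfd \<Rightarrow> 'm \<Rightarrow> ('m, 'e) tvec set" where
  "tangent_space M x = {v.
     (\<forall>c. c \<notin> charts_at M x \<longrightarrow> v c = 0) \<and>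
     (\<forall>c\<in>charts_at M x. \<forall>c'\<in>charts_at M x.
        v c' = frechet_derivative (transition c c') (at (cmap c x)) (v c))}"

definition tzero :: "('m, 'e::euclidean_space) tvec" where
  "tzero = (\<lambda>c. 0)"

definition tplus :: "('m, 'e::euclidean_space) tvec \<Rightarrow> ('m, 'e) tvec \<Rightarrow> ('m, 'e) tvec" where
  "tplus u v = (\<lambda>c. u c + v c)"

definition tminus :: "('m, 'e::euclidean_space) tvec \<Rightarrow> ('m, 'e) tvec \<Rightarrow> ('m, 'e) tvec" where
  "tminus u v = (\<lambda>c. u c - v c)"

definition tscale :: "real \<Rightarrow> ('m, 'e::euclidean_space) tvec \<Rightarrow> ('m, 'e) tvec" where
  "tscale a v = (\<lambda>c. a *\<^sub>R v c)"

text \<open>The tangent vector at \<open>x\<close> whose representation in the chart \<open>c\<close> is \<open>e\<close>.\<close>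

definition coord_vec ::
    "('m, 'e::euclidean_space) rmfd \<Rightarrow> ('m, 'e) chart \<Rightarrow> 'm \<Rightarrow> 'e \<Rightarrow> ('m, 'e) tvec" where
  "coord_vec M c x e =
     (\<lambda>c'. if c' \<in> charts_at M x
            then frechet_derivative (transition c c') (at (cmap c x)) e else 0)"

definition gcoord ::
    "('m, 'e::euclidean_space) rmfd \<Rightarrow> ('m, 'e) chart \<Rightarrow> 'e \<Rightarrow> 'e \<Rightarrow> 'e \<Rightarrow> real" where
  "gcoord M c z u v =
     metric M (cinv c z) (coord_vec M c (cinv c z) u) (coord_vec M c (cinv c z) v)"

definition riemannian_manifold ::
    "('m::{t2_space, second_countable_topology}, 'e::euclidean_space) rmfd \<Rightarrow> bool" where
  "riemannian_manifold M \<longleftrightarrow>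
     smooth_atlas (atlas M) \<and>
     (\<forall>x. \<forall>u\<in>tangent_space M x. \<forall>v\<in>tangent_space M x. metric M x u v = metric M x v u) \<and>
     (\<forall>x. \<forall>u\<in>tangent_space M x. \<forall>v\<in>tangent_space M x. \<forall>w\<in>tangent_space M x.
        metric M x (tplus u v) w = metric M x u w + metric M x v w) \<and>
     (\<forall>x. \<forall>a. \<forall>u\<in>tangent_space M x. \<forall>v\<in>tangent_space M x.
        metric M x (tscale a u) v = a * metric M x u v) \<and>
     (\<forall>x. \<forall>u\<in>tangent_space M x. u \<noteq> tzero \<longrightarrow> metric M x u u > 0) \<and>
     (\<forall>c\<in>atlas M. \<forall>u v. smooth_on (cimg c) (\<lambda>z. gcoord M c z u v))"

definition tnorm :: "('m, 'e::euclidean_space) rmfd \<Rightarrow> 'm \<Rightarrow> ('m, 'e) tvec \<Rightarrow> real" where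
  "tnorm M x v = sqrt (metric M x v v)"


section \<open>Curves, length and distance\<close>

definition differentiable_curve ::
    "('m::topological_space, 'e::euclidean_space) rmfd \<Rightarrow> real set \<Rightarrow> (real \<Rightarrow> 'm) \<Rightarrow> bool" where
  "differentiable_curve M I \<gamma> \<longleftrightarrow> continuous_on I \<gamma> \<and>
     (\<forall>t\<in>I. \<forall>c\<in>charts_at M (\<gamma> t). (cmap c \<circ> \<gamma>) differentiable (at t within I))"

text \<open>One-sided derivatives are taken at the end points of the interval \<open>I\<close>.\<close>

definition velocity ::
    "('m, 'e::euclidean_space) rmfd \<Rightarrow> real set \<Rightarrow> (real \<Rightarrow> 'm) \<Rightarrow> real \<Rightarrow> ('m, 'e) tvec" where
  "velocity M I \<gamma> t =
     (\<lambda>c. if c \<in> charts_at M (\<gamma> t) then vector_derivative (cmap c \<circ> \<gamma>) (at t within I) else 0)"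

definition C1_curve ::
    "('m::topological_space, 'e::euclidean_space) rmfd \<Rightarrow> real set \<Rightarrow> (real \<Rightarrow> 'm) \<Rightarrow> bool" where
  "C1_curve M I \<gamma> \<longleftrightarrow> differentiable_curve M I \<gamma> \<and>
     (\<forall>c\<in>atlas M. continuous_on {t \<in> I. \<gamma> t \<in> cdom c} (\<lambda>t. velocity M I \<gamma> t c))"

text \<open>\<open>P\<close> is the set of division points, and \<open>{a..b}\<close> ranges over the closed pieces.\<close>

definition piecewise_C1_curve ::
    "('m::topological_space, 'e::euclidean_space) rmfd \<Rightarrow> (real \<Rightarrow> 'm) \<Rightarrow> bool" where
  "piecewise_C1_curve M \<gamma> \<longleftrightarrow>
     (\<exists>P. finite P \<and> {0, 1} \<subseteq> P \<and> P \<subseteq> {0..1} \<and>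
       (\<forall>a\<in>P. \<forall>b\<in>P. a < b \<and> {a<..<b} \<inter> P = {} \<longrightarrow> C1_curve M {a..b} \<gamma>))"

text \<open>The velocity may be meaningless at the finitely many division points, which does not
  affect the integral.\<close>

definition curve_length ::
    "('m, 'e::euclidean_space) rmfd \<Rightarrow> (real \<Rightarrow> 'm) \<Rightarrow> real" where
  "curve_length M \<gamma> = integral {0..1} (\<lambda>t. tnorm M (\<gamma> t) (velocity M {0..1} \<gamma> t))"

definition rdist ::
    "('m::topological_space, 'e::euclidean_space) rmfd \<Rightarrow> 'm \<Rightarrow> 'm \<Rightarrow> real" where
  "rdist M x y =
     Inf {curve_length M \<gamma> | \<gamma>. piecewise_C1_curve M \<gamma> \<and> \<gamma> 0 = x \<and> \<gamma> 1 = y}"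


section \<open>Levi-Civita connection, parallel transport and geodesics\<close>

text \<open>The Christoffel symbols of the Levi-Civita connection in the chart \<open>c\<close>, as a bilinear map
  \<open>(u, v) \<mapsto> \<Gamma>\<^sup>k\<^sub>i\<^sub>j u\<^sup>i v\<^sup>j\<close>; the defining identity is
  \<open>g\<^sub>k\<^sub>l \<Gamma>\<^sup>k\<^sub>i\<^sub>j = (\<partial>\<^sub>i g\<^sub>j\<^sub>l + \<partial>\<^sub>j g\<^sub>i\<^sub>l - \<partial>\<^sub>l g\<^sub>i\<^sub>j) / 2\<close> contracted with
  \<open>u\<close>, \<open>v\<close> and \<open>w\<close>.\<close>

definition christoffel ::
    "('m, 'e::euclidean_space) rmfd \<Rightarrow> ('m, 'e) chart \<Rightarrow> 'e \<Rightarrow> 'e \<Rightarrow> 'e \<Rightarrow> 'e" where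
  "christoffel M c z u v = (THE y. \<forall>w. gcoord M c z y w =
     (frechet_derivative (\<lambda>z'. gcoord M c z' v w) (at z) u
      + frechet_derivative (\<lambda>z'. gcoord M c z' u w) (at z) v
      - frechet_derivative (\<lambda>z'. gcoord M c z' u v) (at z) w) / 2)"

text \<open>\<open>V\<close> is parallel along \<open>\<gamma>\<close> when its covariant derivative
  \<open>V' + \<Gamma>(\<gamma>', V)\<close> vanishes in every chart.\<close>

definition parallel_field ::
    "('m::topological_space, 'e::euclidean_space) rmfd \<Rightarrow> real set \<Rightarrow> (real \<Rightarrow> 'm) \<Rightarrow>
     (real \<Rightarrow> ('m, 'e) tvec) \<Rightarrow> bool" where
  "parallel_field M I \<gamma> V \<longleftrightarrow>
     (\<forall>t\<in>I. V t \<in> tangent_space M (\<gamma> t)) \<and>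
     (\<forall>t\<in>I. \<forall>c\<in>charts_at M (\<gamma> t).
        ((\<lambda>s. V s c) has_vector_derivative
           - christoffel M c (cmap c (\<gamma> t)) (velocity M I \<gamma> t c) (V t c)) (at t within I))"

text \<open>Parallel transport from \<open>\<gamma> 0\<close> to \<open>\<gamma> 1\<close>.  Here and in the definition of the exponential
  map the choice is unique by uniqueness of solutions of the respective differential
  equations.\<close>

definition parallel_transport ::
    "('m::topological_space, 'e::euclidean_space) rmfd \<Rightarrow> (real \<Rightarrow> 'm) \<Rightarrow>
     ('m, 'e) tvec \<Rightarrow> ('m, 'e) tvec" where
  "parallel_transport M \<gamma> u =
     (SOME w. \<exists>V. parallel_field M {0..1} \<gamma> V \<and> V 0 = u \<and> V 1 = w)"

definition geodesic ::
    "('m::topological_space, 'e::euclidean_space) rmfd \<Rightarrow> real set \<Rightarrow> (real \<Rightarrow> 'm) \<Rightarrow> bool" where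
  "geodesic M I \<gamma> \<longleftrightarrow> differentiable_curve M I \<gamma> \<and> parallel_field M I \<gamma> (velocity M I \<gamma>)"

definition minimising_geodesic ::
    "('m::topological_space, 'e::euclidean_space) rmfd \<Rightarrow> (real \<Rightarrow> 'm) \<Rightarrow> 'm \<Rightarrow> 'm \<Rightarrow> bool" where
  "minimising_geodesic M \<gamma> x y \<longleftrightarrow>
     geodesic M {0..1} \<gamma> \<and> \<gamma> 0 = x \<and> \<gamma> 1 = y \<and> curve_length M \<gamma> = rdist M x y"

text \<open>Geodesic completeness, that is, the exponential map is defined on all tangent spaces.\<close>

definition complete_rmfd ::
    "('m::topological_space, 'e::euclidean_space) rmfd \<Rightarrow> bool" where
  "complete_rmfd M \<longleftrightarrow>
     (\<forall>x. \<forall>v\<in>tangent_space M x. \<exists>\<gamma>. geodesic M UNIV \<gamma> \<and> \<gamma> 0 = x \<and> velocity M UNIV \<gamma> 0 = v)"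

definition rexp ::
    "('m::topological_space, 'e::euclidean_space) rmfd \<Rightarrow> 'm \<Rightarrow> ('m, 'e) tvec \<Rightarrow> 'm" where
  "rexp M x v =
     (SOME y. \<exists>\<gamma>. geodesic M {0..1} \<gamma> \<and> \<gamma> 0 = x \<and> velocity M {0..1} \<gamma> 0 = v \<and> \<gamma> 1 = y)"

text \<open>Beyond the cut locus the logarithm is not unique, so it is an arbitrary selection of initial
  velocities of minimising geodesics.\<close>

definition is_log_map ::
    "('m::topological_space, 'e::euclidean_space) rmfd \<Rightarrow> ('m \<Rightarrow> 'm \<Rightarrow> ('m, 'e) tvec) \<Rightarrow> bool" where
  "is_log_map M lg \<longleftrightarrow>
     (\<forall>x y. lg x y \<in> tangent_space M x \<and> rexp M x (lg x y) = y \<and>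
            tnorm M x (lg x y) = rdist M x y)"


section \<open>Gradients\<close>

definition C1_function ::
    "('m, 'e::euclidean_space) rmfd \<Rightarrow> ('m \<Rightarrow> real) \<Rightarrow> bool" where
  "C1_function M f \<longleftrightarrow> (\<forall>c\<in>atlas M. Ck_on 1 (cimg c) (f \<circ> cinv c))"

definition grad ::
    "('m, 'e::euclidean_space) rmfd \<Rightarrow> ('m \<Rightarrow> real) \<Rightarrow> 'm \<Rightarrow> ('m, 'e) tvec" where
  "grad M f x = (THE v. v \<in> tangent_space M x \<and>
     (\<forall>u\<in>tangent_space M x. \<forall>c\<in>charts_at M x.
        metric M x v u = frechet_derivative (f \<circ> cinv c) (at (cmap c x)) (u c)))"

definition lipschitz_gradient ::
    "('m::topological_space, 'e::euclidean_space) rmfd \<Rightarrow> real \<Rightarrow> ('m \<Rightarrow> real) \<Rightarrow> bool" where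
  "lipschitz_gradient M L f \<longleftrightarrow>
     (\<forall>x y \<gamma>. minimising_geodesic M \<gamma> x y \<longrightarrow>
        tnorm M y (tminus (parallel_transport M \<gamma> (grad M f x)) (grad M f y)) \<le> L * rdist M x y)"


section \<open>The RIAG-R iteration\<close>

definition riag_r ::
    "('m::topological_space, 'e::euclidean_space) rmfd \<Rightarrow> ('m \<Rightarrow> real) \<Rightarrow>
     ('m \<Rightarrow> 'm \<Rightarrow> ('m, 'e) tvec) \<Rightarrow> real \<Rightarrow> real \<Rightarrow> real \<Rightarrow>
     (nat \<Rightarrow> 'm) \<Rightarrow> (nat \<Rightarrow> 'm) \<Rightarrow> (nat \<Rightarrow> ('m, 'e) tvec) \<Rightarrow> (nat \<Rightarrow> real) \<Rightarrow> (nat \<Rightarrow> real) \<Rightarrow>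
     (nat \<Rightarrow> real) \<Rightarrow> (nat \<Rightarrow> real) \<Rightarrow> bool" where
  "riag_r M f lg \<eta> \<epsilon> \<mu> x w d G \<alpha> \<mu>bar \<mu>til \<longleftrightarrow>
     G 0 = 0 \<and>
     (\<forall>n\<ge>1.
        \<mu>bar n = (if x n \<noteq> x (n - 1) then min \<mu> (\<mu> * rdist M (x n) (x (n - 1))) else \<mu>) \<and>
        d n = tscale (- 1) (lg (x n) (x (n - 1))) \<and>
        \<mu>til n = (if metric M (x n) (grad M f (x n)) (d n) > 0 then 0 else \<mu>bar n) \<and>
        w n = rexp M (x n) (tscale (\<mu>til n) (d n)) \<and>
        G n = G (n - 1) + (tnorm M (w n) (grad M f (w n)))\<^sup>2 \<and>
        \<alpha> n = \<eta> / (sqrt (G n) + \<epsilon>) \<and>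
        x (n + 1) = rexp M (w n) (tscale (- \<alpha> n) (grad M f (w n))))"

end

theory Submission
  imports Defs
begin

text \<open>
  Both steps of the iteration move along a geodesic, so the whole statement follows from one
  inequality: for every geodesic \<open>\<gamma>\<close> on \<open>[0,1]\<close>,
  \<open>f (\<gamma> 1) \<le> f (\<gamma> 0) + \<langle>grad f (\<gamma> 0), \<gamma>' 0\<rangle> + L/2 \<cdot> \<parallel>\<gamma>' 0\<parallel>\<^sup>2\<close> (\<open>descent_along_geodesic\<close>).
  In the inertial step from \<open>x n\<close> to \<open>w n\<close> the choice of \<open>\<mu>til n\<close> makes the first order term
  nonpositive; the gradient step from \<open>w n\<close> to \<open>x (n + 1)\<close> contributes the terms in \<open>\<alpha> n\<close>.

  The inequality is Taylor's formula for \<open>f \<circ> \<gamma>\<close>, whose derivative is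
  \<open>\<psi> t = \<langle>grad f (\<gamma> t), \<gamma>' t\<rangle>\<close>: it suffices that \<open>\<psi>\<close> is Lipschitz with constant
  \<open>L s\<^sup>2\<close>, where \<open>s\<close> is the constant speed of \<open>\<gamma>\<close>.  The difficulty is that the hypothesis on the
  gradient only speaks about minimising geodesics, which \<open>\<gamma>\<close> need not be.  It is
  enough, however, to prove the Lipschitz estimate at each single time up to an arbitrarily
  small error in the constant (\<open>pointwise_lipschitz_imp_lipschitz\<close>), so only short pieces of
  \<open>\<gamma>\<close> matter.  Such a piece is compared, in a chart, with the minimising geodesic \<open>\<sigma>\<close> from
  \<open>\<gamma> t\<close> to \<open>\<gamma> (t + h)\<close> that the logarithmic map provides.  Both solve the equation
  \<open>z'' = - \<Gamma> z z' z'\<close> on \<open>[0,1]\<close> with the same end points and with velocities of order \<open>h\<close>, and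
  this forces their velocities to agree up to \<open>o(h\<^sup>2)\<close>
  (\<open>geodesic_equation_endpoint_estimate\<close>).  Since \<open>\<sigma>\<close> is no longer than \<open>\<bar>h\<bar> s\<close>, the hypothesis
  applied to \<open>\<sigma>\<close> bounds \<open>h (\<psi> (t + h) - \<psi> t)\<close> by \<open>L s\<^sup>2 h\<^sup>2 + o(h\<^sup>2)\<close>, which is what is needed
  (\<open>gradient_pairing_pointwise_lipschitz\<close>).

  Parallel transport is defined by a choice, so the hypothesis on the gradient says nothing
  along a curve before parallel fields are known to exist there.  They are constructed along short curves
  as fixed points of the integrated linear equation in one chart
  (\<open>linear_ode_solution\<close>, \<open>parallel_field_exists\<close>); that they solve the equation in
  all other charts is the transformation law of the Christoffel symbols
  (\<open>christoffel_transition\<close>), which in turn uses the symmetry of second derivatives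
  (\<open>second_derivative_symmetric\<close>).  Any parallel field pairs with the velocity of a geodesic
  to a constant, because the connection is compatible with the metric
  (\<open>parallel_metric_constant\<close>); this turns the bound on the transported gradient into a bound
  on the change of \<open>\<psi>\<close>.
\<close>

section \<open>Families of linear and bilinear maps on a Euclidean space\<close>

lemma linear_basis_expansion:
  fixes A :: "'e::euclidean_space \<Rightarrow> 'b::real_normed_vector"
  assumes "linear A"
  shows "A u = (\<Sum>i\<in>Basis. (u \<bullet> i) *\<^sub>R A i)"
proof -
  interpret linear A by fact
  have "A u = A (\<Sum>i\<in>Basis. (u \<bullet> i) *\<^sub>R i)" by (simp add: euclidean_representation)
  then show ?thesis by (simp add: sum scaleR)
qed

lemma norm_linear_le_basis:
  fixes A :: "'e::euclidean_space \<Rightarrow> 'b::real_normed_vector"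
  assumes "linear A"
  shows "norm (A u) \<le> (\<Sum>i\<in>Basis. norm (A i)) * norm u"
proof -
  have "norm (A u) \<le> (\<Sum>i\<in>Basis. norm ((u \<bullet> i) *\<^sub>R A i))"
    by (subst linear_basis_expansion[OF assms]) (rule norm_sum)
  also have "\<dots> \<le> (\<Sum>i\<in>Basis. norm (A i) * norm u)"
    by (intro sum_mono) (simp add: Basis_le_norm mult.commute[of "norm (A _)"] mult_right_mono)
  finally show ?thesis by (simp add: sum_distrib_right)
qed

lemma bilinear_basis_expansion:
  fixes B :: "'e::euclidean_space \<Rightarrow> 'e \<Rightarrow> 'b::real_normed_vector"
  assumes "bilinear B"
  shows "B u v = (\<Sum>i\<in>Basis. \<Sum>j\<in>Basis. ((u \<bullet> i) * (v \<bullet> j)) *\<^sub>R B i j)"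
proof -
  have l: "linear (\<lambda>u. B u v)" and r: "linear (B u)" for u v
    using assms by (auto simp: bilinear_def)
  have "B u v = (\<Sum>i\<in>Basis. (u \<bullet> i) *\<^sub>R B i v)" by (rule linear_basis_expansion[OF l])
  also have "\<dots> = (\<Sum>i\<in>Basis. (u \<bullet> i) *\<^sub>R (\<Sum>j\<in>Basis. (v \<bullet> j) *\<^sub>R B i j))"
    by (intro sum.cong refl arg_cong2[where f = scaleR]) (rule linear_basis_expansion[OF r])
  finally show ?thesis by (simp add: scaleR_sum_right)
qed

lemma norm_bilinear_le_basis:
  fixes B :: "'e::euclidean_space \<Rightarrow> 'e \<Rightarrow> 'b::real_normed_vector"
  assumes "bilinear B"
  shows "norm (B u v) \<le> (\<Sum>i\<in>Basis. \<Sum>j\<in>Basis. norm (B i j)) * norm u * norm v"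
proof -
  have l: "linear (\<lambda>u. B u v)" and r: "linear (B u)" for u v
    using assms by (auto simp: bilinear_def)
  have "norm (B u v) \<le> (\<Sum>i\<in>Basis. norm (B i v)) * norm u" by (rule norm_linear_le_basis[OF l])
  also have "\<dots> \<le> (\<Sum>i\<in>Basis. (\<Sum>j\<in>Basis. norm (B i j)) * norm v) * norm u"
    by (intro mult_right_mono sum_mono norm_linear_le_basis[OF r]) simp
  finally show ?thesis by (simp add: mult_ac flip: sum_distrib_right sum_distrib_left)
qed

lemma bilinear_diff:
  assumes "bilinear A" "bilinear B"
  shows "bilinear (\<lambda>u v. A u v - B u v)"
  using assms unfolding bilinear_def by (auto intro!: linear_compose_sub)

lemma continuous_on_linear_family:
  fixes A :: "'z::topological_space \<Rightarrow> 'e::euclidean_space \<Rightarrow> 'b::real_normed_vector"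
  assumes "\<And>z. z \<in> S \<Longrightarrow> linear (A z)" "\<And>i. continuous_on S (\<lambda>z. A z i)"
    and "continuous_on S a"
  shows "continuous_on S (\<lambda>z. A z (a z))"
proof -
  have "continuous_on S (\<lambda>z. \<Sum>i\<in>Basis. (a z \<bullet> i) *\<^sub>R A z i)"
    by (intro continuous_intros assms)
  then show ?thesis
    by (rule continuous_on_eq) (auto intro!: linear_basis_expansion[OF assms(1), symmetric])
qed

lemma continuous_on_bilinear_family:
  fixes B :: "'z::topological_space \<Rightarrow> 'e::euclidean_space \<Rightarrow> 'e \<Rightarrow> 'b::real_normed_vector"
  assumes "\<And>z. z \<in> S \<Longrightarrow> bilinear (B z)" "\<And>i j. continuous_on S (\<lambda>z. B z i j)"
    and "continuous_on S a" "continuous_on S b"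
  shows "continuous_on S (\<lambda>z. B z (a z) (b z))"
proof -
  have "continuous_on S (\<lambda>z. \<Sum>i\<in>Basis. \<Sum>j\<in>Basis. ((a z \<bullet> i) * (b z \<bullet> j)) *\<^sub>R B z i j)"
    by (intro continuous_intros assms)
  then show ?thesis
    by (rule continuous_on_eq) (auto intro!: bilinear_basis_expansion[OF assms(1), symmetric])
qed

text \<open>Expanding in a basis reduces uniformity in the two vectors to the finitely many continuous
  functions \<open>\<lambda>z. B z i j\<close>.\<close>

lemma bilinear_family_near:
  fixes B :: "'z::metric_space \<Rightarrow> 'e::euclidean_space \<Rightarrow> 'e \<Rightarrow> 'b::real_normed_vector"
  assumes "open S" "z0 \<in> S" "\<And>z. z \<in> S \<Longrightarrow> bilinear (B z)"
    and "\<And>i j. continuous_on S (\<lambda>z. B z i j)" and "\<epsilon> > 0"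
  obtains \<delta> where "\<delta> > 0" "cball z0 \<delta> \<subseteq> S"
    "\<And>z u v. z \<in> cball z0 \<delta> \<Longrightarrow> norm (B z u v - B z0 u v) \<le> \<epsilon> * norm u * norm v"
proof -
  define F where "F z = (\<Sum>i\<in>Basis. \<Sum>j\<in>Basis. norm (B z i j - B z0 i j))" for z
  have "continuous_on S F" unfolding F_def by (intro continuous_intros assms)
  moreover have "F z0 = 0" by (simp add: F_def)
  ultimately have "(F \<longlongrightarrow> 0) (at z0)"
    using assms(1,2) by (metis continuous_on_eq_continuous_at isContD)
  then have "\<forall>\<^sub>F z in at z0. F z < \<epsilon>" using \<open>\<epsilon> > 0\<close> by (rule order_tendstoD)
  then obtain d1 where d1: "d1 > 0" "\<And>z. z \<noteq> z0 \<Longrightarrow> dist z z0 < d1 \<Longrightarrow> F z < \<epsilon>"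
    by (auto simp: eventually_at)
  obtain d2 where d2: "d2 > 0" "cball z0 d2 \<subseteq> S" using assms(1,2) open_contains_cball by blast
  define \<delta> where "\<delta> = min (d1/2) d2"
  show ?thesis
  proof
    show "\<delta> > 0" "cball z0 \<delta> \<subseteq> S" using d1 d2 by (auto simp: \<delta>_def)
    fix z u v assume z: "z \<in> cball z0 \<delta>"
    have "F z \<le> \<epsilon>"
    proof (cases "z = z0")
      case True then show ?thesis using \<open>F z0 = 0\<close> \<open>\<epsilon> > 0\<close> by simp
    next
      case False then show ?thesis using z d1(1) d1(2)[of z] by (auto simp: \<delta>_def dist_commute)
    qed
    have "norm (B z u v - B z0 u v) \<le> F z * norm u * norm v"
      unfolding F_def
      by (rule norm_bilinear_le_basis) (use z \<open>cball z0 \<delta> \<subseteq> S\<close> assms in \<open>auto intro!: bilinear_diff\<close>)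
    also have "\<dots> \<le> \<epsilon> * norm u * norm v" using \<open>F z \<le> \<epsilon>\<close> by (intro mult_right_mono) auto
    finally show "norm (B z u v - B z0 u v) \<le> \<epsilon> * norm u * norm v" .
  qed
qed

text \<open>A product rule for the evaluation of a varying linear map at a varying vector.  The metric
  and the derivatives of transition maps are only known to be smooth after plugging in fixed
  vectors; expanding \<open>a y\<close> in a basis makes this sufficient.\<close>

lemma has_derivative_linear_family:
  fixes A :: "'z::real_normed_vector \<Rightarrow> 'e::euclidean_space \<Rightarrow> 'b::real_normed_vector"
  assumes lin: "\<And>y. y \<in> S \<Longrightarrow> linear (A y)" and ev: "\<forall>\<^sub>F y in at x within T. y \<in> S"
    and x: "x \<in> T" "x \<in> S"
    and A': "\<And>u. ((\<lambda>y. A y u) has_derivative A' u) (at x within T)"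
    and lin': "\<And>h. linear (\<lambda>u. A' u h)"
    and a: "(a has_derivative a') (at x within T)"
  shows "((\<lambda>y. A y (a y)) has_derivative (\<lambda>h. A' (a x) h + A x (a' h))) (at x within T)"
proof -
  have "((\<lambda>y. \<Sum>i\<in>Basis. (a y \<bullet> i) *\<^sub>R A y i) has_derivative
      (\<lambda>h. \<Sum>i\<in>Basis. (a x \<bullet> i) *\<^sub>R A' i h + (a' h \<bullet> i) *\<^sub>R A x i)) (at x within T)"
    by (intro has_derivative_sum has_derivative_scaleR A' has_derivative_inner_left a)
  moreover have "(\<Sum>i\<in>Basis. (a x \<bullet> i) *\<^sub>R A' i h + (a' h \<bullet> i) *\<^sub>R A x i)
      = A' (a x) h + A x (a' h)" for h
    unfolding sum.distrib linear_basis_expansion[OF lin', of "a x" h]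
      linear_basis_expansion[OF lin[OF x(2)], of "a' h"] by simp
  ultimately have 1: "((\<lambda>y. \<Sum>i\<in>Basis. (a y \<bullet> i) *\<^sub>R A y i) has_derivative
      (\<lambda>h. A' (a x) h + A x (a' h))) (at x within T)" by (simp only:)
  show ?thesis
    by (rule has_derivative_transform_eventually[OF 1])
      (use ev x in \<open>auto elim!: eventually_mono intro!: linear_basis_expansion[symmetric] lin\<close>)
qed

lemma linear_frechet_derivative_family:
  fixes A :: "'z::real_normed_vector \<Rightarrow> 'e::real_normed_vector \<Rightarrow> 'b::real_normed_vector"
  assumes S: "open S" "z \<in> S" and lin: "\<And>y. y \<in> S \<Longrightarrow> linear (A y)"
    and diff: "\<And>u. (\<lambda>y. A y u) differentiable at z"
  shows "linear (\<lambda>u. frechet_derivative (\<lambda>y. A y u) (at z) e)"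
proof (rule linearI)
  have d: "((\<lambda>y. A y u) has_derivative frechet_derivative (\<lambda>y. A y u) (at z)) (at z)" for u
    using diff frechet_derivative_works by blast
  fix u v c
  have "((\<lambda>y. A y (u + v)) has_derivative (\<lambda>h. frechet_derivative (\<lambda>y. A y u) (at z) h
      + frechet_derivative (\<lambda>y. A y v) (at z) h)) (at z)"
    by (rule has_derivative_transform_within_open[OF has_derivative_add[OF d[of u] d[of v]] S])
      (simp add: linear_add[OF lin])
  from frechet_derivative_at[OF this]
  show "frechet_derivative (\<lambda>y. A y (u + v)) (at z) e =
    frechet_derivative (\<lambda>y. A y u) (at z) e + frechet_derivative (\<lambda>y. A y v) (at z) e" by metis
  have "((\<lambda>y. A y (c *\<^sub>R u)) has_derivative
      (\<lambda>h. c *\<^sub>R frechet_derivative (\<lambda>y. A y u) (at z) h)) (at z)"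
    by (rule has_derivative_transform_within_open[OF has_derivative_scaleR_right[OF d[of u]] S])
      (simp add: linear_cmul[OF lin])
  from frechet_derivative_at[OF this]
  show "frechet_derivative (\<lambda>y. A y (c *\<^sub>R u)) (at z) e =
    c *\<^sub>R frechet_derivative (\<lambda>y. A y u) (at z) e" by metis
qed

section \<open>Symmetry of the second derivative\<close>

lemma onorm_scaleR_left_le:
  fixes v :: "'b::real_normed_vector"
  assumes "norm v \<le> B"
  shows "onorm (\<lambda>h::real. h *\<^sub>R v) \<le> B"
proof (rule onorm_le)
  fix h :: real
  show "norm (h *\<^sub>R v) \<le> B * norm h"
    using mult_left_mono[OF assms abs_ge_zero[of h]] by (simp add: mult.commute[of B])
qed

text \<open>The second difference is the increment over \<open>[0,h]\<close> of
  \<open>\<lambda>s. f (z + h v + s u) - f (z + s u)\<close>.  Its derivative is a difference of two values of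
  \<open>\<lambda>y. f' y u\<close>, for which differentiability at the single point \<open>z\<close> gives \<open>h P v + o(h)\<close>.\<close>

lemma second_difference_estimate:
  fixes f :: "'e::real_normed_vector \<Rightarrow> 'b::real_normed_vector"
  assumes S: "open S" "z \<in> S" and f: "\<And>y. y \<in> S \<Longrightarrow> (f has_derivative f' y) (at y)"
    and P: "((\<lambda>y. f' y u) has_derivative P) (at z)" and "\<epsilon> > 0"
  obtains \<delta> where "\<delta> > 0" "\<And>h. 0 < h \<Longrightarrow> h < \<delta> \<Longrightarrow>
    norm (f (z + h *\<^sub>R u + h *\<^sub>R v) - f (z + h *\<^sub>R u) - f (z + h *\<^sub>R v) + f z - (h * h) *\<^sub>R P v)
      \<le> \<epsilon> * (h * h)"
proof -
  interpret P: bounded_linear P using P has_derivative_bounded_linear by blast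
  define N where "N = 2 * norm u + norm v + 1"
  have N: "N > 0" by (simp add: N_def add_nonneg_pos)
  have "\<exists>d>0. \<forall>y. norm (y - z) < d \<longrightarrow>
      norm (f' y u - f' z u - P (y - z)) \<le> \<epsilon> / N * norm (y - z)"
    using P N \<open>\<epsilon> > 0\<close> unfolding has_derivative_at_alt by (metis divide_pos_pos)
  then obtain d where d: "d > 0" "\<And>y. norm (y - z) < d \<Longrightarrow>
      norm (f' y u - f' z u - P (y - z)) \<le> \<epsilon> / N * norm (y - z)" by blast
  obtain d2 where d2: "d2 > 0" "ball z d2 \<subseteq> S" using S open_contains_ball by blast
  define \<delta> where "\<delta> = min d d2 / N"
  show ?thesis
  proof
    show "\<delta> > 0" using d d2 N by (simp add: \<delta>_def)
    fix h :: real assume h: "0 < h" "h < \<delta>"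
    have hN: "h * N < min d d2" using h N by (simp add: \<delta>_def pos_less_divide_eq)
    have n1: "norm (s *\<^sub>R u) \<le> h * norm u" if "s \<in> {0..h}" for s
      using that by (simp add: mult_right_mono)
    have n2: "norm (s *\<^sub>R u + h *\<^sub>R v) \<le> h * norm u + h * norm v" if "s \<in> {0..h}" for s
      using norm_triangle_ineq[of "s *\<^sub>R u" "h *\<^sub>R v"] n1[OF that] h by simp
    have "h * N = h * norm u + (h * norm u + h * norm v) + h" by (simp add: N_def algebra_simps)
    moreover have "h * norm u \<ge> 0" "h * norm v \<ge> 0" using h by auto
    ultimately have b: "h * norm u + h * norm v < min d d2" "h * norm u < min d d2"
      using hN h by linarith+
    have S1: "z + s *\<^sub>R u \<in> S" "z + h *\<^sub>R v + s *\<^sub>R u \<in> S" if "s \<in> {0..h}" for s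
    proof -
      have "dist z (z + s *\<^sub>R u) < d2" using n1[OF that] b by (simp add: dist_norm)
      moreover have "dist (z + h *\<^sub>R v + s *\<^sub>R u) z < d2"
        using n2[OF that] b by (simp add: dist_norm add.commute)
      ultimately show "z + s *\<^sub>R u \<in> S" "z + h *\<^sub>R v + s *\<^sub>R u \<in> S" using d2(2) by (auto simp: dist_commute)
    qed
    define K where "K s = f (z + h *\<^sub>R v + s *\<^sub>R u) - f (z + s *\<^sub>R u) - (s * h) *\<^sub>R P v" for s
    define K' where "K' s = f' (z + h *\<^sub>R v + s *\<^sub>R u) u - f' (z + s *\<^sub>R u) u - h *\<^sub>R P v" for s
    have lin: "linear (f' y)" if "y \<in> S" for y using f[OF that] has_derivative_linear by blast
    have K: "(K has_derivative (\<lambda>t. t *\<^sub>R K' s)) (at s within {0..h})" if "s \<in> {0..h}" for s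
    proof -
      have *: "((\<lambda>s. f (c + s *\<^sub>R u)) has_derivative (\<lambda>t. f' (c + s *\<^sub>R u) (t *\<^sub>R u))) (at s within {0..h})"
        if "c + s *\<^sub>R u \<in> S" for c
      proof -
        have "((\<lambda>s. c + s *\<^sub>R u) has_derivative (\<lambda>t. t *\<^sub>R u)) (at s within {0..h})"
          by (auto intro!: derivative_eq_intros)
        from has_derivative_compose[OF this f[OF that]] show ?thesis .
      qed
      have "(K has_derivative (\<lambda>t. f' (z + h *\<^sub>R v + s *\<^sub>R u) (t *\<^sub>R u)
          - f' (z + s *\<^sub>R u) (t *\<^sub>R u) - (t * h) *\<^sub>R P v)) (at s within {0..h})"
        unfolding K_def
        by (intro has_derivative_diff * S1 that) (auto intro!: derivative_eq_intros)
      then show ?thesis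
        by (simp add: K'_def linear_cmul[OF lin[OF S1(1)[OF that]]] linear_cmul[OF lin[OF S1(2)[OF that]]] scaleR_diff_right)
    qed
    have K'b: "norm (K' s) \<le> \<epsilon> * h" if s: "s \<in> {0..h}" for s
    proof -
      let ?y1 = "z + h *\<^sub>R v + s *\<^sub>R u" and ?y2 = "z + s *\<^sub>R u"
      have e1: "norm (f' ?y1 u - f' z u - P (?y1 - z)) \<le> \<epsilon> / N * (h * norm u + h * norm v)"
      proof -
        have *: "norm (?y1 - z) \<le> h * norm u + h * norm v" using n2[OF s] by (simp add: add.commute)
        then have "norm (?y1 - z) < d" using b by linarith
        from d(2)[OF this] * N \<open>\<epsilon> > 0\<close> show ?thesis
          by (elim order.trans) (intro mult_left_mono, auto)
      qed
      have e2: "norm (f' ?y2 u - f' z u - P (?y2 - z)) \<le> \<epsilon> / N * (h * norm u)"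
      proof -
        have *: "norm (?y2 - z) \<le> h * norm u" using n1[OF s] by simp
        then have "norm (?y2 - z) < d" using b by linarith
        from d(2)[OF this] * N \<open>\<epsilon> > 0\<close> show ?thesis
          by (elim order.trans) (intro mult_left_mono, auto)
      qed
      have "K' s = (f' ?y1 u - f' z u - P (?y1 - z)) - (f' ?y2 u - f' z u - P (?y2 - z))"
        by (simp add: K'_def P.add P.scaleR)
      then have "norm (K' s) \<le> \<epsilon> / N * (h * norm u + h * norm v) + \<epsilon> / N * (h * norm u)"
        using e1 e2 by (simp only:) (rule order.trans[OF norm_triangle_ineq4 add_mono])
      also have "\<dots> = \<epsilon> / N * h * (N - 1)"
        by (simp add: N_def algebra_simps flip: add_divide_distrib)
      also have "\<dots> \<le> \<epsilon> / N * h * N" using N \<open>\<epsilon> > 0\<close> h by (intro mult_left_mono) auto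
      finally show ?thesis using N by simp
    qed
    have "norm (K h - K 0) \<le> (\<epsilon> * h) * norm (h - 0)"
    proof (rule differentiable_bound[where S = "{0..h}"])
      show "onorm (\<lambda>t. t *\<^sub>R K' s) \<le> \<epsilon> * h" if "s \<in> {0..h}" for s
        by (rule onorm_scaleR_left_le[OF K'b[OF that]])
    qed (use K h in auto)
    then show "norm (f (z + h *\<^sub>R u + h *\<^sub>R v) - f (z + h *\<^sub>R u) - f (z + h *\<^sub>R v) + f z
        - (h * h) *\<^sub>R P v) \<le> \<epsilon> * (h * h)"
      using h by (simp add: K_def algebra_simps)
  qed
qed

text \<open>The second difference is symmetric in \<open>u\<close> and \<open>v\<close>, hence so is its limit after division by
  \<open>h\<^sup>2\<close>.\<close>

lemma second_derivative_symmetric: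
  fixes f :: "'e::real_normed_vector \<Rightarrow> 'b::real_normed_vector"
  assumes S: "open S" "z \<in> S" and f: "\<And>y. y \<in> S \<Longrightarrow> (f has_derivative f' y) (at y)"
    and P: "((\<lambda>y. f' y u) has_derivative P) (at z)"
    and Q: "((\<lambda>y. f' y v) has_derivative Q) (at z)"
  shows "P v = Q u"
proof (rule ccontr)
  assume ne: "P v \<noteq> Q u"
  define \<epsilon> where "\<epsilon> = norm (P v - Q u) / 4"
  have \<epsilon>: "\<epsilon> > 0" using ne by (simp add: \<epsilon>_def)
  obtain d1 where d1: "d1 > 0" "\<And>h. 0 < h \<Longrightarrow> h < d1 \<Longrightarrow>
    norm (f (z + h *\<^sub>R u + h *\<^sub>R v) - f (z + h *\<^sub>R u) - f (z + h *\<^sub>R v) + f z - (h * h) *\<^sub>R P v)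
      \<le> \<epsilon> * (h * h)" using second_difference_estimate[OF S f P \<epsilon>] by blast
  obtain d2 where d2: "d2 > 0" "\<And>h. 0 < h \<Longrightarrow> h < d2 \<Longrightarrow>
    norm (f (z + h *\<^sub>R v + h *\<^sub>R u) - f (z + h *\<^sub>R v) - f (z + h *\<^sub>R u) + f z - (h * h) *\<^sub>R Q u)
      \<le> \<epsilon> * (h * h)" using second_difference_estimate[OF S f Q \<epsilon>] by blast
  define h where "h = min d1 d2 / 2"
  have h: "0 < h" "h < d1" "h < d2" using d1 d2 by (auto simp: h_def)
  let ?D = "f (z + h *\<^sub>R u + h *\<^sub>R v) - f (z + h *\<^sub>R u) - f (z + h *\<^sub>R v) + f z"
  have "norm ((h * h) *\<^sub>R (P v - Q u)) = norm ((?D - (h * h) *\<^sub>R Q u) - (?D - (h * h) *\<^sub>R P v))"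
    by (simp add: algebra_simps)
  also have "\<dots> \<le> \<epsilon> * (h * h) + \<epsilon> * (h * h)"
  proof (rule order.trans[OF norm_triangle_ineq4 add_mono])
    have "?D - (h * h) *\<^sub>R Q u = f (z + h *\<^sub>R v + h *\<^sub>R u) - f (z + h *\<^sub>R v) - f (z + h *\<^sub>R u)
        + f z - (h * h) *\<^sub>R Q u" by (simp add: algebra_simps)
    then show "norm (?D - (h * h) *\<^sub>R Q u) \<le> \<epsilon> * (h * h)" using d2(2)[OF h(1,3)] by (simp only:)
    show "norm (?D - (h * h) *\<^sub>R P v) \<le> \<epsilon> * (h * h)" using d1(2)[OF h(1,2)] .
  qed
  finally have "(h * h) * (4 * \<epsilon>) \<le> 2 * \<epsilon> * (h * h)" by (simp add: \<epsilon>_def)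
  then show False using \<epsilon> h by simp
qed

section \<open>Curves on the unit interval and differential equations\<close>

lemma at_within_unit_interval_nontrivial: "t \<in> {0..1::real} \<Longrightarrow> at t within {0..1} \<noteq> bot"
  by (simp add: trivial_limit_within islimpt_Icc)

lemma affine_in_unit_interval:
  fixes t h \<tau> :: real
  assumes "t \<in> {0..1}" "t + h \<in> {0..1}" "\<tau> \<in> {0..1}"
  shows "t + h * \<tau> \<in> {0..1}"
proof -
  have "t + h * \<tau> = (1 - \<tau>) * t + \<tau> * (t + h)" by (simp add: algebra_simps)
  moreover have "\<dots> \<in> {0..1}"
    using convexD[OF convex_real_interval(5), of t 0 1 "t + h" "1 - \<tau>" \<tau>] assms by simp
  ultimately show ?thesis by simp
qed

lemma has_vector_derivative_affine_reparametrisation: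
  fixes F :: "real \<Rightarrow> 'b::real_normed_vector"
  assumes F: "(F has_vector_derivative F') (at (t + h * \<tau>) within {0..1})"
    and t: "t \<in> {0..1}" "t + h \<in> {0..1}"
  shows "((\<lambda>\<tau>. F (t + h * \<tau>)) has_vector_derivative h *\<^sub>R F') (at \<tau> within {0..1})"
proof -
  have im: "(\<lambda>\<tau>. t + h * \<tau>) ` {0..1} \<subseteq> {0..1}" using affine_in_unit_interval[OF t] by auto
  have "((\<lambda>\<tau>. t + h * \<tau>) has_vector_derivative h) (at \<tau> within {0..1})"
    by (auto intro!: derivative_eq_intros)
  from vector_diff_chain_within[OF this has_vector_derivative_within_subset[OF F im]]
  show ?thesis by (simp add: o_def)
qed

text \<open>Infinitesimal control suffices: for every \<open>\<epsilon>\<close> the set of times up to which the bound with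
  constant \<open>K + \<epsilon>\<close> holds is closed, and the estimate around its supremum would extend it further.\<close>

lemma pointwise_lipschitz_imp_lipschitz:
  fixes \<psi> :: "real \<Rightarrow> real"
  assumes ab: "a \<le> b" and loc: "\<And>t \<epsilon>. t \<in> {a..b} \<Longrightarrow> \<epsilon> > 0 \<Longrightarrow> \<exists>\<delta>>0. \<forall>s\<in>{a..b}. \<bar>s - t\<bar> < \<delta> \<longrightarrow>
    \<bar>\<psi> s - \<psi> t\<bar> \<le> (K + \<epsilon>) * \<bar>s - t\<bar>"
    and "K \<ge> 0"
  shows "\<bar>\<psi> b - \<psi> a\<bar> \<le> K * (b - a)"
proof -
  have cont: "continuous_on {a..b} \<psi>"
    unfolding continuous_on_iff
  proof (intro ballI allI impI)
    fix t e :: real assume t: "t \<in> {a..b}" and e: "e > 0"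
    obtain d where d: "d > 0" "\<forall>s\<in>{a..b}. \<bar>s - t\<bar> < d \<longrightarrow> \<bar>\<psi> s - \<psi> t\<bar> \<le> (K + 1) * \<bar>s - t\<bar>"
      using loc[OF t, of 1] by auto
    have "\<bar>\<psi> s - \<psi> t\<bar> < e" if "s \<in> {a..b}" "\<bar>s - t\<bar> < min d (e / (K + 1))" for s
    proof -
      have "\<bar>\<psi> s - \<psi> t\<bar> \<le> (K + 1) * \<bar>s - t\<bar>" using d that by auto
      also have "\<dots> < (K + 1) * (e / (K + 1))" using that \<open>K \<ge> 0\<close> by (intro mult_strict_left_mono) auto
      finally show ?thesis using \<open>K \<ge> 0\<close> by simp
    qed
    then show "\<exists>d>0. \<forall>s\<in>{a..b}. dist s t < d \<longrightarrow> dist (\<psi> s) (\<psi> t) < e"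
      using d(1) e \<open>K \<ge> 0\<close> by (intro exI[of _ "min d (e / (K + 1))"]) (auto simp: dist_real_def)
  qed
  have "\<bar>\<psi> b - \<psi> a\<bar> \<le> (K + \<epsilon>) * (b - a)" if \<epsilon>: "\<epsilon> > 0" for \<epsilon>
  proof -
    define S where "S = {t \<in> {a..b}. \<bar>\<psi> t - \<psi> a\<bar> \<le> (K + \<epsilon>) * (t - a)}"
    have clS: "closed S" unfolding S_def
      by (intro continuous_on_closed_Collect_le continuous_intros cont closed_atLeastAtMost) 
    have aS: "a \<in> S" using ab by (simp add: S_def)
    have bd: "bdd_above S" by (auto simp: S_def bdd_above_def)
    define t where "t = Sup S"
    have tS: "t \<in> S" unfolding t_def using clS aS bd by (intro closed_contains_Sup) auto
    have "t = b"
    proof (rule ccontr)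
      assume "t \<noteq> b"
      then have tb: "t < b" using tS by (auto simp: S_def)
      obtain d where d: "d > 0" "\<forall>s\<in>{a..b}. \<bar>s - t\<bar> < d \<longrightarrow> \<bar>\<psi> s - \<psi> t\<bar> \<le> (K + \<epsilon>) * \<bar>s - t\<bar>"
        using loc[of t \<epsilon>] \<epsilon> tS by (auto simp: S_def)
      define s where "s = min b (t + d / 2)"
      have s: "t < s" "s \<in> {a..b}" "\<bar>s - t\<bar> < d" using tb d tS by (auto simp: s_def S_def)
      have "\<bar>\<psi> s - \<psi> a\<bar> \<le> \<bar>\<psi> s - \<psi> t\<bar> + \<bar>\<psi> t - \<psi> a\<bar>" by simp
      also have "\<dots> \<le> (K + \<epsilon>) * (s - t) + (K + \<epsilon>) * (t - a)"
      proof (rule add_mono)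
        show "\<bar>\<psi> s - \<psi> t\<bar> \<le> (K + \<epsilon>) * (s - t)" using d(2)[rule_format, OF s(2,3)] s(1) by simp
      qed (use tS in \<open>simp add: S_def\<close>)
      also have "\<dots> = (K + \<epsilon>) * (s - a)" by (simp add: algebra_simps)
      finally have "s \<in> S" using s by (simp add: S_def)
      then have "s \<le> t" unfolding t_def using bd by (rule cSup_upper)
      then show False using s by simp
    qed
    then show ?thesis using tS by (simp add: S_def)
  qed
  note * = this
  show ?thesis
  proof (cases "a = b")
    case False
    show ?thesis
    proof (rule field_le_epsilon)
      fix e :: real assume "e > 0"
      have "\<bar>\<psi> b - \<psi> a\<bar> \<le> (K + e / (b - a)) * (b - a)" using *[of "e / (b - a)"] \<open>e > 0\<close> ab False by simp
      also have "\<dots> = K * (b - a) + e" using False by (simp add: distrib_right)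
      finally show "\<bar>\<psi> b - \<psi> a\<bar> \<le> K * (b - a) + e" .
    qed
  qed simp
qed

text \<open>With the coefficients bounded by \<open>1/2\<close>, the operator
  \<open>V \<mapsto> (\<lambda>t. u + \<integral>\<^sub>0\<^sup>t A s (V s) ds)\<close> is a contraction for the supremum norm on the whole
  interval \<open>[0,1]\<close>.\<close>

lemma linear_ode_solution:
  fixes A :: "real \<Rightarrow> 'e::euclidean_space \<Rightarrow> 'e"
  assumes lin: "\<And>t. t \<in> {0..1} \<Longrightarrow> linear (A t)"
    and bd: "\<And>t v. t \<in> {0..1} \<Longrightarrow> norm (A t v) \<le> norm v / 2"
    and cont: "\<And>v. continuous_on {0..1} (\<lambda>t. A t v)"
  obtains V where "V 0 = u"
    "\<And>t. t \<in> {0..1} \<Longrightarrow> (V has_vector_derivative A t (V t)) (at t within {0..1})"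
proof -
  have cA: "continuous_on {0..1} (\<lambda>s. A s (apply_bcontfun W s))" for W :: "real \<Rightarrow>\<^sub>C 'e"
    by (rule continuous_on_linear_family[where A = A, OF lin cont]) auto
  define h where "h W t = u + integral {0..t} (\<lambda>s. A s (apply_bcontfun W s))" for W :: "real \<Rightarrow>\<^sub>C 'e" and t
  have ch: "continuous_on (cbox 0 1) (h W)" for W
    unfolding h_def box_real
    by (intro continuous_intros indefinite_integral_continuous_1 integrable_continuous_real cA)
  \<comment> \<open>Bounded continuous functions live on the whole real line, so values outside \<open>[0,1]\<close> are frozen at the end points.\<close>
  have "\<exists>W'. \<forall>t. apply_bcontfun W' t = h W (clamp 0 1 t)" for W
    by (rule continuous_on_cbox_bcontfunE[OF ch[of W]]) blast
  then obtain \<Phi> where \<Phi>: "\<And>W t. apply_bcontfun (\<Phi> W) t = h W (clamp 0 1 t)" by metis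
  have int: "(\<lambda>s. A s (apply_bcontfun W s)) integrable_on {0..t}" if "t \<in> {0..1}" for W t
    using that by (intro integrable_continuous_real continuous_on_subset[OF cA]) auto
  have contr: "dist (\<Phi> W1) (\<Phi> W2) \<le> 1/2 * dist W1 W2" for W1 W2
  proof (rule dist_bound)
    fix t
    define r :: real where "r = clamp 0 1 t"
    have r: "r \<in> {0..1}" unfolding r_def using clamp_in_interval[of 0 1 t] by simp
    have "dist (apply_bcontfun (\<Phi> W1) t) (apply_bcontfun (\<Phi> W2) t) =
        norm (integral {0..r} (\<lambda>s. A s (apply_bcontfun W1 s) - A s (apply_bcontfun W2 s)))"
      by (simp add: \<Phi> h_def dist_norm integral_diff[OF int[OF r] int[OF r]] flip: r_def)
    also have "\<dots> \<le> 1/2 * dist W1 W2 * (r - 0)"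
    proof (rule integral_bound)
      show "continuous_on {0..r} (\<lambda>s. A s (apply_bcontfun W1 s) - A s (apply_bcontfun W2 s))"
        using r by (intro continuous_on_diff continuous_on_subset[OF cA]) auto
      fix s assume "s \<in> {0..r}"
      then have s: "s \<in> {0..1}" using r by auto
      have "norm (A s (apply_bcontfun W1 s) - A s (apply_bcontfun W2 s))
          = norm (A s (apply_bcontfun W1 s - apply_bcontfun W2 s))"
        using lin[OF s] by (simp add: linear_diff)
      also have "\<dots> \<le> dist (apply_bcontfun W1 s) (apply_bcontfun W2 s) / 2"
        using bd[OF s] by (simp add: dist_norm)
      also have "\<dots> \<le> dist W1 W2 / 2" using dist_bounded by (intro divide_right_mono) auto
      finally show "norm (A s (apply_bcontfun W1 s) - A s (apply_bcontfun W2 s)) \<le> 1/2 * dist W1 W2"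
        by simp
    qed (use r in auto)
    also have "\<dots> \<le> 1/2 * dist W1 W2 * 1" using r by (intro mult_left_mono) auto
    finally show "dist (apply_bcontfun (\<Phi> W1) t) (apply_bcontfun (\<Phi> W2) t) \<le> 1/2 * dist W1 W2" by simp
  qed
  obtain W where W: "\<Phi> W = W"
    using banach_fix_type[of "1/2" \<Phi>] contr by auto
  have eq: "apply_bcontfun W t = h W t" if "t \<in> {0..1}" for t
    using \<Phi>[of W t] W that by (simp add: clamp_cancel_cbox)
  show ?thesis
  proof
    show "h W 0 = u" by (simp add: h_def)
    fix t :: real assume t: "t \<in> {0..1}"
    have "(h W has_vector_derivative 0 + A t (apply_bcontfun W t)) (at t within {0..1})"
      unfolding h_def
      by (intro has_vector_derivative_add has_vector_derivative_const
          integral_has_vector_derivative cA t)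
    then show "(h W has_vector_derivative A t (h W t)) (at t within {0..1})"
      using eq[OF t] by simp
  qed
qed

text \<open>If \<open>u\<close> vanishes at both ends, then \<open>u'\<close> has mean zero, so \<open>u' t\<close> is an average of the
  differences \<open>u' t - u' s\<close>, each of which is at most the bound on the second derivative.\<close>

lemma norm_derivative_le_second_derivative:
  fixes u :: "real \<Rightarrow> 'e::real_normed_vector"
  assumes u: "\<And>t. t \<in> {0..1} \<Longrightarrow> (u has_vector_derivative u' t) (at t within {0..1})"
    and u': "\<And>t. t \<in> {0..1} \<Longrightarrow> (u' has_vector_derivative u'' t) (at t within {0..1})"
    and bd: "\<And>t. t \<in> {0..1} \<Longrightarrow> norm (u'' t) \<le> B"
    and ends: "u 0 = 0" "u 1 = 0" and t: "t \<in> {0..1}"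
  shows "norm (u' t) \<le> B"
proof -
  have B: "B \<ge> 0" using bd[OF t] norm_ge_zero order.trans by blast
  have on: "onorm (\<lambda>r. r *\<^sub>R v) \<le> norm v" for v :: 'e
    by (rule onorm_scaleR_left_le) simp
  have 1: "norm (u' s - u' t) \<le> B" if "s \<in> {0..1}" for s
  proof -
    have "norm (u' s - u' t) \<le> B * norm (s - t)"
      by (rule differentiable_bound[where S = "{0..1}" and f' = "\<lambda>s r. r *\<^sub>R u'' s"])
        (use u' bd on t that in \<open>auto simp: has_vector_derivative_def intro: order.trans\<close>)
    also have "\<dots> \<le> B * 1" using B t that by (intro mult_left_mono) (auto simp: abs_if)
    finally show ?thesis by simp
  qed
  \<comment> \<open>This function has derivative \<open>u' s - u' t\<close> and total increment \<open>- u' t\<close>.\<close>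
  define k where "k s = u s - s *\<^sub>R u' t" for s
  have k: "(k has_vector_derivative u' s - u' t) (at s within {0..1})" if "s \<in> {0..1}" for s
    unfolding k_def by (auto intro!: derivative_eq_intros u that)
  have "norm (k 1 - k 0) \<le> B * norm (1 - 0 :: real)"
    by (rule differentiable_bound[where S = "{0..1}" and f' = "\<lambda>s r. r *\<^sub>R (u' s - u' t)"])
      (use k 1 on in \<open>auto simp: has_vector_derivative_def intro: order.trans\<close>)
  then show ?thesis by (simp add: k_def ends)
qed

text \<open>Two solutions of \<open>z'' = - B z z' z'\<close> with common end points and velocities of size \<open>K\<close> have
  second derivatives of size \<open>K\<^sup>2\<close>, so their velocities differ by \<open>O(K\<^sup>2)\<close>.  Feeding this back into
  the equation, and using that \<open>B\<close> is within \<open>\<epsilon>\<close> of \<open>B z0\<close> along both curves, improves the bound to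
  \<open>\<epsilon> O(K\<^sup>2) + O(K\<^sup>3)\<close>, which is \<open>o(K\<^sup>2)\<close> along shrinking curves if \<open>B\<close> is continuous.\<close>

lemma geodesic_equation_endpoint_estimate:
  fixes B :: "'e::real_normed_vector \<Rightarrow> 'e \<Rightarrow> 'e \<Rightarrow> 'e"
  assumes bil: "bilinear (B z0)" and z0: "z0 \<in> S"
    and near: "\<And>z u v. z \<in> S \<Longrightarrow> norm (B z u v - B z0 u v) \<le> \<epsilon> * norm u * norm v"
    and bound: "\<And>z u v. z \<in> S \<Longrightarrow> norm (B z u v) \<le> C * norm u * norm v"
    and pos: "\<epsilon> \<ge> 0" "C \<ge> 0"
    and p: "\<And>t. t \<in> {0..1} \<Longrightarrow> (p has_vector_derivative p' t) (at t within {0..1})"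
      "\<And>t. t \<in> {0..1} \<Longrightarrow> (p' has_vector_derivative - B (p t) (p' t) (p' t)) (at t within {0..1})"
      "\<And>t. t \<in> {0..1} \<Longrightarrow> p t \<in> S" "\<And>t. t \<in> {0..1} \<Longrightarrow> norm (p' t) \<le> K"
    and q: "\<And>t. t \<in> {0..1} \<Longrightarrow> (q has_vector_derivative q' t) (at t within {0..1})"
      "\<And>t. t \<in> {0..1} \<Longrightarrow> (q' has_vector_derivative - B (q t) (q' t) (q' t)) (at t within {0..1})"
      "\<And>t. t \<in> {0..1} \<Longrightarrow> q t \<in> S" "\<And>t. t \<in> {0..1} \<Longrightarrow> norm (q' t) \<le> K"
    and ends: "p 0 = q 0" "p 1 = q 1" and t: "t \<in> {0..1}"
  shows "norm (p' t - q' t) \<le> (2 * \<epsilon> + 4 * C\<^sup>2 * K) * K\<^sup>2"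
proof -
  have K: "K \<ge> 0" using p(4)[OF t] norm_ge_zero order.trans by blast
  have du: "((\<lambda>t. p t - q t) has_vector_derivative p' t - q' t) (at t within {0..1})" if "t \<in> {0..1}" for t
    using p(1)[OF that] q(1)[OF that] by (rule has_vector_derivative_diff)
  have du': "((\<lambda>t. p' t - q' t) has_vector_derivative
      - B (p t) (p' t) (p' t) - - B (q t) (q' t) (q' t)) (at t within {0..1})" if "t \<in> {0..1}" for t
    using p(2)[OF that] q(2)[OF that] by (rule has_vector_derivative_diff)
  have mono: "a * norm u * norm v \<le> a * b * d"
    if "a \<ge> 0" "b \<ge> 0" "norm u \<le> b" "norm v \<le> d" for a b d and u v :: 'e
    using that by (intro mult_mono) auto
  have first: "norm (p' t - q' t) \<le> 2 * C * K\<^sup>2" if "t \<in> {0..1}" for t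
  proof (rule norm_derivative_le_second_derivative[OF du du' _ _ _ that])
    fix t :: real assume t: "t \<in> {0..1}"
    have "norm (B (p t) (p' t) (p' t)) \<le> C * K * K" "norm (B (q t) (q' t) (q' t)) \<le> C * K * K"
      using order.trans[OF bound[OF p(3)[OF t]] mono[OF pos(2) K p(4)[OF t] p(4)[OF t]]]
        order.trans[OF bound[OF q(3)[OF t]] mono[OF pos(2) K q(4)[OF t] q(4)[OF t]]] by auto
    then show "norm (- B (p t) (p' t) (p' t) - - B (q t) (q' t) (q' t)) \<le> 2 * C * K\<^sup>2"
      using norm_triangle_ineq4[of "B (q t) (q' t) (q' t)" "B (p t) (p' t) (p' t)"]
      by (simp add: power2_eq_square mult.assoc)
  qed (use ends in auto)
  show ?thesis
  proof (rule norm_derivative_le_second_derivative[OF du du' _ _ _ t])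
    fix t :: real assume t: "t \<in> {0..1}"
    let ?a = "p' t" and ?b = "q' t"
    have ab: "norm (?a - ?b) \<le> 2 * C * K\<^sup>2" by (rule first[OF t])
    have e1: "norm (B (p t) ?a ?a - B z0 ?a ?a) \<le> \<epsilon> * K * K"
      by (rule order.trans[OF near[OF p(3)[OF t]] mono[OF pos(1) K p(4)[OF t] p(4)[OF t]]])
    have e2: "norm (B (q t) ?b ?b - B z0 ?b ?b) \<le> \<epsilon> * K * K"
      by (rule order.trans[OF near[OF q(3)[OF t]] mono[OF pos(1) K q(4)[OF t] q(4)[OF t]]])
    have e3: "norm (B z0 (?a - ?b) ?a) \<le> C * (2 * C * K\<^sup>2) * K"
      by (rule order.trans[OF bound[OF z0] mono[OF pos(2) _ ab p(4)[OF t]]]) (use pos K in simp)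
    have e4: "norm (B z0 ?b (?a - ?b)) \<le> C * K * (2 * C * K\<^sup>2)"
      by (rule order.trans[OF bound[OF z0] mono[OF pos(2) K q(4)[OF t] ab]])
    have "- B (p t) ?a ?a - - B (q t) ?b ?b = (B (q t) ?b ?b - B z0 ?b ?b) - (B (p t) ?a ?a - B z0 ?a ?a)
        - (B z0 (?a - ?b) ?a + B z0 ?b (?a - ?b))"
      by (simp add: bilinear_lsub[OF bil] bilinear_rsub[OF bil])
    also have "norm \<dots> \<le> (\<epsilon> * K * K + \<epsilon> * K * K) + (C * (2 * C * K\<^sup>2) * K + C * K * (2 * C * K\<^sup>2))"
      by (intro order.trans[OF norm_triangle_ineq4] add_mono e1 e2
          order.trans[OF norm_triangle_ineq] e3 e4)
    also have "\<dots> = (2 * \<epsilon> + 4 * C\<^sup>2 * K) * K\<^sup>2"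
      by (simp add: power2_eq_square algebra_simps)
    finally show "norm (- B (p t) ?a ?a - - B (q t) ?b ?b) \<le> (2 * \<epsilon> + 4 * C\<^sup>2 * K) * K\<^sup>2" .
  qed (use ends in auto)
qed

section \<open>Charts and tangent spaces\<close>

lemma smooth_on_imp_continuous_on: "smooth_on S f \<Longrightarrow> continuous_on S f"
  unfolding smooth_on_def by (metis Ck_on.simps(1))

lemma smooth_on_imp_differentiable: "smooth_on S f \<Longrightarrow> z \<in> S \<Longrightarrow> f differentiable at z"
  unfolding smooth_on_def by (metis Ck_on.simps(2))

lemma smooth_on_frechet_derivative:
  "smooth_on S f \<Longrightarrow> smooth_on S (\<lambda>z. frechet_derivative f (at z) v)"
  unfolding smooth_on_def by (metis Ck_on.simps(2))

lemma charts_at_iff: "c \<in> charts_at M x \<longleftrightarrow> c \<in> atlas M \<and> x \<in> cdom c"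
  by (simp add: charts_at_def)

definition overlap :: "('m, 'e) chart \<Rightarrow> ('m, 'e) chart \<Rightarrow> 'e set" where
  "overlap c c' = cmap c ` (cdom c \<inter> cdom c')"

abbreviation dtrans ::
    "('m, 'e::euclidean_space) chart \<Rightarrow> ('m, 'e) chart \<Rightarrow> 'e \<Rightarrow> 'e \<Rightarrow> 'e" where
  "dtrans c c' z \<equiv> frechet_derivative (transition c c') (at z)"

abbreviation dmetric ::
    "('m, 'e::euclidean_space) rmfd \<Rightarrow> ('m, 'e) chart \<Rightarrow> 'e \<Rightarrow> 'e \<Rightarrow> 'e \<Rightarrow> 'e \<Rightarrow> real" where
  "dmetric M c z e u v \<equiv> frechet_derivative (\<lambda>z'. gcoord M c z' u v) (at z) e"

locale riemannian =
  fixes M :: "('m::{t2_space, second_countable_topology}, 'e::euclidean_space) rmfd"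
  assumes riemannian: "riemannian_manifold M"
begin

lemma atlas: "smooth_atlas (atlas M)"
  using riemannian by (simp add: riemannian_manifold_def)

lemma metric_axioms:
  assumes "u \<in> tangent_space M x" "v \<in> tangent_space M x"
  shows metric_sym: "metric M x u v = metric M x v u"
    and metric_tplus: "w \<in> tangent_space M x \<Longrightarrow> metric M x (tplus u v) w = metric M x u w + metric M x v w"
    and metric_tscale: "metric M x (tscale a u) v = a * metric M x u v"
    and metric_pos: "u \<noteq> tzero \<Longrightarrow> metric M x u u > 0"
  using riemannian assms unfolding riemannian_manifold_def by blast+

lemma chart:
  assumes "c \<in> atlas M"
  shows open_cdom: "open (cdom c)" and open_cimg: "open (cimg c)"
    and homeomorphism_chart: "homeomorphism (cdom c) (cimg c) (cmap c) (cinv c)"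
  using assms atlas by (auto simp: smooth_atlas_def is_chart_def)

lemma cinv_cmap [simp]: "c \<in> atlas M \<Longrightarrow> x \<in> cdom c \<Longrightarrow> cinv c (cmap c x) = x"
  using homeomorphism_chart homeomorphism_apply1 by blast

lemma cmap_cinv [simp]: "c \<in> atlas M \<Longrightarrow> z \<in> cimg c \<Longrightarrow> cmap c (cinv c z) = z"
  using homeomorphism_chart homeomorphism_apply2 by blast

lemma cmap_in_cimg: "x \<in> cdom c \<Longrightarrow> cmap c x \<in> cimg c"
  by (simp add: cimg_def)

lemma cinv_in_cdom: "c \<in> atlas M \<Longrightarrow> z \<in> cimg c \<Longrightarrow> cinv c z \<in> cdom c"
  using homeomorphism_chart homeomorphism_image2 by blast

lemma continuous_on_cmap: "c \<in> atlas M \<Longrightarrow> continuous_on (cdom c) (cmap c)"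
  using homeomorphism_chart homeomorphism_cont1 by blast

lemma continuous_on_cinv: "c \<in> atlas M \<Longrightarrow> continuous_on (cimg c) (cinv c)"
  using homeomorphism_chart homeomorphism_cont2 by blast

lemma chart_exists: obtains c where "c \<in> charts_at M x"
proof -
  have "x \<in> (\<Union>c\<in>atlas M. cdom c)" using atlas by (simp add: smooth_atlas_def)
  then show ?thesis using that by (auto simp: charts_at_iff)
qed

lemma open_overlap:
  assumes "c \<in> atlas M" "c' \<in> atlas M"
  shows "open (overlap c c')"
proof -
  have "openin (top_of_set (cdom c)) (cdom c \<inter> cdom c')"
    using open_cdom[OF assms(2)] by (rule openin_open_Int)
  then have "openin (top_of_set (cimg c)) (overlap c c')"
    unfolding overlap_def
    using homeomorphism_chart[OF assms(1)] homeomorphism_imp_open_map by blast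
  then show ?thesis using open_cimg[OF assms(1)] openin_open_trans by blast
qed

lemma mem_overlap:
  assumes "c \<in> atlas M"
  shows "z \<in> overlap c c' \<longleftrightarrow> z \<in> cimg c \<and> cinv c z \<in> cdom c'"
proof
  assume "z \<in> overlap c c'"
  then show "z \<in> cimg c \<and> cinv c z \<in> cdom c'"
    using assms by (auto simp: overlap_def cmap_in_cimg)
next
  assume "z \<in> cimg c \<and> cinv c z \<in> cdom c'"
  then show "z \<in> overlap c c'"
    unfolding overlap_def using assms
    by (intro image_eqI[where x = "cinv c z"]) (auto simp: cinv_in_cdom)
qed

lemma cmap_in_overlap: "c \<in> charts_at M x \<Longrightarrow> c' \<in> charts_at M x \<Longrightarrow> cmap c x \<in> overlap c c'"
  by (auto simp: overlap_def charts_at_iff)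

lemma transition_cmap [simp]: "c \<in> charts_at M x \<Longrightarrow> transition c c' (cmap c x) = cmap c' x"
  by (simp add: transition_def charts_at_iff)

lemma smooth_transition: "c \<in> atlas M \<Longrightarrow> c' \<in> atlas M \<Longrightarrow> smooth_on (overlap c c') (transition c c')"
  using atlas by (auto simp: smooth_atlas_def overlap_def)

lemma has_derivative_transition:
  assumes "c \<in> atlas M" "c' \<in> atlas M" "z \<in> overlap c c'"
  shows "(transition c c' has_derivative dtrans c c' z) (at z)"
  using smooth_on_imp_differentiable[OF smooth_transition[OF assms(1,2)] assms(3)]
    frechet_derivative_works by blast

lemma linear_dtrans:
  assumes "c \<in> atlas M" "c' \<in> atlas M" "z \<in> overlap c c'"
  shows "linear (dtrans c c' z)"
  using has_derivative_transition[OF assms] has_derivative_linear by blast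

lemma transition_in_overlap:
  assumes "c \<in> atlas M" "c' \<in> atlas M" "z \<in> overlap c c'"
  shows "transition c c' z \<in> overlap c' c" "transition c c' z \<in> cimg c'"
    "cinv c' (transition c c' z) = cinv c z"
  using assms by (auto simp: mem_overlap transition_def cmap_in_cimg cinv_in_cdom)

lemma dtrans_comp:
  assumes "c \<in> charts_at M x" "c' \<in> charts_at M x" "c'' \<in> charts_at M x"
  shows "dtrans c' c'' (cmap c' x) (dtrans c c' (cmap c x) e) = dtrans c c'' (cmap c x) e"
proof -
  have A: "c \<in> atlas M" "c' \<in> atlas M" "c'' \<in> atlas M" using assms by (auto simp: charts_at_iff)
  have "(transition c' c'' has_derivative dtrans c' c'' (cmap c' x)) (at (transition c c' (cmap c x)))"
    using has_derivative_transition[OF A(2,3) cmap_in_overlap[OF assms(2,3)]] assms(1) by simp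
  from has_derivative_compose[OF has_derivative_transition[OF A(1,2) cmap_in_overlap[OF assms(1,2)]] this]
  have 1: "((\<lambda>z. transition c' c'' (transition c c' z)) has_derivative
      (\<lambda>e. dtrans c' c'' (cmap c' x) (dtrans c c' (cmap c x) e))) (at (cmap c x))" .
  have "(transition c c'' has_derivative
      (\<lambda>e. dtrans c' c'' (cmap c' x) (dtrans c c' (cmap c x) e))) (at (cmap c x))"
  proof (rule has_derivative_transform_within_open[OF 1])
    show "open (overlap c c')" using A by (simp add: open_overlap)
    show "cmap c x \<in> overlap c c'" using assms by (simp add: cmap_in_overlap)
    show "transition c' c'' (transition c c' z) = transition c c'' z" if "z \<in> overlap c c'" for z
      using transition_in_overlap(3)[OF A(1,2) that] by (simp add: transition_def)
  qed
  from frechet_derivative_at[OF this] show ?thesis by metis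
qed

lemma dtrans_self:
  assumes "c \<in> atlas M" "z \<in> cimg c"
  shows "dtrans c c z e = e"
proof -
  have "(transition c c has_derivative (\<lambda>e. e)) (at z)"
    by (rule has_derivative_transform_within_open[OF has_derivative_ident open_cimg[OF assms(1)] assms(2)])
      (simp add: transition_def assms)
  from frechet_derivative_at[OF this] show ?thesis by metis
qed

lemma dtrans_inverse:
  assumes "c \<in> charts_at M x" "c' \<in> charts_at M x"
  shows "dtrans c' c (cmap c' x) (dtrans c c' (cmap c x) e) = e"
  using dtrans_comp[OF assms assms(1)] assms by (simp add: dtrans_self charts_at_iff cmap_in_cimg)

lemma tangent_spaceI:
  assumes "\<And>c. c \<notin> charts_at M x \<Longrightarrow> v c = 0"
    and "\<And>c c'. c \<in> charts_at M x \<Longrightarrow> c' \<in> charts_at M x \<Longrightarrow> v c' = dtrans c c' (cmap c x) (v c)"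
  shows "v \<in> tangent_space M x"
  unfolding tangent_space_def using assms by blast

lemma tangent_spaceD:
  assumes "v \<in> tangent_space M x" "c \<in> charts_at M x" "c' \<in> charts_at M x"
  shows "dtrans c c' (cmap c x) (v c) = v c'"
proof (rule sym)
  show "v c' = dtrans c c' (cmap c x) (v c)" using assms unfolding tangent_space_def by blast
qed

lemma tangent_space_outside: "v \<in> tangent_space M x \<Longrightarrow> c \<notin> charts_at M x \<Longrightarrow> v c = 0"
  unfolding tangent_space_def by blast

lemma coord_vec_tangent:
  assumes "c \<in> charts_at M x"
  shows "coord_vec M c x e \<in> tangent_space M x"
  using assms by (intro tangent_spaceI) (auto simp: coord_vec_def dtrans_comp)

lemma coord_vec_self [simp]: "c \<in> charts_at M x \<Longrightarrow> coord_vec M c x e c = e"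
  by (simp add: coord_vec_def dtrans_self charts_at_iff cmap_in_cimg)

lemma coord_vec_tangent_eq:
  assumes "v \<in> tangent_space M x" "c \<in> charts_at M x"
  shows "coord_vec M c x (v c) = v"
proof (rule ext)
  fix c'
  show "coord_vec M c x (v c) c' = v c'"
  proof (cases "c' \<in> charts_at M x")
    case True
    then show ?thesis using tangent_spaceD[OF assms True] by (simp only: coord_vec_def if_True)
  next
    case False
    then show ?thesis
      using tangent_space_outside[OF assms(1) False] by (simp only: coord_vec_def if_False)
  qed
qed

lemma linear_dtrans_at:
  "c \<in> charts_at M x \<Longrightarrow> c' \<in> charts_at M x \<Longrightarrow> linear (dtrans c c' (cmap c x))"
  by (rule linear_dtrans) (auto simp: charts_at_iff overlap_def)

lemma coord_vec_add:
  assumes "c \<in> charts_at M x"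
  shows "coord_vec M c x (u + v) = tplus (coord_vec M c x u) (coord_vec M c x v)"
  using assms by (intro ext) (simp add: coord_vec_def tplus_def linear_add linear_dtrans_at)

lemma coord_vec_scale:
  assumes "c \<in> charts_at M x"
  shows "coord_vec M c x (a *\<^sub>R v) = tscale a (coord_vec M c x v)"
  using assms by (intro ext) (simp add: coord_vec_def tscale_def linear_cmul linear_dtrans_at)

lemma tangent_tscale: "v \<in> tangent_space M x \<Longrightarrow> tscale a v \<in> tangent_space M x"
  by (rule tangent_spaceI)
    (unfold tscale_def, simp add: tangent_space_outside,
     simp only: linear_cmul[OF linear_dtrans_at] tangent_spaceD[of v])

lemma tangent_tminus:
  "u \<in> tangent_space M x \<Longrightarrow> v \<in> tangent_space M x \<Longrightarrow> tminus u v \<in> tangent_space M x"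
  by (rule tangent_spaceI)
    (unfold tminus_def, simp add: tangent_space_outside,
     simp only: linear_diff[OF linear_dtrans_at] tangent_spaceD[of v] tangent_spaceD[of u])

lemma metric_coord:
  assumes "u \<in> tangent_space M x" "v \<in> tangent_space M x" "c \<in> charts_at M x"
  shows "metric M x u v = gcoord M c (cmap c x) (u c) (v c)"
  using assms by (simp add: gcoord_def coord_vec_tangent_eq charts_at_iff)

lemma cinv_charts_at: "c \<in> atlas M \<Longrightarrow> z \<in> cimg c \<Longrightarrow> c \<in> charts_at M (cinv c z)"
  by (simp add: charts_at_iff cinv_in_cdom)

section \<open>The metric in coordinates\<close>

lemma gcoord_sym:
  assumes "c \<in> atlas M" "z \<in> cimg c"
  shows "gcoord M c z u v = gcoord M c z v u"
  unfolding gcoord_def by (intro metric_sym coord_vec_tangent cinv_charts_at assms)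

lemma bilinear_gcoord:
  assumes "c \<in> atlas M" "z \<in> cimg c"
  shows "bilinear (gcoord M c z)"
proof -
  note C = cinv_charts_at[OF assms]
  note T = coord_vec_tangent[OF C]
  have l: "linear (\<lambda>u. gcoord M c z u v)" for v
    by (rule linearI) (simp_all add: gcoord_def coord_vec_add[OF C] coord_vec_scale[OF C]
        metric_tplus[OF T T T] metric_tscale[OF T T])
  have "(\<lambda>v. gcoord M c z v u) = gcoord M c z u" for u
    by (intro ext gcoord_sym assms)
  with l have "linear (gcoord M c z u)" for u by metis
  with l show ?thesis unfolding bilinear_def by blast
qed

lemma gcoord_pos:
  assumes "c \<in> atlas M" "z \<in> cimg c" "u \<noteq> 0"
  shows "gcoord M c z u u > 0"
proof -
  note C = cinv_charts_at[OF assms(1,2)]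
  have "coord_vec M c (cinv c z) u \<noteq> tzero"
    using coord_vec_self[OF C, of u] assms(3) by (auto simp: tzero_def)
  then show ?thesis unfolding gcoord_def by (intro metric_pos[OF coord_vec_tangent[OF C] coord_vec_tangent[OF C]])
qed

lemma smooth_gcoord: "c \<in> atlas M \<Longrightarrow> smooth_on (cimg c) (\<lambda>z. gcoord M c z u v)"
  using riemannian by (simp add: riemannian_manifold_def)

lemma has_derivative_gcoord:
  assumes "c \<in> atlas M" "z \<in> cimg c"
  shows "((\<lambda>z'. gcoord M c z' u v) has_derivative (\<lambda>e. dmetric M c z e u v)) (at z)"
  using smooth_on_imp_differentiable[OF smooth_gcoord[OF assms(1)] assms(2)]
    frechet_derivative_works by blast

lemma linear_dmetric:
  assumes "c \<in> atlas M" "z \<in> cimg c"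
  shows "linear (\<lambda>e. dmetric M c z e u v)" "linear (\<lambda>u. dmetric M c z e u v)"
    "linear (\<lambda>v. dmetric M c z e u v)"
proof -
  show "linear (\<lambda>e. dmetric M c z e u v)"
    using has_derivative_gcoord[OF assms] has_derivative_linear by blast
  have d: "(\<lambda>z. gcoord M c z u v) differentiable at z" for u v
    using smooth_on_imp_differentiable[OF smooth_gcoord[OF assms(1)] assms(2)] .
  show "linear (\<lambda>u. dmetric M c z e u v)"
    by (rule linear_frechet_derivative_family[OF open_cimg[OF assms(1)] assms(2) _ d])
      (use bilinear_gcoord[OF assms(1)] in \<open>auto simp: bilinear_def\<close>)
  show "linear (\<lambda>v. dmetric M c z e u v)"
    by (rule linear_frechet_derivative_family[OF open_cimg[OF assms(1)] assms(2) _ d])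
      (use bilinear_gcoord[OF assms(1)] in \<open>auto simp: bilinear_def\<close>)
qed

lemma dmetric_sym:
  assumes "c \<in> atlas M" "z \<in> cimg c"
  shows "dmetric M c z e u v = dmetric M c z e v u"
proof -
  have "frechet_derivative (\<lambda>z. gcoord M c z u v) (at z) = frechet_derivative (\<lambda>z. gcoord M c z v u) (at z)"
    by (rule frechet_derivative_transform_within_open[OF
        smooth_on_imp_differentiable[OF smooth_gcoord[OF assms(1)] assms(2)] open_cimg[OF assms(1)] assms(2)])
      (rule gcoord_sym[OF assms(1)])
  then show ?thesis by (rule fun_cong)
qed

lemma has_derivative_gcoord_along:
  fixes p a b :: "'z::real_normed_vector \<Rightarrow> 'e"
  assumes c: "c \<in> atlas M" and S: "x \<in> S" "p x \<in> cimg c"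
    and p: "(p has_derivative p') (at x within S)"
    and a: "(a has_derivative a') (at x within S)"
    and b: "(b has_derivative b') (at x within S)"
  shows "((\<lambda>y. gcoord M c (p y) (a y) (b y)) has_derivative (\<lambda>h. dmetric M c (p x) (p' h) (a x) (b x)
    + gcoord M c (p x) (a' h) (b x) + gcoord M c (p x) (a x) (b' h))) (at x within S)"
proof -
  define T where "T = p -` cimg c"
  have ev: "\<forall>\<^sub>F y in at x within S. y \<in> T"
    using topological_tendstoD[OF has_derivative_continuous[OF p, unfolded continuous_within]
        open_cimg[OF c] S(2)] by (simp add: T_def)
  have x: "x \<in> T" using S by (simp add: T_def)
  have l: "linear (\<lambda>u. gcoord M c z u v)" "linear (gcoord M c z u)" if "z \<in> cimg c" for z u v
    using bilinear_gcoord[OF c that] by (auto simp: bilinear_def)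
  have 1: "((\<lambda>y. gcoord M c (p y) u v) has_derivative (\<lambda>h. dmetric M c (p x) (p' h) u v)) (at x within S)"
    for u v using has_derivative_compose[OF p has_derivative_gcoord[OF c S(2)]] .
  have 2: "((\<lambda>y. gcoord M c (p y) (a y) v) has_derivative
      (\<lambda>h. dmetric M c (p x) (p' h) (a x) v + gcoord M c (p x) (a' h) v)) (at x within S)" for v
    by (rule has_derivative_linear_family[where A = "\<lambda>y u. gcoord M c (p y) u v", OF _ ev S(1) x 1 _ a])
      (auto simp: T_def l linear_dmetric c S(2))
  have "((\<lambda>y. gcoord M c (p y) (a y) (b y)) has_derivative
      (\<lambda>h. (dmetric M c (p x) (p' h) (a x) (b x) + gcoord M c (p x) (a' h) (b x))
         + gcoord M c (p x) (a x) (b' h))) (at x within S)"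
    by (rule has_derivative_linear_family[where A = "\<lambda>y. gcoord M c (p y) (a y)", OF _ ev S(1) x 2 _ b])
      (auto simp: T_def l linear_dmetric c S(2) intro!: linear_compose_add)
  then show ?thesis by simp
qed

text \<open>Positive definiteness makes the linear map \<open>y \<mapsto> (g y i)\<^sub>i\<close> injective, hence surjective.\<close>

lemma gcoord_represents:
  assumes "c \<in> atlas M" "z \<in> cimg c" "linear k"
  shows "\<exists>y. \<forall>w. gcoord M c z y w = k w"
proof -
  have l: "linear (\<lambda>u. gcoord M c z u v)" "linear (gcoord M c z u)" for u v
    using bilinear_gcoord[OF assms(1,2)] by (auto simp: bilinear_def)
  define T where "T y = (\<Sum>i\<in>Basis. gcoord M c z y i *\<^sub>R i)" for y
  have linT: "linear T" unfolding T_def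
    by (intro linear_compose_sum ballI) 
      (rule linearI, simp_all add: linear_add[OF l(1)] linear_cmul[OF l(1)] scaleR_add_left)
  have Ti: "T y \<bullet> i = gcoord M c z y i" if "i \<in> Basis" for y i
    using that by (simp add: T_def inner_sum_left inner_Basis if_distrib cong: if_cong)
  have "inj T"
  proof (subst linear_injective_0[OF linT], intro allI impI)
    fix y assume "T y = 0"
    then have "gcoord M c z y i = 0" if "i \<in> Basis" for i using Ti[OF that, of y] by simp
    then have "gcoord M c z y y = 0" by (subst linear_basis_expansion[OF l(2)]) simp
    then show "y = 0" using gcoord_pos[OF assms(1,2), of y] by force
  qed
  then have "surj T" using linear_injective_imp_surjective[OF linT] by blast
  then obtain y where y: "T y = (\<Sum>i\<in>Basis. k i *\<^sub>R i)" by (metis surjD)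
  have "gcoord M c z y i = k i" if "i \<in> Basis" for i
    using Ti[OF that, of y] that by (simp add: y inner_sum_left inner_Basis if_distrib cong: if_cong)
  then have "gcoord M c z y w = k w" for w
    by (subst linear_basis_expansion[OF l(2)], subst linear_basis_expansion[OF assms(3)]) simp
  then show ?thesis by blast
qed

lemma gcoord_nondegenerate:
  assumes "c \<in> atlas M" "z \<in> cimg c" "\<And>w. gcoord M c z y w = gcoord M c z y' w"
  shows "y = y'"
proof (rule ccontr)
  assume "y \<noteq> y'"
  then have "gcoord M c z (y - y') (y - y') > 0" using gcoord_pos assms(1,2) by simp
  then show False using assms(3) by (simp add: bilinear_lsub[OF bilinear_gcoord[OF assms(1,2)]])
qed

section \<open>The Levi-Civita connection in coordinates\<close>

text \<open>The right-hand side of Koszul's formula for constant coordinate fields, that is, the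
  Christoffel symbols with the index lowered.\<close>

definition koszul :: "('m, 'e) chart \<Rightarrow> 'e \<Rightarrow> 'e \<Rightarrow> 'e \<Rightarrow> 'e \<Rightarrow> real" where
  "koszul c z u v w =
     (dmetric M c z u v w + dmetric M c z v u w - dmetric M c z w u v) / 2"

lemma linear_koszul:
  assumes "c \<in> atlas M" "z \<in> cimg c"
  shows "linear (\<lambda>u. koszul c z u v w)" "linear (\<lambda>v. koszul c z u v w)" "linear (koszul c z u v)"
proof -
  note L = linear_dmetric[OF assms]
  show "linear (\<lambda>u. koszul c z u v w)"
    by (rule linearI) (simp_all add: koszul_def linear_add[OF L(1)] linear_cmul[OF L(1)]
        linear_add[OF L(2)] linear_cmul[OF L(2)] algebra_simps add_divide_distrib diff_divide_distrib)
  show "linear (\<lambda>v. koszul c z u v w)"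
    by (rule linearI) (simp_all add: koszul_def linear_add[OF L(1)] linear_cmul[OF L(1)]
        linear_add[OF L(2)] linear_cmul[OF L(2)] linear_add[OF L(3)] linear_cmul[OF L(3)]
        algebra_simps add_divide_distrib diff_divide_distrib)
  show "linear (koszul c z u v)"
    by (rule linearI) (simp_all add: koszul_def linear_add[OF L(1)] linear_cmul[OF L(1)]
        linear_add[OF L(3)] linear_cmul[OF L(3)] algebra_simps add_divide_distrib diff_divide_distrib)
qed

lemma gcoord_christoffel:
  assumes "c \<in> atlas M" "z \<in> cimg c"
  shows "gcoord M c z (christoffel M c z u v) w = koszul c z u v w"
proof -
  obtain y where y: "\<forall>w. gcoord M c z y w = koszul c z u v w"
    using gcoord_represents[OF assms linear_koszul(3)[OF assms]] by blast
  have "\<exists>!y. \<forall>w. gcoord M c z y w = koszul c z u v w"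
    using y gcoord_nondegenerate[OF assms] by metis
  from theI'[OF this] show ?thesis unfolding christoffel_def koszul_def by blast
qed

lemma christoffel_eqI:
  assumes "c \<in> atlas M" "z \<in> cimg c" "\<And>w. gcoord M c z y w = koszul c z u v w"
  shows "christoffel M c z u v = y"
  using gcoord_nondegenerate[OF assms(1,2)] gcoord_christoffel[OF assms(1,2)] assms(3) by metis

lemma bilinear_christoffel:
  assumes "c \<in> atlas M" "z \<in> cimg c"
  shows "bilinear (christoffel M c z)"
  unfolding bilinear_def
  by (auto intro!: linearI christoffel_eqI[OF assms] simp: bilinear_ladd[OF bilinear_gcoord[OF assms]]
      bilinear_lmul[OF bilinear_gcoord[OF assms]] gcoord_christoffel[OF assms]
      linear_add[OF linear_koszul(1)[OF assms]] linear_cmul[OF linear_koszul(1)[OF assms]]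
      linear_add[OF linear_koszul(2)[OF assms]] linear_cmul[OF linear_koszul(2)[OF assms]])

text \<open>In \<open>koszul c z e u v + koszul c z e v u\<close> all terms but the derivative in direction \<open>e\<close>
  cancel.\<close>

lemma metric_compatibility:
  assumes "c \<in> atlas M" "z \<in> cimg c"
  shows "dmetric M c z e u v =
    gcoord M c z (christoffel M c z e u) v + gcoord M c z u (christoffel M c z e v)"
proof -
  have "gcoord M c z u (christoffel M c z e v) = koszul c z e v u"
    by (rule trans[OF gcoord_sym[OF assms] gcoord_christoffel[OF assms]])
  moreover have "koszul c z e u v + koszul c z e v u = dmetric M c z e u v"
  proof -
    have "(p + q - r) / 2 + (p + r - q) / 2 = p" for p q r :: real by (simp add: field_simps)
    moreover have "dmetric M c z e v u = dmetric M c z e u v" by (rule dmetric_sym[OF assms])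
    ultimately show ?thesis unfolding koszul_def by metis
  qed
  ultimately show ?thesis using gcoord_christoffel[OF assms, of e u v] by linarith
qed

text \<open>At \<open>z0\<close> the bound comes from compactness of the unit sphere; half of it survives
  nearby because the metric coefficients are continuous.\<close>

lemma gcoord_coercive_near:
  assumes "c \<in> atlas M" "z0 \<in> cimg c"
  obtains r m where "r > 0" "m > 0" "cball z0 r \<subseteq> cimg c"
    "\<And>z u. z \<in> cball z0 r \<Longrightarrow> m * (norm u)\<^sup>2 \<le> gcoord M c z u u"
proof -
  note B = bilinear_gcoord[OF assms(1)]
  let ?S = "sphere (0::'e) 1"
  have "continuous_on ?S (\<lambda>u. gcoord M c z0 u u)"
    using bilinear_continuous_on_compose[OF continuous_on_id continuous_on_id, of "gcoord M c z0"]
      B[OF assms(2)] by simp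
  moreover obtain b :: 'e where "b \<in> Basis" using nonempty_Basis by blast
  then have "?S \<noteq> {}" by force
  ultimately obtain u0 where u0: "u0 \<in> ?S" "\<And>u. u \<in> ?S \<Longrightarrow> gcoord M c z0 u0 u0 \<le> gcoord M c z0 u u"
    using continuous_attains_inf[of ?S] compact_sphere by blast
  define m where "m = gcoord M c z0 u0 u0"
  have m: "m > 0" unfolding m_def using u0(1) by (intro gcoord_pos assms) auto
  have lo: "m * (norm u)\<^sup>2 \<le> gcoord M c z0 u u" for u
  proof (cases "u = 0")
    case True then show ?thesis using bilinear_lzero[OF B[OF assms(2)]] by simp
  next
    case False
    define v where "v = u /\<^sub>R norm u"
    have "m \<le> gcoord M c z0 v v" unfolding m_def using False by (intro u0(2)) (simp add: v_def)
    moreover have "u = norm u *\<^sub>R v" using False by (simp add: v_def)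
    then have "gcoord M c z0 u u = (norm u)\<^sup>2 * gcoord M c z0 v v"
      by (metis bilinear_lmul[OF B[OF assms(2)]] bilinear_rmul[OF B[OF assms(2)]] mult.assoc power2_eq_square real_scaleR_def)
    ultimately show ?thesis by (simp add: mult.commute[of "(norm u)\<^sup>2"] mult_right_mono)
  qed
  obtain r where r: "r > 0" "cball z0 r \<subseteq> cimg c"
    "\<And>z u v. z \<in> cball z0 r \<Longrightarrow> norm (gcoord M c z u v - gcoord M c z0 u v) \<le> m / 2 * norm u * norm v"
    by (rule bilinear_family_near[where S = "cimg c" and B = "gcoord M c" and \<epsilon> = "m / 2" and ?z0.0 = z0])
      (use assms B m open_cimg smooth_on_imp_continuous_on[OF smooth_gcoord] in auto)
  show ?thesis
  proof
    show "r > 0" "m / 2 > 0" "cball z0 r \<subseteq> cimg c" using r m by auto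
    fix z u assume "z \<in> cball z0 r"
    from r(3)[OF this, of u u]
    have "\<bar>gcoord M c z u u - gcoord M c z0 u u\<bar> \<le> m / 2 * (norm u)\<^sup>2"
      by (simp add: power2_eq_square mult.assoc)
    moreover have "m * (norm u)\<^sup>2 = m / 2 * (norm u)\<^sup>2 + m / 2 * (norm u)\<^sup>2" by simp
    ultimately show "m / 2 * (norm u)\<^sup>2 \<le> gcoord M c z u u" using lo[of u] by linarith
  qed
qed

text \<open>The Christoffel symbols solve a linear system with continuous data.  Instead of inverting it,
  one tests the equation for the difference \<open>y z - y z0\<close> with this difference itself and uses
  coercivity.\<close>

lemma continuous_on_christoffel:
  assumes c: "c \<in> atlas M"
  shows "continuous_on (cimg c) (\<lambda>z. christoffel M c z u v)"
proof -
  have "((\<lambda>z. christoffel M c z u v) \<longlongrightarrow> christoffel M c z0 u v) (at z0)" if z0: "z0 \<in> cimg c" for z0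
  proof -
    define y where "y z = christoffel M c z u v" for z
    \<comment> \<open>The functional represented by \<open>y z - y z0\<close> for the metric at \<open>z\<close>; in this form it visibly tends to \<open>0\<close>.\<close>
    define F where "F z w = (koszul c z u v w - koszul c z0 u v w)
        + (gcoord M c z0 (y z0) w - gcoord M c z (y z0) w)" for z w
    obtain r m where rm: "r > 0" "m > 0" "cball z0 r \<subseteq> cimg c"
      "\<And>z u. z \<in> cball z0 r \<Longrightarrow> m * (norm u)\<^sup>2 \<le> gcoord M c z u u"
      using gcoord_coercive_near[OF c z0] by blast
    have lg: "linear (gcoord M c z u)" if "z \<in> cimg c" for z u
      using bilinear_gcoord[OF c that] by (simp add: bilinear_def)
    have lin: "linear (F z)" if "z \<in> cimg c" for z
      unfolding F_def
      by (intro linear_compose_add linear_compose_sub linear_koszul(3)[unfolded eta_contract_eq] lg c that z0)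
    have F: "F z w = gcoord M c z (y z - y z0) w" if "z \<in> cimg c" for z w
      using gcoord_christoffel[OF c that] gcoord_christoffel[OF c z0]
      by (simp add: F_def y_def bilinear_lsub[OF bilinear_gcoord[OF c that]])
    define N where "N z = (\<Sum>i\<in>Basis. norm (F z i))" for z
    have bound: "norm (y z - y z0) \<le> N z / m" if "z \<in> cball z0 r" for z
    proof -
      have z: "z \<in> cimg c" using that rm by blast
      have "m * (norm (y z - y z0))\<^sup>2 \<le> F z (y z - y z0)" using rm(4)[OF that] F[OF z] by simp
      also have "\<dots> \<le> N z * norm (y z - y z0)"
        using norm_linear_le_basis[OF lin[OF z], of "y z - y z0"] by (simp add: N_def)
      finally have "(m * norm (y z - y z0)) * norm (y z - y z0) \<le> N z * norm (y z - y z0)"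
        by (simp add: power2_eq_square)
      then have "m * norm (y z - y z0) \<le> N z \<or> y z - y z0 = 0"
        by (metis mult_le_cancel_right norm_eq_zero norm_ge_zero order_le_less)
      moreover have "N z \<ge> 0" by (simp add: N_def sum_nonneg)
      ultimately show ?thesis using rm(2) by (auto simp: pos_le_divide_eq mult.commute)
    qed
    have "continuous_on (cimg c) (\<lambda>z. N z / m)"
      unfolding N_def F_def koszul_def
      by (intro continuous_intros smooth_on_imp_continuous_on smooth_on_frechet_derivative smooth_gcoord c)
        (use rm in auto)
    moreover have "N z0 = 0" by (simp add: N_def F_def)
    ultimately have N0: "((\<lambda>z. N z / m) \<longlongrightarrow> 0) (at z0)"
      using continuous_on_eq_continuous_at[OF open_cimg[OF c], of "\<lambda>z. N z / m"] z0
        isContD[of z0 "\<lambda>z. N z / m"] by simp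
    have "((\<lambda>z. y z - y z0) \<longlongrightarrow> 0) (at z0)"
    proof (rule Lim_null_comparison[OF _ N0])
      show "\<forall>\<^sub>F z in at z0. norm (y z - y z0) \<le> N z / m"
        unfolding eventually_at using rm(1) bound by (intro exI[of _ r]) (auto simp: dist_commute)
    qed
    then show ?thesis using Lim_null y_def by force
  qed
  then show ?thesis by (simp add: continuous_on_def Lim_at_imp_Lim_at_within)
qed

section \<open>Change of charts\<close>

definition hess :: "('m, 'e) chart \<Rightarrow> ('m, 'e) chart \<Rightarrow> 'e \<Rightarrow> 'e \<Rightarrow> 'e \<Rightarrow> 'e" where
  "hess c c' z u e = frechet_derivative (\<lambda>z'. dtrans c c' z' u) (at z) e"

lemma has_derivative_dtrans:
  assumes "c \<in> atlas M" "c' \<in> atlas M" "z \<in> overlap c c'"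
  shows "((\<lambda>z'. dtrans c c' z' u) has_derivative hess c c' z u) (at z)"
  unfolding hess_def
  using smooth_on_imp_differentiable[OF smooth_on_frechet_derivative[OF smooth_transition[OF assms(1,2)]] assms(3)]
    frechet_derivative_works by blast

lemma linear_hess:
  assumes "c \<in> atlas M" "c' \<in> atlas M" "z \<in> overlap c c'"
  shows "linear (\<lambda>u. hess c c' z u e)" "linear (hess c c' z u)"
proof -
  show "linear (\<lambda>u. hess c c' z u e)" unfolding hess_def
    by (rule linear_frechet_derivative_family[OF open_overlap[OF assms(1,2)] assms(3) linear_dtrans[OF assms(1,2)]
          smooth_on_imp_differentiable[OF smooth_on_frechet_derivative[OF smooth_transition[OF assms(1,2)]] assms(3)]])
  show "linear (hess c c' z u)"
    using has_derivative_dtrans[OF assms] has_derivative_linear by blast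
qed

lemma hess_sym:
  assumes "c \<in> atlas M" "c' \<in> atlas M" "z \<in> overlap c c'"
  shows "hess c c' z u v = hess c c' z v u"
  by (rule second_derivative_symmetric[OF open_overlap[OF assms(1,2)] assms(3)
        has_derivative_transition[OF assms(1,2)] has_derivative_dtrans[OF assms] has_derivative_dtrans[OF assms]])

lemma has_derivative_dtrans_along:
  fixes p a :: "'z::real_normed_vector \<Rightarrow> 'e"
  assumes c: "c \<in> atlas M" "c' \<in> atlas M" and S: "x \<in> S" "p x \<in> overlap c c'"
    and p: "(p has_derivative p') (at x within S)"
    and a: "(a has_derivative a') (at x within S)"
  shows "((\<lambda>y. dtrans c c' (p y) (a y)) has_derivative
    (\<lambda>h. hess c c' (p x) (a x) (p' h) + dtrans c c' (p x) (a' h))) (at x within S)"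
proof -
  define T where "T = p -` overlap c c'"
  have ev: "\<forall>\<^sub>F y in at x within S. y \<in> T"
    using topological_tendstoD[OF has_derivative_continuous[OF p, unfolded continuous_within]
        open_overlap[OF c] S(2)] by (simp add: T_def)
  have x: "x \<in> T" using S by (simp add: T_def)
  have 1: "((\<lambda>y. dtrans c c' (p y) u) has_derivative (\<lambda>h. hess c c' (p x) u (p' h))) (at x within S)" for u
    using has_derivative_compose[OF p has_derivative_dtrans[OF c S(2)]] .
  show ?thesis
    by (rule has_derivative_linear_family[where A = "\<lambda>y. dtrans c c' (p y)", OF _ ev S(1) x 1 _ a])
      (auto simp: T_def linear_dtrans linear_hess c S(2))
qed

lemma gcoord_transition:
  assumes "c \<in> atlas M" "c' \<in> atlas M" "z \<in> overlap c c'"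
  shows "gcoord M c z u v = gcoord M c' (transition c c' z) (dtrans c c' z u) (dtrans c c' z v)"
proof -
  have z: "z \<in> cimg c" "cinv c z \<in> cdom c'" using assms by (auto simp: mem_overlap)
  have C: "c \<in> charts_at M (cinv c z)" "c' \<in> charts_at M (cinv c z)"
    using assms(1,2) z by (auto simp: charts_at_iff cinv_in_cdom)
  note T = coord_vec_tangent[OF C(1)]
  have "gcoord M c z u v = metric M (cinv c z) (coord_vec M c (cinv c z) u) (coord_vec M c (cinv c z) v)"
    by (simp add: gcoord_def)
  also have "\<dots> = gcoord M c' (cmap c' (cinv c z)) (coord_vec M c (cinv c z) u c') (coord_vec M c (cinv c z) v c')"
    by (rule metric_coord[OF T T C(2)])
  finally show ?thesis using C z assms(1) by (simp add: coord_vec_def transition_def)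
qed

lemma dmetric_transition:
  assumes "c \<in> atlas M" "c' \<in> atlas M" "z \<in> overlap c c'"
  shows "dmetric M c z e u v =
      dmetric M c' (transition c c' z) (dtrans c c' z e) (dtrans c c' z u) (dtrans c c' z v)
    + gcoord M c' (transition c c' z) (hess c c' z u e) (dtrans c c' z v)
    + gcoord M c' (transition c c' z) (dtrans c c' z u) (hess c c' z v e)"
proof -
  note T = transition_in_overlap(2)[OF assms]
  have 1: "((\<lambda>z. gcoord M c' (transition c c' z) (dtrans c c' z u) (dtrans c c' z v)) has_derivative
    (\<lambda>e. dmetric M c' (transition c c' z) (dtrans c c' z e) (dtrans c c' z u) (dtrans c c' z v)
    + gcoord M c' (transition c c' z) (hess c c' z u e) (dtrans c c' z v)
    + gcoord M c' (transition c c' z) (dtrans c c' z u) (hess c c' z v e))) (at z)"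
    by (rule has_derivative_gcoord_along[OF assms(2) UNIV_I T has_derivative_transition[OF assms]
          has_derivative_dtrans[OF assms] has_derivative_dtrans[OF assms]])
  have "((\<lambda>z. gcoord M c z u v) has_derivative
    (\<lambda>e. dmetric M c' (transition c c' z) (dtrans c c' z e) (dtrans c c' z u) (dtrans c c' z v)
    + gcoord M c' (transition c c' z) (hess c c' z u e) (dtrans c c' z v)
    + gcoord M c' (transition c c' z) (dtrans c c' z u) (hess c c' z v e))) (at z)"
    by (rule has_derivative_transform_within_open[OF 1 open_overlap[OF assms(1,2)] assms(3)])
      (rule gcoord_transition[OF assms(1,2), symmetric])
  then show ?thesis by (rule fun_cong[OF frechet_derivative_at, symmetric])
qed

lemma dtrans_surj:
  assumes "c \<in> atlas M" "c' \<in> atlas M" "z \<in> overlap c c'"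
  obtains w where "dtrans c c' z w = w'"
proof
  have z: "z \<in> cimg c" "cinv c z \<in> cdom c'" using assms by (auto simp: mem_overlap)
  have C: "c \<in> charts_at M (cinv c z)" "c' \<in> charts_at M (cinv c z)"
    using assms(1,2) z by (auto simp: charts_at_iff cinv_in_cdom)
  show "dtrans c c' z (dtrans c' c (cmap c' (cinv c z)) w') = w'"
    using dtrans_inverse[OF C(2,1), of w'] assms(1) z(1) by simp
qed

text \<open>The classical law with its inhomogeneous second order term.  In Koszul's formula the second
  derivatives of the transition map enter through \<open>dmetric_transition\<close>; by their symmetry all of
  them cancel except those in the directions \<open>u\<close> and \<open>v\<close>.\<close>

lemma christoffel_transition:
  assumes "c \<in> atlas M" "c' \<in> atlas M" "z \<in> overlap c c'"
  shows "dtrans c c' z (christoffel M c z u v) =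
    christoffel M c' (transition c c' z) (dtrans c c' z u) (dtrans c c' z v) + hess c c' z u v"
proof -
  have z: "z \<in> cimg c" using assms by (simp add: mem_overlap)
  note T = transition_in_overlap(2)[OF assms]
  let ?g = "gcoord M c' (transition c c' z)" and ?D = "dtrans c c' z" and ?H = "hess c c' z"
  have sym: "?g a b = ?g b a" for a b by (rule gcoord_sym[OF assms(2) T])
  have "christoffel M c' (transition c c' z) (?D u) (?D v) = ?D (christoffel M c z u v) - ?H u v"
  proof (rule christoffel_eqI[OF assms(2) T])
    fix w'
    obtain w where w: "?D w = w'" using dtrans_surj[OF assms] by blast
    have "?g (?D (christoffel M c z u v)) w' = koszul c z u v w"
      unfolding w[symmetric] gcoord_transition[OF assms, symmetric] by (rule gcoord_christoffel[OF assms(1) z])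
    also have "\<dots> = koszul c' (transition c c' z) (?D u) (?D v) w' + ?g (?H u v) w'"
    proof -
      note d = dmetric_transition[OF assms]
      have "dmetric M c z u v w = dmetric M c' (transition c c' z) (?D u) (?D v) w'
          + ?g (?H u v) w' + ?g (?H u w) (?D v)"
        unfolding d[where e = u and u = v and v = w] w hess_sym[OF assms, of v u]
          hess_sym[OF assms, of w u] sym[of "?D v" "?H u w"] by (rule refl)
      moreover have "dmetric M c z v u w = dmetric M c' (transition c c' z) (?D v) (?D u) w'
          + ?g (?H u v) w' + ?g (?H v w) (?D u)"
        unfolding d[where e = v and u = u and v = w] w
          hess_sym[OF assms, of w v] sym[of "?D u" "?H v w"] by (rule refl)
      moreover have "dmetric M c z w u v = dmetric M c' (transition c c' z) w' (?D u) (?D v)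
          + ?g (?H u w) (?D v) + ?g (?H v w) (?D u)"
        unfolding d[where e = w and u = u and v = v] w sym[of "?D u" "?H v w"] by (rule refl)
      ultimately show ?thesis unfolding koszul_def by argo
    qed
    finally show "?g (?D (christoffel M c z u v) - ?H u v) w' =
        koszul c' (transition c c' z) (?D u) (?D v) w'"
      by (simp add: bilinear_lsub[OF bilinear_gcoord[OF assms(2) T]])
  qed
  then show ?thesis by simp
qed

section \<open>Curves and parallel fields\<close>

lemma velocity_has_vector_derivative:
  assumes "differentiable_curve M I \<gamma>" "t \<in> I" "c \<in> charts_at M (\<gamma> t)"
  shows "((\<lambda>s. cmap c (\<gamma> s)) has_vector_derivative velocity M I \<gamma> t c) (at t within I)"
proof -
  have "(cmap c \<circ> \<gamma>) differentiable (at t within I)"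
    using assms by (simp add: differentiable_curve_def)
  then show ?thesis using assms(3)
    by (simp add: velocity_def o_def vector_derivative_works)
qed

lemma velocity_eqI:
  assumes "at t within I \<noteq> bot" "c \<in> charts_at M (\<gamma> t)"
    and "((\<lambda>s. cmap c (\<gamma> s)) has_vector_derivative v) (at t within I)"
  shows "velocity M I \<gamma> t c = v"
  using assms vector_derivative_within[OF assms(1,3)] by (simp add: velocity_def o_def)

lemma eventually_in_cdom:
  assumes "continuous_on I \<gamma>" "t \<in> I" "c \<in> charts_at M (\<gamma> t)"
  shows "\<forall>\<^sub>F s in at t within I. \<gamma> s \<in> cdom c"
  using assms(1,2) topological_tendstoD[of \<gamma> "\<gamma> t" "at t within I" "cdom c"] assms(3) open_cdom
  by (auto simp: continuous_on_def charts_at_iff)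

text \<open>The chain rule for \<open>cmap c' \<circ> \<gamma> = transition c c' \<circ> (cmap c \<circ> \<gamma>)\<close> near \<open>t\<close>.  If \<open>t\<close> were an
  isolated point of \<open>I\<close>, every vector would be a derivative and the choices in the various charts
  need not match.\<close>

lemma velocity_tangent:
  assumes d: "differentiable_curve M I \<gamma>" and I: "t \<in> I" "at t within I \<noteq> bot"
  shows "velocity M I \<gamma> t \<in> tangent_space M (\<gamma> t)"
proof (rule tangent_spaceI)
  have \<gamma>: "continuous_on I \<gamma>" using d unfolding differentiable_curve_def by blast
  show "velocity M I \<gamma> t c = 0" if "c \<notin> charts_at M (\<gamma> t)" for c
    using that by (simp add: velocity_def)
  fix c c' assume c: "c \<in> charts_at M (\<gamma> t)" "c' \<in> charts_at M (\<gamma> t)"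
  have A: "c \<in> atlas M" "c' \<in> atlas M" using c by (auto simp: charts_at_iff)
  have v: "((\<lambda>s. cmap c (\<gamma> s)) has_derivative (\<lambda>h. h *\<^sub>R velocity M I \<gamma> t c)) (at t within I)"
    using velocity_has_vector_derivative[OF d I(1) c(1)] by (simp only: has_vector_derivative_def)
  from has_derivative_compose[OF v has_derivative_transition[OF A cmap_in_overlap[OF c]]]
  have 1: "((\<lambda>s. transition c c' (cmap c (\<gamma> s))) has_derivative
      (\<lambda>h. dtrans c c' (cmap c (\<gamma> t)) (h *\<^sub>R velocity M I \<gamma> t c))) (at t within I)" .
  have "((\<lambda>s. cmap c' (\<gamma> s)) has_derivative
      (\<lambda>h. dtrans c c' (cmap c (\<gamma> t)) (h *\<^sub>R velocity M I \<gamma> t c))) (at t within I)"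
  proof (rule has_derivative_transform_eventually[OF 1])
    show "\<forall>\<^sub>F s in at t within I. transition c c' (cmap c (\<gamma> s)) = cmap c' (\<gamma> s)"
      using eventually_in_cdom[OF \<gamma> I(1) c(1)] A by (auto elim!: eventually_mono simp: transition_def)
  qed (use c I in auto)
  then have "((\<lambda>s. cmap c' (\<gamma> s)) has_vector_derivative
      dtrans c c' (cmap c (\<gamma> t)) (velocity M I \<gamma> t c)) (at t within I)"
    by (simp add: has_vector_derivative_def linear_cmul[OF linear_dtrans_at[OF c]])
  then show "velocity M I \<gamma> t c' = dtrans c c' (cmap c (\<gamma> t)) (velocity M I \<gamma> t c)"
    by (rule velocity_eqI[where \<gamma> = \<gamma>, OF I(2) c(2)])
qed

text \<open>In a chart the derivative of the metric along the curve cancels, by compatibility, against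
  the two Christoffel terms of the parallel fields.\<close>

lemma parallel_metric_derivative:
  assumes \<gamma>: "differentiable_curve M I \<gamma>" and V: "parallel_field M I \<gamma> V" and W: "parallel_field M I \<gamma> W"
    and t: "t \<in> I"
  shows "((\<lambda>s. metric M (\<gamma> s) (V s) (W s)) has_derivative (\<lambda>h. 0)) (at t within I)"
proof -
  obtain c where c: "c \<in> charts_at M (\<gamma> t)" by (rule chart_exists)
  have A: "c \<in> atlas M" "cmap c (\<gamma> t) \<in> cimg c" using c by (auto simp: charts_at_iff cmap_in_cimg)
  have I: "continuous_on I \<gamma>" using \<gamma> by (simp add: differentiable_curve_def)
  let ?z = "cmap c (\<gamma> t)" and ?e = "velocity M I \<gamma> t c"
  have dV: "((\<lambda>s. V s c) has_derivative (\<lambda>h. h *\<^sub>R (- christoffel M c ?z ?e (V t c)))) (at t within I)"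
    and dW: "((\<lambda>s. W s c) has_derivative (\<lambda>h. h *\<^sub>R (- christoffel M c ?z ?e (W t c)))) (at t within I)"
    using V W t c unfolding has_vector_derivative_def[symmetric] by (simp_all only: parallel_field_def)
  have dz: "((\<lambda>s. cmap c (\<gamma> s)) has_derivative (\<lambda>h. h *\<^sub>R ?e)) (at t within I)"
    using velocity_has_vector_derivative[OF \<gamma> t c] by (simp add: has_vector_derivative_def)
  note B = bilinear_gcoord[OF A]
  have "((\<lambda>s. gcoord M c (cmap c (\<gamma> s)) (V s c) (W s c)) has_derivative
      (\<lambda>h. dmetric M c ?z (h *\<^sub>R ?e) (V t c) (W t c)
        + gcoord M c ?z (h *\<^sub>R (- christoffel M c ?z ?e (V t c))) (W t c)
        + gcoord M c ?z (V t c) (h *\<^sub>R (- christoffel M c ?z ?e (W t c))))) (at t within I)"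
    by (rule has_derivative_gcoord_along[OF A(1) t A(2) dz dV dW])
  moreover have "dmetric M c ?z (h *\<^sub>R ?e) (V t c) (W t c)
        + gcoord M c ?z (h *\<^sub>R (- christoffel M c ?z ?e (V t c))) (W t c)
        + gcoord M c ?z (V t c) (h *\<^sub>R (- christoffel M c ?z ?e (W t c))) = 0" for h
    unfolding metric_compatibility[OF A] bilinear_lmul[OF bilinear_christoffel[OF A]]
      bilinear_lmul[OF B] bilinear_rmul[OF B] bilinear_lneg[OF B] bilinear_rneg[OF B]
    by simp
  ultimately have 1: "((\<lambda>s. gcoord M c (cmap c (\<gamma> s)) (V s c) (W s c)) has_derivative (\<lambda>h. 0)) (at t within I)"
    by (simp only:)
  have m: "gcoord M c (cmap c (\<gamma> s)) (V s c) (W s c) = metric M (\<gamma> s) (V s) (W s)"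
    if "s \<in> I" "\<gamma> s \<in> cdom c" for s
    using V W that A by (intro metric_coord[symmetric]) (auto simp: parallel_field_def charts_at_iff)
  show ?thesis
  proof (rule has_derivative_transform_eventually[OF 1])
    have "\<forall>\<^sub>F s in at t within I. s \<in> I" by (simp add: eventually_at_filter)
    then show "\<forall>\<^sub>F s in at t within I. gcoord M c (cmap c (\<gamma> s)) (V s c) (W s c) = metric M (\<gamma> s) (V s) (W s)"
      using eventually_in_cdom[OF I t c] by eventually_elim (rule m)
    show "gcoord M c (cmap c (\<gamma> t)) (V t c) (W t c) = metric M (\<gamma> t) (V t) (W t)"
      using m[OF t] c by (simp add: charts_at_iff)
  qed (use t in auto)
qed

lemma parallel_metric_constant:
  assumes "differentiable_curve M I \<gamma>" "parallel_field M I \<gamma> V" "parallel_field M I \<gamma> W"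
    and "convex I" "s \<in> I" "t \<in> I"
  shows "metric M (\<gamma> s) (V s) (W s) = metric M (\<gamma> t) (V t) (W t)"
  using has_derivative_zero_constant[OF assms(4) parallel_metric_derivative[OF assms(1,2,3)]] assms(5,6)
  by metis

lemma geodesic_constant_speed:
  assumes "geodesic M I \<gamma>" "convex I" "s \<in> I" "t \<in> I"
  shows "tnorm M (\<gamma> s) (velocity M I \<gamma> s) = tnorm M (\<gamma> t) (velocity M I \<gamma> t)"
  using parallel_metric_constant[of I \<gamma> "velocity M I \<gamma>" "velocity M I \<gamma>" s t] assms
  by (simp add: geodesic_def tnorm_def)

lemma metric_self_nonneg:
  assumes "v \<in> tangent_space M x"
  shows "metric M x v v \<ge> 0"
proof (cases "v = tzero")
  case True
  then have "tscale 0 v = v" by (simp add: tscale_def tzero_def)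
  then show ?thesis using metric_tscale[OF assms assms, of 0] by simp
next
  case False
  then show ?thesis using metric_pos[OF assms assms] by simp
qed

lemma tnorm_nonneg: "v \<in> tangent_space M x \<Longrightarrow> tnorm M x v \<ge> 0"
  by (simp add: tnorm_def metric_self_nonneg)

lemma tnorm_square: "v \<in> tangent_space M x \<Longrightarrow> (tnorm M x v)\<^sup>2 = metric M x v v"
  by (simp add: tnorm_def metric_self_nonneg)

lemma metric_le_tnorm:
  assumes "u \<in> tangent_space M x" "v \<in> tangent_space M x"
  shows "\<bar>metric M x u v\<bar> \<le> tnorm M x u * tnorm M x v"
proof -
  obtain c where c: "c \<in> charts_at M x" by (rule chart_exists)
  have A: "c \<in> atlas M" "cmap c x \<in> cimg c" using c by (auto simp: charts_at_iff cmap_in_cimg)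
  let ?g = "gcoord M c (cmap c x)"
  note B = bilinear_gcoord[OF A]
  define a b d where "a = ?g (v c) (v c)" and "b = ?g (u c) (v c)" and "d = ?g (u c) (u c)"
  have sq: "b\<^sup>2 \<le> d * a"
  proof (cases "v c = 0")
    case True
    then show ?thesis by (simp add: a_def b_def bilinear_rzero[OF B])
  next
    case False
    then have a: "a > 0" unfolding a_def by (rule gcoord_pos[OF A])
    let ?w = "a *\<^sub>R u c - b *\<^sub>R v c"
    have "0 \<le> ?g ?w ?w"
      using gcoord_pos[OF A, of ?w] bilinear_lzero[OF B] by (cases "?w = 0") auto
    also have "?g ?w ?w = a * (a * d - b\<^sup>2)"
      unfolding bilinear_lsub[OF B] bilinear_rsub[OF B] bilinear_lmul[OF B] bilinear_rmul[OF B]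
        gcoord_sym[OF A, of "v c" "u c"] a_def[symmetric] b_def[symmetric] d_def[symmetric]
      by (simp add: algebra_simps power2_eq_square)
    finally show ?thesis using a by (simp add: zero_le_mult_iff mult.commute)
  qed
  have "\<bar>metric M x u v\<bar> = sqrt (b\<^sup>2)" using metric_coord[OF assms c] by (simp add: b_def)
  also have "\<dots> \<le> sqrt (d * a)" using sq by (rule real_sqrt_le_mono)
  also have "\<dots> = tnorm M x u * tnorm M x v"
    using metric_coord[OF assms(1,1) c] metric_coord[OF assms(2,2) c]
    by (simp add: tnorm_def real_sqrt_mult d_def a_def)
  finally show ?thesis .
qed

lemma metric_tminus:
  assumes "u \<in> tangent_space M x" "v \<in> tangent_space M x" "w \<in> tangent_space M x"
  shows "metric M x (tminus u v) w = metric M x u w - metric M x v w"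
proof -
  have "tminus u v = tplus u (tscale (- 1) v)" by (auto simp: tminus_def tplus_def tscale_def)
  then show ?thesis
    using metric_tplus[OF assms(1) tangent_tscale[OF assms(2)] assms(3)] metric_tscale[OF assms(2,3)] by simp
qed

lemma metric_tscale_right:
  assumes "u \<in> tangent_space M x" "v \<in> tangent_space M x"
  shows "metric M x u (tscale a v) = a * metric M x u v"
  using metric_sym[OF assms(1) tangent_tscale[OF assms(2)]] metric_tscale[OF assms(2,1)] metric_sym[OF assms]
  by simp

lemma tnorm_tscale:
  assumes "v \<in> tangent_space M x"
  shows "tnorm M x (tscale a v) = \<bar>a\<bar> * tnorm M x v"
proof -
  have "metric M x (tscale a v) (tscale a v) = a\<^sup>2 * metric M x v v"
    by (simp add: metric_tscale[OF assms tangent_tscale[OF assms]] metric_tscale_right[OF assms assms] power2_eq_square)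
  then show ?thesis by (simp add: tnorm_def real_sqrt_mult)
qed

lemma parallel_fieldD:
  assumes "parallel_field M I \<gamma> V" "t \<in> I"
  shows "V t \<in> tangent_space M (\<gamma> t)"
    and "c \<in> charts_at M (\<gamma> t) \<Longrightarrow> ((\<lambda>s. V s c) has_vector_derivative
      - christoffel M c (cmap c (\<gamma> t)) (velocity M I \<gamma> t c) (V t c)) (at t within I)"
proof -
  note all = assms(1)[unfolded parallel_field_def]
  show "V t \<in> tangent_space M (\<gamma> t)" by (rule bspec[OF conjunct1[OF all] assms(2)])
  show "((\<lambda>s. V s c) has_vector_derivative
      - christoffel M c (cmap c (\<gamma> t)) (velocity M I \<gamma> t c) (V t c)) (at t within I)"
    if "c \<in> charts_at M (\<gamma> t)"
    by (rule bspec[OF bspec[OF conjunct2[OF all] assms(2)] that])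
qed

text \<open>The equation is solved in the chart \<open>c\<close>, which contains the whole curve, and the solution is
  carried to the other charts by the transition maps.  Differentiating \<open>dtrans c c' (z t) (X t)\<close>
  produces a second derivative of the transition map, and \<open>christoffel_transition\<close> absorbs
  precisely this term.\<close>

lemma parallel_field_exists:
  assumes \<sigma>: "differentiable_curve M {0..1} \<sigma>" and c: "c \<in> atlas M"
    and dom: "\<And>t. t \<in> {0..1} \<Longrightarrow> \<sigma> t \<in> cdom c"
    and vel: "continuous_on {0..1} (\<lambda>t. velocity M {0..1} \<sigma> t c)"
    and bd: "\<And>t v. t \<in> {0..1} \<Longrightarrow>
      norm (christoffel M c (cmap c (\<sigma> t)) (velocity M {0..1} \<sigma> t c) v) \<le> norm v / 2"
    and u: "u \<in> tangent_space M (\<sigma> 0)"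
  obtains V where "parallel_field M {0..1} \<sigma> V" "V 0 = u"
proof -
  define z where "z t = cmap c (\<sigma> t)" for t
  define w where "w t = velocity M {0..1} \<sigma> t c" for t
  have C: "c \<in> charts_at M (\<sigma> t)" if "t \<in> {0..1}" for t using c dom[OF that] by (simp add: charts_at_iff)
  have zc: "z t \<in> cimg c" if "t \<in> {0..1}" for t unfolding z_def by (rule cmap_in_cimg[OF dom[OF that]])
  have cz: "continuous_on {0..1} z" unfolding z_def
  proof (rule continuous_on_compose2[OF continuous_on_cmap[OF c]])
    show "continuous_on {0..1} \<sigma>" using \<sigma> unfolding differentiable_curve_def by blast
  qed (use dom in auto)
  have dz: "(z has_derivative (\<lambda>h. h *\<^sub>R w t)) (at t within {0..1})" if "t \<in> {0..1}" for t
    using velocity_has_vector_derivative[OF \<sigma> that C[OF that]]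
    unfolding z_def[abs_def] w_def has_vector_derivative_def .
  define A where "A t v = - christoffel M c (z t) (w t) v" for t v
  have linA: "linear (A t)" if "t \<in> {0..1}" for t
    using bilinear_christoffel[OF c zc[OF that]] unfolding A_def bilinear_def by (intro linear_compose_neg) auto
  have cont: "continuous_on {0..1} (\<lambda>t. A t v)" for v
    unfolding A_def
  proof (rule continuous_on_minus[OF continuous_on_bilinear_family[where B = "\<lambda>t. christoffel M c (z t)"]])
    show "continuous_on {0..1} (\<lambda>t. christoffel M c (z t) i j)" for i j
      by (rule continuous_on_compose2[OF continuous_on_christoffel[OF c] cz]) (use zc in auto)
    show "bilinear (christoffel M c (z t))" if "t \<in> {0..1}" for t
      by (rule bilinear_christoffel[OF c zc[OF that]])
  qed (use vel in \<open>auto simp: w_def\<close>)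
  obtain X where X0: "X 0 = u c" and
    X: "\<And>t. t \<in> {0..1} \<Longrightarrow> (X has_vector_derivative A t (X t)) (at t within {0..1})"
  proof (rule linear_ode_solution[of A "u c"])
    show "norm (A t v) \<le> norm v / 2" if "t \<in> {0..1}" for t v
      using bd[OF that, of v] by (simp add: A_def z_def w_def)
  qed (use linA cont in auto)
  define V where "V t = coord_vec M c (\<sigma> t) (X t)" for t
  show ?thesis
  proof
    show "V 0 = u" unfolding V_def X0 by (rule coord_vec_tangent_eq[OF u C]) simp
    show "parallel_field M {0..1} \<sigma> V"
      unfolding parallel_field_def
    proof (intro conjI ballI)
      fix t :: real assume t: "t \<in> {0..1}"
      show Vt: "V t \<in> tangent_space M (\<sigma> t)" unfolding V_def by (rule coord_vec_tangent[OF C[OF t]])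
      fix c' assume c': "c' \<in> charts_at M (\<sigma> t)"
      have A': "c' \<in> atlas M" using c' by (simp add: charts_at_iff)
      have ov: "z t \<in> overlap c c'" unfolding z_def by (rule cmap_in_overlap[OF C[OF t] c'])
      let ?\<Gamma> = "christoffel M c' (cmap c' (\<sigma> t)) (velocity M {0..1} \<sigma> t c') (V t c')"
      have D1: "dtrans c c' (z t) (w t) = velocity M {0..1} \<sigma> t c'"
        unfolding z_def w_def
        by (rule tangent_spaceD[OF velocity_tangent[OF \<sigma> t at_within_unit_interval_nontrivial[OF t]] C[OF t] c'])
      have D2: "dtrans c c' (z t) (X t) = V t c'"
        using c' by (simp add: V_def coord_vec_def z_def)
      have D3: "transition c c' (z t) = cmap c' (\<sigma> t)"
        unfolding z_def by (rule transition_cmap[OF C[OF t]])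
      have "((\<lambda>s. dtrans c c' (z s) (X s)) has_derivative
          (\<lambda>h. hess c c' (z t) (X t) (h *\<^sub>R w t) + dtrans c c' (z t) (h *\<^sub>R A t (X t)))) (at t within {0..1})"
        using X[OF t]
        by (intro has_derivative_dtrans_along[OF c A' t ov dz[OF t]]) (simp add: has_vector_derivative_def)
      moreover have "hess c c' (z t) (X t) (h *\<^sub>R w t) + dtrans c c' (z t) (h *\<^sub>R A t (X t))
          = h *\<^sub>R (- ?\<Gamma>)" for h
      proof -
        have *: "dtrans c c' (z t) (A t (X t)) = - (?\<Gamma> + hess c c' (z t) (X t) (w t))"
          unfolding A_def linear_neg[OF linear_dtrans[OF c A' ov]] christoffel_transition[OF c A' ov] D1 D2 D3
          by (simp add: hess_sym[OF c A' ov, of "w t" "X t"])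
        show ?thesis
          unfolding linear_cmul[OF linear_hess(2)[OF c A' ov]] linear_cmul[OF linear_dtrans[OF c A' ov]] *
          by (simp add: algebra_simps)
      qed
      ultimately have 1: "((\<lambda>s. dtrans c c' (z s) (X s)) has_derivative (\<lambda>h. h *\<^sub>R (- ?\<Gamma>))) (at t within {0..1})"
        by (simp only:)
      have "((\<lambda>s. V s c') has_derivative (\<lambda>h. h *\<^sub>R (- ?\<Gamma>))) (at t within {0..1})"
      proof (rule has_derivative_transform_eventually[where g = "\<lambda>s. V s c'", OF 1 _ D2 t])
        have "continuous_on {0..1} \<sigma>" using \<sigma> unfolding differentiable_curve_def by blast
        from eventually_in_cdom[OF this t c']
        show "\<forall>\<^sub>F s in at t within {0..1}. dtrans c c' (z s) (X s) = V s c'"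
          by eventually_elim (simp add: V_def coord_vec_def z_def charts_at_iff A')
      qed
      then show "((\<lambda>s. V s c') has_vector_derivative - ?\<Gamma>) (at t within {0..1})"
        by (simp only: has_vector_derivative_def)
    qed
  qed
qed

section \<open>Length and distance\<close>

text \<open>This is what bounds the set of lengths in the definition of \<open>rdist\<close> from below, so that its
  infimum is meaningful.\<close>

lemma curve_length_nonneg:
  assumes "piecewise_C1_curve M \<gamma>"
  shows "curve_length M \<gamma> \<ge> 0"
proof -
  obtain P where *: "finite P \<and> {0, 1} \<subseteq> P \<and> P \<subseteq> {0..1} \<and>
      (\<forall>a\<in>P. \<forall>b\<in>P. a < b \<and> {a<..<b} \<inter> P = {} \<longrightarrow> C1_curve M {a..b} \<gamma>)"
    using assms unfolding piecewise_C1_curve_def by (elim exE)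
  then have P: "finite P" "{0, 1} \<subseteq> P" "P \<subseteq> {0..1}" by simp_all
  have C1: "C1_curve M {a..b} \<gamma>" if "a \<in> P" "b \<in> P" "a < b" "{a<..<b} \<inter> P = {}" for a b
    using *[THEN conjunct2, THEN conjunct2, THEN conjunct2, rule_format, OF that(1,2)] that(3,4) by blast
  let ?F = "\<lambda>t. tnorm M (\<gamma> t) (velocity M {0..1} \<gamma> t)"
  have pos: "?F t \<ge> 0" if t: "t \<in> {0..1} - P" for t
  proof -
    \<comment> \<open>The piece that contains \<open>t\<close> is bounded by the neighbouring division points.\<close>
    let ?A = "{p \<in> P. p < t}" and ?B = "{p \<in> P. t < p}"
    have t01: "0 < t" "t < 1" using t P(2) by (auto simp: less_le)
    have AB: "finite ?A" "?A \<noteq> {}" "finite ?B" "?B \<noteq> {}" using P t01 by auto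
    define a b where "a = Max ?A" and "b = Min ?B"
    have a: "a \<in> P" "a < t" using Max_in[OF AB(1,2)] by (auto simp: a_def)
    have b: "b \<in> P" "t < b" using Min_in[OF AB(3,4)] by (auto simp: b_def)
    have "{a<..<b} \<inter> P = {}"
    proof (rule ccontr)
      assume "{a<..<b} \<inter> P \<noteq> {}"
      then obtain p where p: "p \<in> P" "a < p" "p < b" by auto
      then have "p \<noteq> t" using t by auto
      then consider "p < t" | "t < p" by linarith
      then show False
      proof cases
        case 1
        then have "p \<le> a" unfolding a_def using p AB(1) by (intro Max_ge) auto
        then show False using p by simp
      next
        case 2
        then have "b \<le> p" unfolding b_def using p AB(3) by (intro Min_le) auto
        then show False using p by simp
      qed
    qed
    then have "C1_curve M {a..b} \<gamma>" using a b by (intro C1) auto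
    then have d: "differentiable_curve M {a..b} \<gamma>" by (simp add: C1_curve_def)
    have at: "at t within {a..b} = at t" "at t within {0..1} = at t"
      using a b t01 by (simp_all add: at_within_Icc_at)
    have "velocity M {a..b} \<gamma> t \<in> tangent_space M (\<gamma> t)"
      by (rule velocity_tangent[OF d]) (use a b at in auto)
    then have "velocity M {0..1} \<gamma> t \<in> tangent_space M (\<gamma> t)"
      unfolding velocity_def at .
    then show ?thesis by (rule tnorm_nonneg)
  qed
  show ?thesis
  proof (cases "?F integrable_on {0..1}")
    case True
    let ?G = "\<lambda>t. if t \<in> P then 0 else ?F t"
    have "?G integrable_on {0..1}"
      by (rule integrable_spike[OF True negligible_finite[OF P(1)]]) simp
    then have "0 \<le> integral {0..1} ?G"
      by (rule Henstock_Kurzweil_Integration.integral_nonneg) (simp add: pos)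
    also have "\<dots> = integral {0..1} ?F"
      by (rule integral_spike[OF negligible_finite[OF P(1)]]) simp
    finally show ?thesis by (simp add: curve_length_def)
  next
    case False
    then show ?thesis by (simp add: curve_length_def not_integrable_integral)
  qed
qed

lemma rdist_le_curve_length:
  assumes "piecewise_C1_curve M \<gamma>"
  shows "rdist M (\<gamma> 0) (\<gamma> 1) \<le> curve_length M \<gamma>"
  unfolding rdist_def
proof (rule cInf_lower)
  show "curve_length M \<gamma> \<in> {curve_length M \<gamma>' |\<gamma>'. piecewise_C1_curve M \<gamma>' \<and> \<gamma>' 0 = \<gamma> 0 \<and> \<gamma>' 1 = \<gamma> 1}"
    using assms by blast
  show "bdd_below {curve_length M \<gamma>' |\<gamma>'. piecewise_C1_curve M \<gamma>' \<and> \<gamma>' 0 = \<gamma> 0 \<and> \<gamma>' 1 = \<gamma> 1}"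
    by (rule bdd_belowI[of _ 0]) (auto simp: curve_length_nonneg)
qed

lemma geodesicD:
  assumes "geodesic M I \<gamma>"
  shows "differentiable_curve M I \<gamma>" "continuous_on I \<gamma>" "parallel_field M I \<gamma> (velocity M I \<gamma>)"
  using assms unfolding geodesic_def differentiable_curve_def by blast+

lemma geodesic_length:
  assumes "geodesic M {0..1} \<gamma>"
  shows "curve_length M \<gamma> = tnorm M (\<gamma> 0) (velocity M {0..1} \<gamma> 0)"
proof -
  have "curve_length M \<gamma> = integral {0..1::real} (\<lambda>t. tnorm M (\<gamma> 0) (velocity M {0..1} \<gamma> 0))"
    unfolding curve_length_def
    by (rule integral_spike[OF negligible_empty], rule geodesic_constant_speed[OF assms]) auto
  then show ?thesis by simp
qed

text \<open>The competitor is the piece of the geodesic between the two times, run affinely over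
  \<open>[0,1]\<close>; negative \<open>h\<close> is allowed, so that both sides of \<open>t\<close> are covered.\<close>

lemma rdist_along_geodesic_le:
  assumes \<gamma>: "geodesic M {0..1} \<gamma>" and t: "t \<in> {0..1}" "t + h \<in> {0..1}"
  shows "rdist M (\<gamma> t) (\<gamma> (t + h)) \<le> \<bar>h\<bar> * tnorm M (\<gamma> 0) (velocity M {0..1} \<gamma> 0)"
proof -
  define \<delta> where "\<delta> \<tau> = \<gamma> (t + h * \<tau>)" for \<tau>
  note d\<gamma> = geodesicD[OF \<gamma>]
  note I = affine_in_unit_interval[OF t]
  have im: "(\<lambda>\<tau>. t + h * \<tau>) ` {0..1} \<subseteq> {0..1}" using I by auto
  have cont: "continuous_on {0..1} \<delta>" unfolding \<delta>_def
    by (rule continuous_on_compose2[OF d\<gamma>(2) _ im]) (intro continuous_intros)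
  have der: "((\<lambda>\<tau>. cmap c (\<delta> \<tau>)) has_vector_derivative h *\<^sub>R velocity M {0..1} \<gamma> (t + h * \<tau>) c) (at \<tau> within {0..1})"
    if \<tau>: "\<tau> \<in> {0..1}" and c: "c \<in> charts_at M (\<delta> \<tau>)" for \<tau> c
    using has_vector_derivative_affine_reparametrisation[OF
        velocity_has_vector_derivative[OF d\<gamma>(1) I[OF \<tau>] c[unfolded \<delta>_def]] t]
    by (simp add: \<delta>_def)
  have vel: "velocity M {0..1} \<delta> \<tau> = tscale h (velocity M {0..1} \<gamma> (t + h * \<tau>))" if "\<tau> \<in> {0..1}" for \<tau>
  proof (rule ext)
    fix c
    show "velocity M {0..1} \<delta> \<tau> c = tscale h (velocity M {0..1} \<gamma> (t + h * \<tau>)) c"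
    proof (cases "c \<in> charts_at M (\<delta> \<tau>)")
      case True
      show ?thesis unfolding tscale_def
        by (rule velocity_eqI[OF at_within_unit_interval_nontrivial[OF that] True der[OF that True]])
    next
      case False
      then show ?thesis by (simp add: velocity_def tscale_def \<delta>_def)
    qed
  qed
  have "C1_curve M {0..1} \<delta>"
    unfolding C1_curve_def differentiable_curve_def
  proof (intro conjI ballI)
    show "(cmap c \<circ> \<delta>) differentiable at \<tau> within {0..1}" if "\<tau> \<in> {0..1}" "c \<in> charts_at M (\<delta> \<tau>)" for \<tau> c
      using der[OF that] by (auto simp: o_def intro: differentiableI_vector)
    fix c assume c: "c \<in> atlas M"
    have "continuous_on {s \<in> {0..1}. \<gamma> s \<in> cdom c} (\<lambda>s. velocity M {0..1} \<gamma> s c)"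
      unfolding continuous_on_eq_continuous_within
    proof
      fix s assume s: "s \<in> {s \<in> {0..1}. \<gamma> s \<in> cdom c}"
      then have "((\<lambda>s. velocity M {0..1} \<gamma> s c) has_vector_derivative
          - christoffel M c (cmap c (\<gamma> s)) (velocity M {0..1} \<gamma> s c) (velocity M {0..1} \<gamma> s c)) (at s within {0..1})"
        using c by (intro parallel_fieldD(2)[OF d\<gamma>(3)]) (auto simp: charts_at_iff)
      then have "continuous (at s within {0..1}) (\<lambda>s. velocity M {0..1} \<gamma> s c)"
        by (rule has_vector_derivative_continuous)
      then show "continuous (at s within {s \<in> {0..1}. \<gamma> s \<in> cdom c}) (\<lambda>s. velocity M {0..1} \<gamma> s c)"
        by (rule continuous_within_subset) auto
    qed
    then have "continuous_on {\<tau> \<in> {0..1}. \<delta> \<tau> \<in> cdom c} (\<lambda>\<tau>. h *\<^sub>R velocity M {0..1} \<gamma> (t + h * \<tau>) c)"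
      by (intro continuous_intros continuous_on_compose2[where f = "\<lambda>\<tau>. t + h * \<tau>" and g = "\<lambda>s. velocity M {0..1} \<gamma> s c"])
        (use I in \<open>auto simp: \<delta>_def\<close>)
    then show "continuous_on {\<tau> \<in> {0..1}. \<delta> \<tau> \<in> cdom c} (\<lambda>\<tau>. velocity M {0..1} \<delta> \<tau> c)"
      by (rule continuous_on_eq) (simp add: vel tscale_def)
  qed (rule cont)
  then have "piecewise_C1_curve M \<delta>"
    unfolding piecewise_C1_curve_def
    by (intro exI[of _ "{0, 1}"]) auto
  from rdist_le_curve_length[OF this]
  have "rdist M (\<gamma> t) (\<gamma> (t + h)) \<le> curve_length M \<delta>" by (simp add: \<delta>_def)
  also have "curve_length M \<delta> = integral {0..1::real} (\<lambda>\<tau>. \<bar>h\<bar> * tnorm M (\<gamma> 0) (velocity M {0..1} \<gamma> 0))"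
    unfolding curve_length_def
  proof (rule integral_spike[OF negligible_empty])
    fix \<tau> :: real assume "\<tau> \<in> {0..1} - {}"
    then have \<tau>: "\<tau> \<in> {0..1}" by simp
    note T = velocity_tangent[OF d\<gamma>(1) I[OF \<tau>] at_within_unit_interval_nontrivial[OF I[OF \<tau>]]]
    show "\<bar>h\<bar> * tnorm M (\<gamma> 0) (velocity M {0..1} \<gamma> 0) = tnorm M (\<delta> \<tau>) (velocity M {0..1} \<delta> \<tau>)"
      using tnorm_tscale[OF T, of h] geodesic_constant_speed[OF \<gamma> _ I[OF \<tau>], of 0]
      by (simp add: vel[OF \<tau>] \<delta>_def)
  qed
  finally show ?thesis by simp
qed

section \<open>The exponential map and minimising geodesics\<close>

lemma geodesic_restrict:
  assumes \<gamma>: "geodesic M UNIV \<gamma>"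
  shows "geodesic M {0..1} \<gamma>" "\<And>t. t \<in> {0..1} \<Longrightarrow> velocity M {0..1} \<gamma> t = velocity M UNIV \<gamma> t"
proof -
  note d = geodesicD[OF \<gamma>]
  show vel: "velocity M {0..1} \<gamma> t = velocity M UNIV \<gamma> t" if t: "t \<in> {0..1}" for t
  proof (rule ext)
    fix c
    show "velocity M {0..1} \<gamma> t c = velocity M UNIV \<gamma> t c"
    proof (cases "c \<in> charts_at M (\<gamma> t)")
      case True
      from velocity_has_vector_derivative[OF d(1) UNIV_I True]
      have "((\<lambda>s. cmap c (\<gamma> s)) has_vector_derivative velocity M UNIV \<gamma> t c) (at t within {0..1})"
        by (rule has_vector_derivative_within_subset) simp
      then show ?thesis by (rule velocity_eqI[where \<gamma> = \<gamma>, OF at_within_unit_interval_nontrivial[OF t] True])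
    next
      case False then show ?thesis by (simp add: velocity_def)
    qed
  qed
  show "geodesic M {0..1} \<gamma>"
    unfolding geodesic_def differentiable_curve_def parallel_field_def
  proof (intro conjI ballI)
    show "continuous_on {0..1} \<gamma>" using d(2) continuous_on_subset by blast
    fix t :: real assume t: "t \<in> {0..1}"
    show "velocity M {0..1} \<gamma> t \<in> tangent_space M (\<gamma> t)"
      unfolding vel[OF t] by (rule parallel_fieldD(1)[OF d(3)]) simp
    fix c assume c: "c \<in> charts_at M (\<gamma> t)"
    show "(cmap c \<circ> \<gamma>) differentiable at t within {0..1}"
      using d(1) c differentiable_at_withinI unfolding differentiable_curve_def by blast
    have "((\<lambda>s. velocity M UNIV \<gamma> s c) has_vector_derivative
        - christoffel M c (cmap c (\<gamma> t)) (velocity M UNIV \<gamma> t c) (velocity M UNIV \<gamma> t c)) (at t within {0..1})"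
      by (rule has_vector_derivative_within_subset[OF parallel_fieldD(2)[OF d(3) UNIV_I c]]) simp
    then show "((\<lambda>s. velocity M {0..1} \<gamma> s c) has_vector_derivative
        - christoffel M c (cmap c (\<gamma> t)) (velocity M {0..1} \<gamma> t c) (velocity M {0..1} \<gamma> t c)) (at t within {0..1})"
      unfolding vel[OF t] by (rule has_vector_derivative_transform[OF t, rotated]) (simp add: vel)
  qed
qed

text \<open>Existence alone justifies the choice in \<open>rexp\<close>: whichever geodesic is chosen, its end point
  is reached by a geodesic with initial velocity \<open>v\<close>.\<close>

lemma rexp_geodesic:
  assumes "complete_rmfd M" "v \<in> tangent_space M x"
  obtains \<gamma> where "geodesic M {0..1} \<gamma>" "\<gamma> 0 = x" "velocity M {0..1} \<gamma> 0 = v" "\<gamma> 1 = rexp M x v"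
proof -
  obtain \<gamma> where "geodesic M UNIV \<gamma>" "\<gamma> 0 = x" "velocity M UNIV \<gamma> 0 = v"
    using assms unfolding complete_rmfd_def by blast
  then have "\<exists>y \<gamma>. geodesic M {0..1} \<gamma> \<and> \<gamma> 0 = x \<and> velocity M {0..1} \<gamma> 0 = v \<and> \<gamma> 1 = y"
    using geodesic_restrict[of \<gamma>] by auto
  from someI_ex[OF this] show ?thesis using that unfolding rexp_def by blast
qed

text \<open>A geodesic from \<open>x\<close> to \<open>y\<close> with initial velocity \<open>lg x y\<close> has length \<open>tnorm M x (lg x y)\<close>, which is the distance.\<close>

lemma minimising_geodesic_exists:
  assumes "complete_rmfd M" "is_log_map M lg"
  obtains \<sigma> where "minimising_geodesic M \<sigma> x y" "tnorm M x (velocity M {0..1} \<sigma> 0) = rdist M x y"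
proof -
  have lg: "lg x y \<in> tangent_space M x" "rexp M x (lg x y) = y" "tnorm M x (lg x y) = rdist M x y"
    using assms(2) by (auto simp: is_log_map_def)
  obtain \<sigma> where \<sigma>: "geodesic M {0..1} \<sigma>" "\<sigma> 0 = x" "velocity M {0..1} \<sigma> 0 = lg x y" "\<sigma> 1 = y"
    using rexp_geodesic[OF assms(1) lg(1)] lg(2) by metis
  show ?thesis
  proof
    show "minimising_geodesic M \<sigma> x y"
      using \<sigma> lg(3) geodesic_length[OF \<sigma>(1)] by (simp add: minimising_geodesic_def)
    show "tnorm M x (velocity M {0..1} \<sigma> 0) = rdist M x y" using \<sigma> lg(3) by simp
  qed
qed

section \<open>The gradient\<close>

abbreviation dfun :: "('m \<Rightarrow> real) \<Rightarrow> ('m, 'e) chart \<Rightarrow> 'e \<Rightarrow> 'e \<Rightarrow> real" where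
  "dfun f c z \<equiv> frechet_derivative (f \<circ> cinv c) (at z)"

lemma C1_functionD:
  assumes "C1_function M f" "c \<in> atlas M"
  shows "z \<in> cimg c \<Longrightarrow> ((\<lambda>z. f (cinv c z)) has_derivative dfun f c z) (at z)"
    and "continuous_on (cimg c) (\<lambda>z. dfun f c z e)"
proof -
  have "Ck_on (Suc 0) (cimg c) (f \<circ> cinv c)" using assms by (simp add: C1_function_def)
  then show "z \<in> cimg c \<Longrightarrow> ((\<lambda>z. f (cinv c z)) has_derivative dfun f c z) (at z)"
    and "continuous_on (cimg c) (\<lambda>z. dfun f c z e)"
    using frechet_derivative_works[of "f \<circ> cinv c" "at z"] by (auto simp: o_def)
qed

lemma dfun_transition:
  assumes f: "C1_function M f" and c: "c \<in> charts_at M x" "c' \<in> charts_at M x"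
  shows "dfun f c' (cmap c' x) (dtrans c c' (cmap c x) e) = dfun f c (cmap c x) e"
proof -
  have A: "c \<in> atlas M" "c' \<in> atlas M" "cmap c' x \<in> cimg c'" using c by (auto simp: charts_at_iff cmap_in_cimg)
  note ov = cmap_in_overlap[OF c]
  have "((\<lambda>z. f (cinv c' z)) has_derivative dfun f c' (cmap c' x)) (at (transition c c' (cmap c x)))"
    using C1_functionD(1)[OF f A(2,3)] transition_cmap[OF c(1)] by (simp only:)
  from has_derivative_compose[OF has_derivative_transition[OF A(1,2) ov] this]
  have 1: "((\<lambda>z. f (cinv c' (transition c c' z))) has_derivative
      (\<lambda>e. dfun f c' (cmap c' x) (dtrans c c' (cmap c x) e))) (at (cmap c x))" .
  have "((f \<circ> cinv c) has_derivative
      (\<lambda>e. dfun f c' (cmap c' x) (dtrans c c' (cmap c x) e))) (at (cmap c x))"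
    by (rule has_derivative_transform_within_open[OF 1 open_overlap[OF A(1,2)] ov])
      (simp add: transition_in_overlap(3)[OF A(1,2)])
  then show ?thesis by (rule fun_cong[OF frechet_derivative_at])
qed

text \<open>The gradient is represented in one chart; the chain rule (\<open>dfun_transition\<close>) shows that it
  represents the differential in every chart.\<close>

lemma grad_exists_unique:
  assumes f: "C1_function M f"
  shows "\<exists>!v. v \<in> tangent_space M x \<and> (\<forall>u\<in>tangent_space M x. \<forall>c\<in>charts_at M x.
      metric M x v u = dfun f c (cmap c x) (u c))"
proof -
  obtain c where c: "c \<in> charts_at M x" by (rule chart_exists)
  have A: "c \<in> atlas M" "cmap c x \<in> cimg c" using c by (auto simp: charts_at_iff cmap_in_cimg)
  have "linear (dfun f c (cmap c x))"
    using C1_functionD(1)[OF f A] has_derivative_linear by blast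
  then obtain y where y: "\<And>w. gcoord M c (cmap c x) y w = dfun f c (cmap c x) w"
    using gcoord_represents[OF A] by blast
  show ?thesis
  proof (rule ex1I[of _ "coord_vec M c x y"])
    show "coord_vec M c x y \<in> tangent_space M x \<and> (\<forall>u\<in>tangent_space M x. \<forall>c'\<in>charts_at M x.
      metric M x (coord_vec M c x y) u = dfun f c' (cmap c' x) (u c'))"
    proof (intro conjI ballI coord_vec_tangent[OF c])
      fix u c' assume u: "u \<in> tangent_space M x" and c': "c' \<in> charts_at M x"
      have "metric M x (coord_vec M c x y) u = gcoord M c (cmap c x) y (u c)"
        using metric_coord[OF coord_vec_tangent[OF c] u c, of y] c by simp
      also have "\<dots> = dfun f c' (cmap c' x) (dtrans c c' (cmap c x) (u c))"
        unfolding y by (rule dfun_transition[OF f c c', symmetric])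
      finally show "metric M x (coord_vec M c x y) u = dfun f c' (cmap c' x) (u c')"
        unfolding tangent_spaceD[OF u c c'] .
    qed
    fix v assume v: "v \<in> tangent_space M x \<and> (\<forall>u\<in>tangent_space M x. \<forall>c\<in>charts_at M x.
      metric M x v u = dfun f c (cmap c x) (u c))"
    have "v c = y"
    proof (rule gcoord_nondegenerate[OF A])
      fix w
      have "gcoord M c (cmap c x) (v c) w = metric M x v (coord_vec M c x w)"
        using metric_coord[OF _ coord_vec_tangent[OF c] c, of v w] v c by simp
      also have "\<dots> = dfun f c (cmap c x) (coord_vec M c x w c)"
        using v coord_vec_tangent[OF c] c by blast
      finally show "gcoord M c (cmap c x) (v c) w = gcoord M c (cmap c x) y w"
        using c y by simp
    qed
    with coord_vec_tangent_eq[OF conjunct1[OF v] c] show "v = coord_vec M c x y" by (simp only:)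
  qed
qed

lemma grad_properties:
  assumes "C1_function M f"
  shows grad_tangent: "grad M f x \<in> tangent_space M x"
    and metric_grad: "u \<in> tangent_space M x \<Longrightarrow> c \<in> charts_at M x \<Longrightarrow>
      metric M x (grad M f x) u = dfun f c (cmap c x) (u c)"
  using theI'[OF grad_exists_unique[OF assms, of x]] unfolding grad_def by blast+

lemma derivative_along_curve:
  assumes f: "C1_function M f" and \<gamma>: "differentiable_curve M I \<gamma>" and t: "t \<in> I" "at t within I \<noteq> bot"
  shows "((\<lambda>s. f (\<gamma> s)) has_vector_derivative metric M (\<gamma> t) (grad M f (\<gamma> t)) (velocity M I \<gamma> t)) (at t within I)"
proof -
  obtain c where c: "c \<in> charts_at M (\<gamma> t)" by (rule chart_exists)
  have A: "c \<in> atlas M" "cmap c (\<gamma> t) \<in> cimg c" using c by (auto simp: charts_at_iff cmap_in_cimg)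
  let ?df = "dfun f c (cmap c (\<gamma> t))"
  have lin: "linear ?df" using C1_functionD(1)[OF f A] has_derivative_linear by blast
  have "((\<lambda>s. cmap c (\<gamma> s)) has_derivative (\<lambda>h. h *\<^sub>R velocity M I \<gamma> t c)) (at t within I)"
    using velocity_has_vector_derivative[OF \<gamma> t(1) c] by (simp add: has_vector_derivative_def)
  from has_derivative_compose[OF this C1_functionD(1)[OF f A]]
  have 1: "((\<lambda>s. f (cinv c (cmap c (\<gamma> s)))) has_derivative (\<lambda>h. ?df (h *\<^sub>R velocity M I \<gamma> t c))) (at t within I)" .
  have "((\<lambda>s. f (\<gamma> s)) has_derivative (\<lambda>h. ?df (h *\<^sub>R velocity M I \<gamma> t c))) (at t within I)"
  proof (rule has_derivative_transform_eventually[where g = "\<lambda>s. f (\<gamma> s)", OF 1 _ _ t(1)])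
    have "continuous_on I \<gamma>" using \<gamma> unfolding differentiable_curve_def by blast
    from eventually_in_cdom[OF this t(1) c]
    show "\<forall>\<^sub>F s in at t within I. f (cinv c (cmap c (\<gamma> s))) = f (\<gamma> s)"
      by eventually_elim (simp add: A)
    show "f (cinv c (cmap c (\<gamma> t))) = f (\<gamma> t)" using c by (simp add: charts_at_iff)
  qed
  then show ?thesis
    by (simp add: has_vector_derivative_def linear_cmul[OF lin] metric_grad[OF f velocity_tangent[OF \<gamma> t] c])
qed

section \<open>Short geodesics in a chart\<close>

lemma geodesic_tangent:
  assumes "geodesic M I \<gamma>" "t \<in> I"
  shows "velocity M I \<gamma> t \<in> tangent_space M (\<gamma> t)"
  using parallel_fieldD(1)[OF geodesicD(3)] assms by blast

lemma coordinate_velocity_bound: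
  assumes \<gamma>: "geodesic M {0..1} \<gamma>" and t: "t \<in> {0..1}" and c: "c \<in> charts_at M (\<gamma> t)"
    and m: "m \<ge> 0" "\<And>u. m * (norm u)\<^sup>2 \<le> gcoord M c (cmap c (\<gamma> t)) u u"
  shows "sqrt m * norm (velocity M {0..1} \<gamma> t c) \<le> tnorm M (\<gamma> 0) (velocity M {0..1} \<gamma> 0)"
proof -
  let ?v = "velocity M {0..1} \<gamma>"
  note T = geodesic_tangent[OF \<gamma> t]
  have "(sqrt m * norm (?v t c))\<^sup>2 \<le> gcoord M c (cmap c (\<gamma> t)) (?v t c) (?v t c)"
    using m by (simp add: power_mult_distrib)
  also have "\<dots> = (tnorm M (\<gamma> t) (?v t))\<^sup>2"
    unfolding tnorm_square[OF T] by (rule metric_coord[OF T T c, symmetric])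
  finally have "sqrt m * norm (?v t c) \<le> tnorm M (\<gamma> t) (?v t)"
    by (rule power2_le_imp_le) (rule tnorm_nonneg[OF T])
  also have "\<dots> = tnorm M (\<gamma> 0) (?v 0)" by (rule geodesic_constant_speed[OF \<gamma> _ t]) auto
  finally show ?thesis .
qed

text \<open>A geodesic that leaves the coordinate ball must first reach its boundary, staying inside until
  then; but there its coordinate velocity is at most speed over \<open>sqrt m\<close>, which is too small to
  cover the distance \<open>r\<close> in unit time.  The closed ball is transported to a compact, hence
  closed, subset of the manifold, so that the curve is still in the chart at the exit time.\<close>

lemma geodesic_stays_in_chart:
  assumes \<sigma>: "geodesic M {0..1} \<sigma>" and c: "c \<in> charts_at M (\<sigma> 0)"
    and r: "cball (cmap c (\<sigma> 0)) r \<subseteq> cimg c" "r > 0"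
    and m: "m > 0" "\<And>z u. z \<in> cball (cmap c (\<sigma> 0)) r \<Longrightarrow> m * (norm u)\<^sup>2 \<le> gcoord M c z u u"
    and speed: "tnorm M (\<sigma> 0) (velocity M {0..1} \<sigma> 0) < sqrt m * r"
    and t: "t \<in> {0..1}"
  shows "\<sigma> t \<in> cdom c \<and> cmap c (\<sigma> t) \<in> cball (cmap c (\<sigma> 0)) r"
proof -
  define z where "z s = cmap c (\<sigma> s)" for s
  define s where "s = tnorm M (\<sigma> 0) (velocity M {0..1} \<sigma> 0)"
  have A: "c \<in> atlas M" "\<sigma> 0 \<in> cdom c" using c by (auto simp: charts_at_iff)
  note d\<sigma> = geodesicD[OF \<sigma>]
  define U where "U = cdom c \<inter> cmap c -` ball (z 0) r"
  have U: "open U" unfolding U_def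
    by (rule continuous_open_preimage[OF continuous_on_cmap[OF A(1)] open_cdom[OF A(1)] open_ball])
  define N where "N = cinv c ` cball (z 0) r"
  have "compact N" unfolding N_def
    by (rule compact_continuous_image[OF continuous_on_subset[OF continuous_on_cinv[OF A(1)]] compact_cball])
      (use r in \<open>simp add: z_def\<close>)
  then have N: "closed N" by (rule compact_imp_closed)
  have UN: "U \<subseteq> N"
  proof
    fix x assume "x \<in> U"
    then have "x \<in> cdom c" "cmap c x \<in> cball (z 0) r" by (auto simp: U_def)
    then show "x \<in> N" unfolding N_def using A(1) by (intro image_eqI[of _ _ "cmap c x"]) auto
  qed
  have NI: "x \<in> cdom c \<and> cmap c x \<in> cball (z 0) r" if xN: "x \<in> N" for x
  proof -
    obtain y where y: "y \<in> cball (z 0) r" "x = cinv c y" using xN unfolding N_def by blast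
    then have "y \<in> cimg c" using r by (auto simp: z_def)
    then show ?thesis using y A(1) by (simp add: cinv_in_cdom)
  qed
  define E where "E = {0..1} \<inter> \<sigma> -` (- U)"
  have "E = {}"
  proof (rule ccontr)
    assume "E \<noteq> {}"
    have "closed E" unfolding E_def
      by (rule continuous_closed_preimage[OF d\<sigma>(2)]) (use U in auto)
    moreover have bb: "bdd_below E" by (auto simp: E_def bdd_below_def)
    ultimately have TE: "Inf E \<in> E" using closed_contains_Inf[OF \<open>E \<noteq> {}\<close>] by blast
    define T where "T = Inf E"
    have T: "T \<in> {0..1}" "\<sigma> T \<notin> U" using TE by (auto simp: E_def T_def)
    have "\<sigma> 0 \<in> U" using A r by (simp add: U_def z_def)
    then have T0: "T > 0" using T by (metis atLeastAtMost_iff less_eq_real_def)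
    have before: "\<sigma> \<tau> \<in> U" if "\<tau> \<in> {0..<T}" for \<tau>
    proof (rule ccontr)
      assume "\<sigma> \<tau> \<notin> U"
      then have "\<tau> \<in> E" using that T by (auto simp: E_def)
      then have "T \<le> \<tau>" unfolding T_def using bb by (rule cInf_lower)
      then show False using that by simp
    qed
    have "closed ({0..1} \<inter> \<sigma> -` N)"
      by (rule continuous_closed_preimage[OF d\<sigma>(2) _ N]) simp
    moreover have "{0..<T} \<subseteq> {0..1} \<inter> \<sigma> -` N"
    proof
      fix \<tau> assume "\<tau> \<in> {0..<T}"
      with before[OF this] UN T(1) show "\<tau> \<in> {0..1} \<inter> \<sigma> -` N" by auto
    qed
    ultimately have "closure {0..<T} \<subseteq> {0..1} \<inter> \<sigma> -` N" by (rule closure_minimal[rotated])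
    then have inN: "\<sigma> \<tau> \<in> N" if "\<tau> \<in> {0..T}" for \<tau> using that T0 by auto
    have der: "(z has_derivative (\<lambda>h. h *\<^sub>R velocity M {0..1} \<sigma> \<tau> c)) (at \<tau> within {0..T})"
      if "\<tau> \<in> {0..T}" for \<tau>
    proof -
      have "\<tau> \<in> {0..1}" "c \<in> charts_at M (\<sigma> \<tau>)"
        using that T NI[OF inN[OF that]] A(1) by (auto simp: charts_at_iff)
      from velocity_has_vector_derivative[OF d\<sigma>(1) this]
      have "(z has_vector_derivative velocity M {0..1} \<sigma> \<tau> c) (at \<tau> within {0..1})"
        by (simp only: z_def[abs_def])
      then have "(z has_vector_derivative velocity M {0..1} \<sigma> \<tau> c) (at \<tau> within {0..T})"
        by (rule has_vector_derivative_within_subset) (use T in auto)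
      then show ?thesis by (simp only: has_vector_derivative_def)
    qed
    have s0: "s \<ge> 0" unfolding s_def by (rule tnorm_nonneg[OF geodesic_tangent[OF \<sigma>]]) simp
    have bd: "norm (velocity M {0..1} \<sigma> \<tau> c) \<le> s / sqrt m" if "\<tau> \<in> {0..T}" for \<tau>
    proof -
      have "\<tau> \<in> {0..1}" "c \<in> charts_at M (\<sigma> \<tau>)" "cmap c (\<sigma> \<tau>) \<in> cball (z 0) r"
        using that T NI[OF inN[OF that]] A(1) by (auto simp: charts_at_iff)
      from coordinate_velocity_bound[OF \<sigma> this(1,2) less_imp_le[OF m(1)] m(2)] this(3)
      have "sqrt m * norm (velocity M {0..1} \<sigma> \<tau> c) \<le> s" unfolding s_def z_def by blast
      then show ?thesis using m(1) by (simp add: pos_le_divide_eq mult.commute)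
    qed
    have "norm (z T - z 0) \<le> s / sqrt m * norm (T - 0)"
    proof (rule differentiable_bound[OF _ der])
      show "onorm (\<lambda>h. h *\<^sub>R velocity M {0..1} \<sigma> \<tau> c) \<le> s / sqrt m" if "\<tau> \<in> {0..T}" for \<tau>
        by (rule onorm_scaleR_left_le[OF bd[OF that]])
    qed (use T0 in auto)
    also have "\<dots> \<le> s / sqrt m * 1" using T T0 s0 m(1) by (intro mult_left_mono) auto
    also have "\<dots> < r" using speed m(1) by (simp add: s_def pos_divide_less_eq mult.commute)
    finally have "z T \<in> ball (z 0) r" by (simp add: dist_norm norm_minus_commute)
    moreover have "\<sigma> T \<in> cdom c" using NI[OF inN] T0 by simp
    ultimately show False using T(2) by (simp add: U_def z_def)
  qed
  then have "\<sigma> t \<in> N" using t UN unfolding E_def by blast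
  then show ?thesis using NI by (simp add: z_def)
qed

lemma continuous_on_velocity_coord:
  assumes \<sigma>: "geodesic M I \<sigma>" and c: "\<And>t. t \<in> I \<Longrightarrow> c \<in> charts_at M (\<sigma> t)"
  shows "continuous_on I (\<lambda>t. velocity M I \<sigma> t c)"
  unfolding continuous_on_eq_continuous_within
proof
  fix t assume "t \<in> I"
  from parallel_fieldD(2)[OF geodesicD(3)[OF \<sigma>] this c[OF this]]
  show "continuous (at t within I) (\<lambda>t. velocity M I \<sigma> t c)" by (rule has_vector_derivative_continuous)
qed

text \<open>Transport along \<open>\<sigma>\<close> preserves the pairing with the velocity of \<open>\<sigma>\<close>, so the change of the
  pairing is the pairing of \<open>tminus P (grad M f y)\<close> with a vector of norm \<open>rdist M x y\<close>.  The field
  \<open>V\<close> only witnesses that the choice in \<open>parallel_transport\<close> is made from a nonempty set.\<close>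

lemma gradient_change_along_minimising_geodesic:
  assumes f: "C1_function M f" and lip: "lipschitz_gradient M L f"
    and \<sigma>: "minimising_geodesic M \<sigma> x y"
    and V: "parallel_field M {0..1} \<sigma> V" "V 0 = grad M f x"
  shows "\<bar>metric M y (grad M f y) (velocity M {0..1} \<sigma> 1) - metric M x (grad M f x) (velocity M {0..1} \<sigma> 0)\<bar>
    \<le> L * (rdist M x y)\<^sup>2"
proof -
  have g: "geodesic M {0..1} \<sigma>" and ends: "\<sigma> 0 = x" "\<sigma> 1 = y" and len: "curve_length M \<sigma> = rdist M x y"
    using \<sigma> by (auto simp: minimising_geodesic_def)
  let ?v = "velocity M {0..1} \<sigma>"
  define P where "P = parallel_transport M \<sigma> (grad M f x)"
  have "\<exists>w V. parallel_field M {0..1} \<sigma> V \<and> V 0 = grad M f x \<and> V 1 = w" using V by blast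
  from someI_ex[OF this]
  obtain W where W: "parallel_field M {0..1} \<sigma> W" "W 0 = grad M f x" "W 1 = P"
    unfolding P_def parallel_transport_def by blast
  have P: "P \<in> tangent_space M y" using parallel_fieldD(1)[OF W(1), of 1] W(3) ends by simp
  have v1: "?v 1 \<in> tangent_space M y" using geodesic_tangent[OF g, of 1] ends by simp
  note G = grad_tangent[OF f, of y]
  have "metric M x (grad M f x) (?v 0) = metric M y P (?v 1)"
    using parallel_metric_constant[OF geodesicD(1)[OF g] W(1) geodesicD(3)[OF g] convex_real_interval(5), of 0 1]
      W ends by simp
  then have "\<bar>metric M y (grad M f y) (?v 1) - metric M x (grad M f x) (?v 0)\<bar>
      = \<bar>metric M y (tminus P (grad M f y)) (?v 1)\<bar>"
    unfolding metric_tminus[OF P G v1] by simp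
  also have "\<dots> \<le> tnorm M y (tminus P (grad M f y)) * tnorm M y (?v 1)"
    by (rule metric_le_tnorm[OF tangent_tminus[OF P G] v1])
  also have "tnorm M y (?v 1) = rdist M x y"
    using geodesic_constant_speed[OF g, of 1 0] geodesic_length[OF g] len ends by simp
  also have "tnorm M y (tminus P (grad M f y)) * rdist M x y \<le> (L * rdist M x y) * rdist M x y"
  proof (rule mult_right_mono)
    show "tnorm M y (tminus P (grad M f y)) \<le> L * rdist M x y"
      using lip \<sigma> unfolding lipschitz_gradient_def P_def by blast
    show "rdist M x y \<ge> 0"
      using geodesic_length[OF g] len tnorm_nonneg[OF geodesic_tangent[OF g, of 0]] by simp
  qed
  finally show ?thesis by (simp add: power2_eq_square mult.assoc)
qed

lemma dfun_bounded_near: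
  assumes f: "C1_function M f" and c: "c \<in> atlas M" "z0 \<in> cimg c"
  obtains r B where "r > 0" "B > 0" "\<And>z e. z \<in> cball z0 r \<Longrightarrow> z \<in> cimg c \<Longrightarrow> \<bar>dfun f c z e\<bar> \<le> B * norm e"
proof -
  define N where "N z = (\<Sum>i\<in>Basis. norm (dfun f c z i))" for z
  have "continuous_on (cimg c) N" unfolding N_def
    by (intro continuous_intros C1_functionD(2)[OF f c(1)])
  then have "continuous (at z0) N"
    using continuous_on_eq_continuous_at[OF open_cimg[OF c(1)]] c(2) by blast
  then obtain d where d: "d > 0" "\<And>z. dist z z0 < d \<Longrightarrow> dist (N z) (N z0) < 1"
    unfolding continuous_at_eps_delta by (metis zero_less_one)
  show ?thesis
  proof
    show "d / 2 > 0" "N z0 + 1 > 0" using d(1) by (auto simp: N_def intro: add_nonneg_pos sum_nonneg)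
    fix z e assume z: "z \<in> cball z0 (d / 2)" "z \<in> cimg c"
    have "N z \<le> N z0 + 1" using d(2)[of z] z(1) d(1) by (auto simp: dist_commute dist_real_def)
    have lin: "linear (dfun f c z)" using C1_functionD(1)[OF f c(1) z(2)] has_derivative_linear by blast
    have "\<bar>dfun f c z e\<bar> \<le> N z * norm e"
      using norm_linear_le_basis[OF lin, of e] by (simp add: N_def)
    also have "\<dots> \<le> (N z0 + 1) * norm e" using \<open>N z \<le> N z0 + 1\<close> by (intro mult_right_mono) auto
    finally show "\<bar>dfun f c z e\<bar> \<le> (N z0 + 1) * norm e" .
  qed
qed

section \<open>The descent inequality\<close>

text \<open>The hypothesis on the gradient controls the pairing along the minimising geodesic \<open>\<sigma>\<close> from
  \<open>\<gamma> t\<close> to \<open>\<gamma> t'\<close>.  Passing from \<open>\<sigma>\<close> to \<open>\<gamma>\<close> costs, at each of the two end points, the differential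
  of \<open>f\<close> applied to a difference of velocities of order \<open>o(h\<^sup>2)\<close>.\<close>

lemma gradient_pairing_pointwise_lipschitz:
  assumes complete: "complete_rmfd M" and lg: "is_log_map M lg" and f: "C1_function M f"
    and lip: "lipschitz_gradient M L f" and L: "L \<ge> 0" and \<gamma>: "geodesic M {0..1} \<gamma>"
    and t: "t \<in> {0..1}" and \<epsilon>: "\<epsilon> > 0"
  defines "s \<equiv> tnorm M (\<gamma> 0) (velocity M {0..1} \<gamma> 0)"
    and "\<psi> \<equiv> \<lambda>t. metric M (\<gamma> t) (grad M f (\<gamma> t)) (velocity M {0..1} \<gamma> t)"
  shows "\<exists>\<delta>>0. \<forall>t'\<in>{0..1}. \<bar>t' - t\<bar> < \<delta> \<longrightarrow> \<bar>\<psi> t' - \<psi> t\<bar> \<le> (L * s\<^sup>2 + \<epsilon>) * \<bar>t' - t\<bar>"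
proof -
  obtain c where c: "c \<in> charts_at M (\<gamma> t)" by (rule chart_exists)
  have A: "c \<in> atlas M" "\<gamma> t \<in> cdom c" using c by (auto simp: charts_at_iff)
  define z0 where "z0 = cmap c (\<gamma> t)"
  have z0: "z0 \<in> cimg c" unfolding z0_def by (rule cmap_in_cimg[OF A(2)])
  note d\<gamma> = geodesicD[OF \<gamma>]
  define w where "w s = velocity M {0..1} \<gamma> s c" for s
  have s0: "s \<ge> 0" unfolding s_def by (rule tnorm_nonneg[OF geodesic_tangent[OF \<gamma>]]) simp
  obtain r1 m where r1: "r1 > 0" "m > 0" "cball z0 r1 \<subseteq> cimg c"
    "\<And>z u. z \<in> cball z0 r1 \<Longrightarrow> m * (norm u)\<^sup>2 \<le> gcoord M c z u u"
    using gcoord_coercive_near[OF A(1) z0] by blast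
  obtain r3 B where r3: "r3 > 0" "B > 0"
    "\<And>z e. z \<in> cball z0 r3 \<Longrightarrow> z \<in> cimg c \<Longrightarrow> \<bar>dfun f c z e\<bar> \<le> B * norm e"
    using dfun_bounded_near[OF f A(1) z0] by blast
  \<comment> \<open>A bound for the coordinate velocity of \<open>\<gamma>\<close> near \<open>t\<close>; \<open>\<sigma>\<close> obeys the bound \<open>k \<bar>h\<bar>\<close>.\<close>
  define k where "k = s / sqrt m"
  have k0: "k \<ge> 0" using s0 r1(2) by (simp add: k_def)
  \<comment> \<open>The admissible oscillation of the Christoffel symbols, chosen so that the term \<open>4 B \<epsilon>1 k\<^sup>2\<close> of the final estimate uses up half of \<open>\<epsilon>\<close>.\<close>
  define \<epsilon>1 where "\<epsilon>1 = min 1 (\<epsilon> / (8 * B * (k\<^sup>2 + 1)))"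
  have k21: "k\<^sup>2 + 1 > 0" by (simp add: add_nonneg_pos)
  have \<epsilon>1: "\<epsilon>1 > 0" "\<epsilon>1 \<le> 1" using \<epsilon> r3(2) k21 by (auto simp: \<epsilon>1_def)
  have \<epsilon>1': "4 * B * \<epsilon>1 * k\<^sup>2 \<le> \<epsilon> / 2"
  proof -
    have "\<epsilon>1 * (8 * B * (k\<^sup>2 + 1)) \<le> \<epsilon>"
      using r3(2) k21 by (simp add: \<epsilon>1_def flip: pos_le_divide_eq)
    moreover have "\<epsilon>1 * (8 * B * k\<^sup>2) \<le> \<epsilon>1 * (8 * B * (k\<^sup>2 + 1))"
      using \<epsilon>1 r3(2) by (intro mult_left_mono) auto
    ultimately show ?thesis by (simp add: mult_ac)
  qed
  have "\<exists>r2>0. \<forall>z\<in>cball z0 r2. \<forall>u v.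
      norm (christoffel M c z u v - christoffel M c z0 u v) \<le> \<epsilon>1 * norm u * norm v"
    by (rule bilinear_family_near[of "cimg c" z0 "christoffel M c" \<epsilon>1,
          OF open_cimg[OF A(1)] z0 bilinear_christoffel[OF A(1)] continuous_on_christoffel[OF A(1)] \<epsilon>1(1)]) blast+
  then obtain r2 where r2: "r2 > 0" "\<And>z u v. z \<in> cball z0 r2 \<Longrightarrow>
      norm (christoffel M c z u v - christoffel M c z0 u v) \<le> \<epsilon>1 * norm u * norm v" by blast
  define C where "C = (\<Sum>i\<in>Basis. \<Sum>j\<in>Basis. norm (christoffel M c z0 i j)) + 1"
  have C0: "C \<ge> 0" unfolding C_def by (intro add_nonneg_nonneg sum_nonneg) auto
  define r where "r = min r1 (min r2 r3)"
  have r: "r > 0" "cball z0 r \<subseteq> cball z0 r1" "cball z0 r \<subseteq> cball z0 r2" "cball z0 r \<subseteq> cball z0 r3"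
    using r1(1) r2(1) r3(1) by (auto simp: r_def)
  have rc: "cball z0 r \<subseteq> cimg c" using r(2) r1(3) by blast
  have coercive: "m * (norm u)\<^sup>2 \<le> gcoord M c z u u" if "z \<in> cball z0 r" for z u
    using r1(4) r(2) that by blast
  have near: "norm (christoffel M c z u v - christoffel M c z0 u v) \<le> \<epsilon>1 * norm u * norm v"
    if "z \<in> cball z0 r" for z u v using r2(2) r(3) that by blast
  have bound: "norm (christoffel M c z u v) \<le> C * norm u * norm v" if "z \<in> cball z0 r" for z u v
  proof -
    have "norm (christoffel M c z u v)
        \<le> norm (christoffel M c z u v - christoffel M c z0 u v) + norm (christoffel M c z0 u v)"
      using norm_triangle_ineq[of "christoffel M c z u v - christoffel M c z0 u v" "christoffel M c z0 u v"] by simp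
    also have "\<dots> \<le> 1 * norm u * norm v + (C - 1) * norm u * norm v"
    proof (rule add_mono)
      show "norm (christoffel M c z u v - christoffel M c z0 u v) \<le> 1 * norm u * norm v"
        by (rule order.trans[OF near[OF that]]) (intro mult_right_mono \<epsilon>1(2) norm_ge_zero)
      show "norm (christoffel M c z0 u v) \<le> (C - 1) * norm u * norm v"
        using norm_bilinear_le_basis[OF bilinear_christoffel[OF A(1) z0], of u v] by (simp add: C_def)
    qed
    finally show ?thesis by (simp add: algebra_simps)
  qed
  have dfb: "\<bar>dfun f c z e\<bar> \<le> B * norm e" if "z \<in> cball z0 r" for z e
    using r3(3) r(4) rc that by blast
  have lindf: "linear (dfun f c z)" if "z \<in> cball z0 r" for z
    using C1_functionD(1)[OF f A(1)] has_derivative_linear rc that by blast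
  define U where "U = cdom c \<inter> cmap c -` ball z0 r"
  have "open U" unfolding U_def
    by (rule continuous_open_preimage[OF continuous_on_cmap[OF A(1)] open_cdom[OF A(1)] open_ball])
  moreover have "\<gamma> t \<in> U" using A(2) r(1) by (simp add: U_def z0_def)
  moreover have "(\<gamma> \<longlongrightarrow> \<gamma> t) (at t within {0..1})" using d\<gamma>(2) t by (simp add: continuous_on_def)
  ultimately have "\<forall>\<^sub>F a in at t within {0..1}. \<gamma> a \<in> U" using topological_tendstoD by blast
  then obtain \<delta>1 where \<delta>1: "\<delta>1 > 0" "\<And>a. a \<in> {0..1} \<Longrightarrow> a \<noteq> t \<Longrightarrow> dist a t < \<delta>1 \<Longrightarrow> \<gamma> a \<in> U"
    unfolding eventually_at by blast
  have small: "a * x < b" if "a \<ge> 0" "b > 0" "x \<ge> 0" "x < b / (a + 1)" for a b x :: real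
  proof -
    have "x * (a + 1) < b" using that by (simp add: pos_less_divide_eq)
    moreover have "a * x \<le> x * (a + 1)" using that by (simp add: algebra_simps)
    ultimately show ?thesis by linarith
  qed
  \<comment> \<open>In this order: \<open>\<gamma>\<close> stays in the ball, so does \<open>\<sigma>\<close>, the equation of parallel fields along \<open>\<sigma>\<close> has coefficients below \<open>1/2\<close>, and the cubic error term uses up the other half of \<open>\<epsilon>\<close>.\<close>
  define \<delta> where "\<delta> = min \<delta>1 (min (r / (k + 1)) (min ((1/2) / (C * k + 1)) ((\<epsilon>/2) / (8 * B * C\<^sup>2 * k ^ 3 + 1))))"
  have "\<delta> > 0" unfolding \<delta>_def min_less_iff_conj
    using \<delta>1(1) r(1) k0 C0 r3(2) \<epsilon> by (intro conjI divide_pos_pos add_nonneg_pos mult_nonneg_nonneg) auto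
  moreover have "\<bar>\<psi> t' - \<psi> t\<bar> \<le> (L * s\<^sup>2 + \<epsilon>) * \<bar>t' - t\<bar>" if t': "t' \<in> {0..1}" "\<bar>t' - t\<bar> < \<delta>" "t' \<noteq> t" for t'
  proof -
    define h where "h = t' - t"
    have h: "h \<noteq> 0" "t + h \<in> {0..1}" "t + h = t'" using t' by (auto simp: h_def)
    have hk: "k * \<bar>h\<bar> < r"
      by (rule small) (use k0 r(1) t'(2) in \<open>auto simp: h_def \<delta>_def\<close>)
    have hC: "C * k * \<bar>h\<bar> < 1/2"
      by (rule small) (use k0 C0 t'(2) in \<open>auto simp: h_def \<delta>_def\<close>)
    have h\<epsilon>: "8 * B * C\<^sup>2 * k ^ 3 * \<bar>h\<bar> < \<epsilon> / 2"
      by (rule small) (use k0 C0 r3(2) \<epsilon> t'(2) in \<open>auto simp: h_def \<delta>_def\<close>)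
    define K where "K = k * \<bar>h\<bar>"
    have K0: "K \<ge> 0" using k0 by (simp add: K_def)
    note I = affine_in_unit_interval[OF t h(2)]
    have \<gamma>U: "\<gamma> (t + h * \<tau>) \<in> cdom c \<and> cmap c (\<gamma> (t + h * \<tau>)) \<in> cball z0 r" if "\<tau> \<in> {0..1}" for \<tau>
    proof (cases "h * \<tau> = 0")
      case True
      then have eq: "t + h * \<tau> = t" by auto
      show ?thesis unfolding eq using A(2) r(1) by (simp add: z0_def)
    next
      case False
      have "\<bar>h\<bar> * \<bar>\<tau>\<bar> \<le> \<bar>h\<bar> * 1" using that by (intro mult_left_mono) auto
      also have "\<dots> < \<delta>1" using t'(2) by (simp add: h_def \<delta>_def)
      finally have "dist (t + h * \<tau>) t < \<delta>1" by (simp add: dist_real_def abs_mult)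
      then have "\<gamma> (t + h * \<tau>) \<in> U" using False I[OF that] by (intro \<delta>1(2)) auto
      then show ?thesis by (auto simp: U_def)
    qed
    have \<gamma>c: "c \<in> charts_at M (\<gamma> (t + h * \<tau>))" if "\<tau> \<in> {0..1}" for \<tau>
      using \<gamma>U[OF that] A(1) by (simp add: charts_at_iff)
    obtain \<sigma> where min: "minimising_geodesic M \<sigma> (\<gamma> t) (\<gamma> t')"
      and \<sigma>speed: "tnorm M (\<gamma> t) (velocity M {0..1} \<sigma> 0) = rdist M (\<gamma> t) (\<gamma> t')"
      using minimising_geodesic_exists[OF complete lg] by blast
    have \<sigma>: "geodesic M {0..1} \<sigma>" "\<sigma> 0 = \<gamma> t" "\<sigma> 1 = \<gamma> t'" using min by (auto simp: minimising_geodesic_def)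
    note d\<sigma> = geodesicD[OF \<sigma>(1)]
    define v where "v \<tau> = velocity M {0..1} \<sigma> \<tau> c" for \<tau>
    have dist_le: "rdist M (\<gamma> t) (\<gamma> t') \<le> \<bar>h\<bar> * s"
      using rdist_along_geodesic_le[OF \<gamma> t h(2)] h(3) by (simp add: s_def)
    have dist0: "rdist M (\<gamma> t) (\<gamma> t') \<ge> 0"
      using tnorm_nonneg[OF geodesic_tangent[OF \<sigma>(1), of 0]] \<sigma>speed \<sigma>(2) by simp
    have sk: "\<bar>h\<bar> * s = sqrt m * K" using r1(2) by (simp add: K_def k_def)
    have \<sigma>U: "\<sigma> \<tau> \<in> cdom c \<and> cmap c (\<sigma> \<tau>) \<in> cball z0 r" if "\<tau> \<in> {0..1}" for \<tau>
    proof -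
      have "tnorm M (\<sigma> 0) (velocity M {0..1} \<sigma> 0) < sqrt m * r"
      proof -
        have "sqrt m * K < sqrt m * r" using hk r1(2) by (simp add: K_def)
        then show ?thesis using \<sigma>speed \<sigma>(2) dist_le sk by simp
      qed
      then show ?thesis
        using geodesic_stays_in_chart[OF \<sigma>(1), of c r m \<tau>] \<sigma>(2) c rc r(1) r1(2) coercive that
        by (simp add: z0_def)
    qed
    have \<sigma>c: "c \<in> charts_at M (\<sigma> \<tau>)" if "\<tau> \<in> {0..1}" for \<tau>
      using \<sigma>U[OF that] A(1) by (simp add: charts_at_iff)
    have vK: "norm (v \<tau>) \<le> K" if "\<tau> \<in> {0..1}" for \<tau>
    proof -
      have "sqrt m * norm (v \<tau>) \<le> tnorm M (\<sigma> 0) (velocity M {0..1} \<sigma> 0)"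
        unfolding v_def using \<sigma>U[OF that] r1(2)
        by (intro coordinate_velocity_bound[OF \<sigma>(1) that \<sigma>c[OF that]] coercive) auto
      also have "\<dots> \<le> sqrt m * K" using \<sigma>speed \<sigma>(2) dist_le sk by simp
      finally show ?thesis using r1(2) by simp
    qed
    have wK: "norm (h *\<^sub>R w (t + h * \<tau>)) \<le> K" if "\<tau> \<in> {0..1}" for \<tau>
    proof -
      have "sqrt m * norm (w (t + h * \<tau>)) \<le> s"
        unfolding w_def s_def using \<gamma>U[OF that] r1(2)
        by (intro coordinate_velocity_bound[OF \<gamma> I[OF that] \<gamma>c[OF that]] coercive) auto
      then have "norm (w (t + h * \<tau>)) \<le> k" using r1(2) by (simp add: k_def pos_le_divide_eq mult.commute)
      then have "\<bar>h\<bar> * norm (w (t + h * \<tau>)) \<le> \<bar>h\<bar> * k" by (rule mult_left_mono) simp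
      then show ?thesis by (simp add: K_def mult.commute)
    qed
    define \<eta> where "\<eta> = (2 * \<epsilon>1 + 4 * C\<^sup>2 * K) * K\<^sup>2"
    have close: "norm (h *\<^sub>R w (t + h * \<tau>) - v \<tau>) \<le> \<eta>" if "\<tau> \<in> {0..1}" for \<tau>
      unfolding \<eta>_def
    proof (rule geodesic_equation_endpoint_estimate[where B = "christoffel M c" and S = "cball z0 r" and ?z0.0 = z0
          and p = "\<lambda>\<tau>. cmap c (\<gamma> (t + h * \<tau>))" and q = "\<lambda>\<tau>. cmap c (\<sigma> \<tau>)"
          and p' = "\<lambda>\<tau>. h *\<^sub>R w (t + h * \<tau>)" and q' = v and t = \<tau>])
      show "bilinear (christoffel M c z0)" by (rule bilinear_christoffel[OF A(1) z0])
      show "z0 \<in> cball z0 r" using r(1) by simp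
      show "\<epsilon>1 \<ge> 0" using \<epsilon>1(1) by simp
      show "C \<ge> 0" by (rule C0)
      show "cmap c (\<gamma> (t + h * 0)) = cmap c (\<sigma> 0)" "cmap c (\<gamma> (t + h * 1)) = cmap c (\<sigma> 1)"
        using \<sigma> h(3) by simp_all
      fix \<tau> :: real assume \<tau>: "\<tau> \<in> {0..1}"
      show "cmap c (\<gamma> (t + h * \<tau>)) \<in> cball z0 r" using \<gamma>U[OF \<tau>] ..
      show "cmap c (\<sigma> \<tau>) \<in> cball z0 r" using \<sigma>U[OF \<tau>] ..
      show "norm (h *\<^sub>R w (t + h * \<tau>)) \<le> K" by (rule wK[OF \<tau>])
      show "norm (v \<tau>) \<le> K" by (rule vK[OF \<tau>])
      show "((\<lambda>\<tau>. cmap c (\<gamma> (t + h * \<tau>))) has_vector_derivative h *\<^sub>R w (t + h * \<tau>)) (at \<tau> within {0..1})"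
        unfolding w_def
        by (rule has_vector_derivative_affine_reparametrisation[OF
              velocity_has_vector_derivative[OF d\<gamma>(1) I[OF \<tau>] \<gamma>c[OF \<tau>]] t h(2)])
      show "((\<lambda>\<tau>. cmap c (\<sigma> \<tau>)) has_vector_derivative v \<tau>) (at \<tau> within {0..1})"
        unfolding v_def by (rule velocity_has_vector_derivative[OF d\<sigma>(1) \<tau> \<sigma>c[OF \<tau>]])
      show "(v has_vector_derivative - christoffel M c (cmap c (\<sigma> \<tau>)) (v \<tau>) (v \<tau>)) (at \<tau> within {0..1})"
        unfolding v_def[abs_def] by (rule parallel_fieldD(2)[OF d\<sigma>(3) \<tau> \<sigma>c[OF \<tau>]])
      have zc: "cmap c (\<gamma> (t + h * \<tau>)) \<in> cimg c" using \<gamma>U[OF \<tau>] rc by blast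
      have "((\<lambda>\<tau>. w (t + h * \<tau>)) has_vector_derivative
          h *\<^sub>R (- christoffel M c (cmap c (\<gamma> (t + h * \<tau>))) (w (t + h * \<tau>)) (w (t + h * \<tau>)))) (at \<tau> within {0..1})"
        unfolding w_def
        by (rule has_vector_derivative_affine_reparametrisation[OF
              parallel_fieldD(2)[OF d\<gamma>(3) I[OF \<tau>] \<gamma>c[OF \<tau>]] t h(2)])
      from has_vector_derivative_scaleR[OF DERIV_const this, of h]
      show "((\<lambda>\<tau>. h *\<^sub>R w (t + h * \<tau>)) has_vector_derivative
          - christoffel M c (cmap c (\<gamma> (t + h * \<tau>))) (h *\<^sub>R w (t + h * \<tau>)) (h *\<^sub>R w (t + h * \<tau>))) (at \<tau> within {0..1})"
        unfolding bilinear_lmul[OF bilinear_christoffel[OF A(1) zc]] bilinear_rmul[OF bilinear_christoffel[OF A(1) zc]]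
        by simp
    qed (use near bound that in auto)
    have "norm (christoffel M c (cmap c (\<sigma> \<tau>)) (velocity M {0..1} \<sigma> \<tau> c) e) \<le> norm e / 2"
      if "\<tau> \<in> {0..1}" for \<tau> e
    proof -
      have "norm (christoffel M c (cmap c (\<sigma> \<tau>)) (v \<tau>) e) \<le> C * norm (v \<tau>) * norm e"
        by (rule bound) (use \<sigma>U[OF that] in blast)
      also have "\<dots> \<le> C * K * norm e" using vK[OF that] C0 by (intro mult_right_mono mult_left_mono) auto
      also have "\<dots> \<le> 1/2 * norm e" using hC by (intro mult_right_mono) (auto simp: K_def)
      finally show ?thesis by (simp add: v_def)
    qed
    then obtain V where V: "parallel_field M {0..1} \<sigma> V" "V 0 = grad M f (\<gamma> t)"
      using parallel_field_exists[OF d\<sigma>(1) A(1) _ continuous_on_velocity_coord[OF \<sigma>(1) \<sigma>c], of "grad M f (\<gamma> t)"]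
        \<sigma>U grad_tangent[OF f, of "\<gamma> t"] \<sigma>(2) by auto
    let ?x = "cmap c (\<gamma> t)" and ?y = "cmap c (\<gamma> t')"
    have ct': "c \<in> charts_at M (\<gamma> t')" using \<gamma>c[of 1] h(3) by simp
    have xy: "?x \<in> cball z0 r" "?y \<in> cball z0 r" using \<gamma>U[of 0] \<gamma>U[of 1] h(3) by auto
    have main: "\<bar>dfun f c ?y (v 1) - dfun f c ?x (v 0)\<bar> \<le> L * (rdist M (\<gamma> t) (\<gamma> t'))\<^sup>2"
      using gradient_change_along_minimising_geodesic[OF f lip min V]
        metric_grad[OF f _ ct', of "velocity M {0..1} \<sigma> 1"] metric_grad[OF f _ c, of "velocity M {0..1} \<sigma> 0"]
        geodesic_tangent[OF \<sigma>(1), of 0] geodesic_tangent[OF \<sigma>(1), of 1] \<sigma>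
      by (simp add: v_def)
    have \<psi>: "\<psi> t = dfun f c ?x (w t)" "\<psi> t' = dfun f c ?y (w t')"
      unfolding \<psi>_def w_def
      by (rule metric_grad[OF f geodesic_tangent[OF \<gamma> t] c] metric_grad[OF f geodesic_tangent[OF \<gamma> t'(1)] ct'])+
    have "h * \<psi> t' - h * \<psi> t = (dfun f c ?y (v 1) - dfun f c ?x (v 0))
        + dfun f c ?y (h *\<^sub>R w t' - v 1) - dfun f c ?x (h *\<^sub>R w t - v 0)"
      unfolding \<psi> using lindf[OF xy(1)] lindf[OF xy(2)] by (simp add: linear_diff linear_cmul)
    then have "\<bar>h\<bar> * \<bar>\<psi> t' - \<psi> t\<bar> \<le> \<bar>dfun f c ?y (v 1) - dfun f c ?x (v 0)\<bar>
        + \<bar>dfun f c ?y (h *\<^sub>R w t' - v 1)\<bar> + \<bar>dfun f c ?x (h *\<^sub>R w t - v 0)\<bar>"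
      by (simp add: right_diff_distrib flip: abs_mult)
    also have "\<dots> \<le> L * (\<bar>h\<bar> * s)\<^sup>2 + B * \<eta> + B * \<eta>"
    proof (intro add_mono)
      show "\<bar>dfun f c ?y (v 1) - dfun f c ?x (v 0)\<bar> \<le> L * (\<bar>h\<bar> * s)\<^sup>2"
        by (rule order.trans[OF main]) (intro mult_left_mono power_mono dist_le dist0 L)
      show "\<bar>dfun f c ?y (h *\<^sub>R w t' - v 1)\<bar> \<le> B * \<eta>"
        using close[of 1] h(3) r3(2) by (intro order.trans[OF dfb[OF xy(2)]] mult_left_mono) auto
      show "\<bar>dfun f c ?x (h *\<^sub>R w t - v 0)\<bar> \<le> B * \<eta>"
        using close[of 0] r3(2) by (intro order.trans[OF dfb[OF xy(1)]] mult_left_mono) auto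
    qed
    also have "B * \<eta> = (2 * B * \<epsilon>1 * k\<^sup>2 + 4 * B * C\<^sup>2 * k ^ 3 * \<bar>h\<bar>) * h\<^sup>2"
      by (simp add: \<eta>_def K_def power_mult_distrib power2_eq_square power3_eq_cube algebra_simps)
    also have "L * (\<bar>h\<bar> * s)\<^sup>2 + (2 * B * \<epsilon>1 * k\<^sup>2 + 4 * B * C\<^sup>2 * k ^ 3 * \<bar>h\<bar>) * h\<^sup>2
        + (2 * B * \<epsilon>1 * k\<^sup>2 + 4 * B * C\<^sup>2 * k ^ 3 * \<bar>h\<bar>) * h\<^sup>2
        = (L * s\<^sup>2 + (4 * B * \<epsilon>1 * k\<^sup>2 + 8 * B * C\<^sup>2 * k ^ 3 * \<bar>h\<bar>)) * h\<^sup>2"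
      by (simp add: power_mult_distrib algebra_simps)
    also have "\<dots> \<le> (L * s\<^sup>2 + \<epsilon>) * h\<^sup>2"
      using \<epsilon>1' h\<epsilon> by (intro mult_right_mono) auto
    also have "\<dots> = \<bar>h\<bar> * ((L * s\<^sup>2 + \<epsilon>) * \<bar>h\<bar>)" by (simp add: power2_eq_square)
    finally have "\<bar>\<psi> t' - \<psi> t\<bar> \<le> (L * s\<^sup>2 + \<epsilon>) * \<bar>h\<bar>" using h(1) by simp
    then show ?thesis by (simp add: h_def)
  qed
  ultimately show ?thesis by (metis abs_zero diff_self mult_zero_right order_refl)
qed

text \<open>By the Lipschitz bound on \<open>\<psi>\<close>, subtracting the claimed quadratic majorant from \<open>f \<circ> \<gamma>\<close>
  leaves a function with nonpositive derivative.\<close>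

lemma descent_along_geodesic:
  assumes complete: "complete_rmfd M" and lg: "is_log_map M lg" and f: "C1_function M f"
    and lip: "lipschitz_gradient M L f" and L: "L \<ge> 0" and \<gamma>: "geodesic M {0..1} \<gamma>"
  shows "f (\<gamma> 1) \<le> f (\<gamma> 0) + metric M (\<gamma> 0) (grad M f (\<gamma> 0)) (velocity M {0..1} \<gamma> 0)
    + L / 2 * (tnorm M (\<gamma> 0) (velocity M {0..1} \<gamma> 0))\<^sup>2"
proof -
  define s where "s = tnorm M (\<gamma> 0) (velocity M {0..1} \<gamma> 0)"
  define \<psi> where "\<psi> t = metric M (\<gamma> t) (grad M f (\<gamma> t)) (velocity M {0..1} \<gamma> t)" for t
  have Lip: "\<bar>\<psi> b - \<psi> 0\<bar> \<le> L * s\<^sup>2 * (b - 0)" if b: "b \<in> {0..1}" for b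
  proof (rule pointwise_lipschitz_imp_lipschitz)
    fix t \<epsilon> :: real assume "t \<in> {0..b}" "\<epsilon> > 0"
    then have "t \<in> {0..1}" using b by auto
    from gradient_pairing_pointwise_lipschitz[OF complete lg f lip L \<gamma> this \<open>\<epsilon> > 0\<close>]
    obtain \<delta> where \<delta>: "\<delta> > 0" "\<And>t'. t' \<in> {0..1} \<Longrightarrow> \<bar>t' - t\<bar> < \<delta> \<Longrightarrow> \<bar>\<psi> t' - \<psi> t\<bar> \<le> (L * s\<^sup>2 + \<epsilon>) * \<bar>t' - t\<bar>"
      unfolding s_def \<psi>_def by blast
    then show "\<exists>\<delta>>0. \<forall>t'\<in>{0..b}. \<bar>t' - t\<bar> < \<delta> \<longrightarrow> \<bar>\<psi> t' - \<psi> t\<bar> \<le> (L * s\<^sup>2 + \<epsilon>) * \<bar>t' - t\<bar>"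
      using b by (intro exI[of _ \<delta>]) auto
  qed (use L b in auto)
  define F where "F t = f (\<gamma> t) - \<psi> 0 * t - L * s\<^sup>2 * t\<^sup>2 / 2" for t
  have der: "(F has_real_derivative \<psi> t - \<psi> 0 - L * s\<^sup>2 * t) (at t within {0..1})" if t: "t \<in> {0..1}" for t
  proof -
    have "((\<lambda>t. f (\<gamma> t)) has_real_derivative \<psi> t) (at t within {0..1})"
      using derivative_along_curve[OF f geodesicD(1)[OF \<gamma>] t at_within_unit_interval_nontrivial[OF t]]
      by (simp add: \<psi>_def has_real_derivative_iff_has_vector_derivative)
    then show ?thesis unfolding F_def by (auto intro!: derivative_eq_intros)
  qed
  have "F 1 \<le> F 0"
  proof (rule DERIV_nonpos_imp_decreasing_open[of 0 1 F])
    show "continuous_on {0..1} F"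
      by (rule DERIV_continuous_on[OF der])
    fix t :: real assume t: "0 < t" "t < 1"
    have "(F has_real_derivative \<psi> t - \<psi> 0 - L * s\<^sup>2 * t) (at t)"
      using der[of t] t by (simp add: at_within_Icc_at)
    moreover have "\<psi> t - \<psi> 0 - L * s\<^sup>2 * t \<le> 0" using Lip[of t] t by simp
    ultimately show "\<exists>y. (F has_real_derivative y) (at t) \<and> y \<le> 0" by blast
  qed simp
  then show ?thesis by (simp add: F_def \<psi>_def s_def)
qed

lemma descent_along_rexp:
  assumes "complete_rmfd M" "is_log_map M lg" "C1_function M f" "lipschitz_gradient M L f" "L \<ge> 0"
    and v: "v \<in> tangent_space M x"
  shows "f (rexp M x v) \<le> f x + metric M x (grad M f x) v + L / 2 * (tnorm M x v)\<^sup>2"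
proof -
  obtain \<gamma> where "geodesic M {0..1} \<gamma>" "\<gamma> 0 = x" "velocity M {0..1} \<gamma> 0 = v" "\<gamma> 1 = rexp M x v"
    using rexp_geodesic[OF assms(1) v] by blast
  then show ?thesis using descent_along_geodesic[OF assms(1-5), of \<gamma>] by simp
qed

end

section \<open>One step of the iteration\<close>

theorem lemma3p2:
  fixes M :: "('m::{t2_space, second_countable_topology}, 'e::euclidean_space) rmfd"
    and f :: "'m \<Rightarrow> real"
    and lg :: "'m \<Rightarrow> 'm \<Rightarrow> ('m, 'e) tvec"
    and L f_star \<eta> \<epsilon> \<mu> :: real
    and x w :: "nat \<Rightarrow> 'm"
    and d :: "nat \<Rightarrow> ('m, 'e) tvec"
    and G \<alpha> \<mu>bar \<mu>til :: "nat \<Rightarrow> real"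
  assumes "riemannian_manifold M"
    and "connected (UNIV :: 'm set)"
    and "complete_rmfd M"
    and "is_log_map M lg"
    and "C1_function M f"
    and "L > 0"
    and "lipschitz_gradient M L f"
    and "\<And>p. f p \<ge> f_star"
    and "\<eta> > 0" and "\<epsilon> > 0" and "0 < \<mu>" and "\<mu> < 1"
    and "riag_r M f lg \<eta> \<epsilon> \<mu> x w d G \<alpha> \<mu>bar \<mu>til"
  shows "\<forall>n\<ge>1. f (x (n + 1)) \<le>
           f (x n) - \<alpha> n * (1 - L * \<alpha> n / 2) * (tnorm M (w n) (grad M f (w n)))\<^sup>2
           + L * (\<mu>til n)\<^sup>2 / 2 * (rdist M (x n) (x (n - 1)))\<^sup>2"
proof (intro allI impI)
  fix n :: nat assume n: "n \<ge> 1"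
  interpret riemannian M by standard (rule assms(1))
  note f = assms(5)
  have L: "L \<ge> 0" using assms(6) by simp
  note descent = descent_along_rexp[OF assms(3,4) f assms(7) L]
  have it: "\<mu>bar n = (if x n \<noteq> x (n - 1) then min \<mu> (\<mu> * rdist M (x n) (x (n - 1))) else \<mu>)"
    "d n = tscale (- 1) (lg (x n) (x (n - 1)))"
    "\<mu>til n = (if metric M (x n) (grad M f (x n)) (d n) > 0 then 0 else \<mu>bar n)"
    "w n = rexp M (x n) (tscale (\<mu>til n) (d n))"
    "x (n + 1) = rexp M (w n) (tscale (- \<alpha> n) (grad M f (w n)))"
    using assms(13) n unfolding riag_r_def by blast+
  have lg: "lg (x n) (x (n - 1)) \<in> tangent_space M (x n)"
    "tnorm M (x n) (lg (x n) (x (n - 1))) = rdist M (x n) (x (n - 1))"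
    using assms(4) unfolding is_log_map_def by blast+
  have d: "d n \<in> tangent_space M (x n)" "tnorm M (x n) (d n) = rdist M (x n) (x (n - 1))"
    unfolding it(2) using tangent_tscale[OF lg(1)] tnorm_tscale[OF lg(1)] lg(2) by auto
  have rd: "rdist M (x n) (x (n - 1)) \<ge> 0" using tnorm_nonneg[OF d(1)] d(2) by simp
  have "\<mu>bar n \<ge> 0" unfolding it(1) using assms(11) rd by simp
  then have inertia: "\<mu>til n * metric M (x n) (grad M f (x n)) (d n) \<le> 0"
    unfolding it(3) by (auto simp: mult_nonneg_nonpos)
  have "f (w n) \<le> f (x n) + metric M (x n) (grad M f (x n)) (tscale (\<mu>til n) (d n))
      + L / 2 * (tnorm M (x n) (tscale (\<mu>til n) (d n)))\<^sup>2"
    unfolding it(4) by (rule descent[OF tangent_tscale[OF d(1)]])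
  also have "\<dots> = f (x n) + \<mu>til n * metric M (x n) (grad M f (x n)) (d n)
      + L / 2 * (\<mu>til n)\<^sup>2 * (rdist M (x n) (x (n - 1)))\<^sup>2"
    by (simp add: metric_tscale_right[OF grad_tangent[OF f] d(1)] tnorm_tscale[OF d(1)] d(2) power_mult_distrib)
  finally have 1: "f (w n) \<le> f (x n) + L / 2 * (\<mu>til n)\<^sup>2 * (rdist M (x n) (x (n - 1)))\<^sup>2"
    using inertia by simp
  let ?g = "grad M f (w n)"
  note g = grad_tangent[OF f, of "w n"]
  have "f (x (n + 1)) \<le> f (w n) + metric M (w n) ?g (tscale (- \<alpha> n) ?g)
      + L / 2 * (tnorm M (w n) (tscale (- \<alpha> n) ?g))\<^sup>2"
    unfolding it(5) by (rule descent[OF tangent_tscale[OF g]])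
  also have "\<dots> = f (w n) - \<alpha> n * (1 - L * \<alpha> n / 2) * (tnorm M (w n) ?g)\<^sup>2"
    unfolding metric_tscale_right[OF g g] tnorm_tscale[OF g] tnorm_square[OF g, symmetric]
    by (simp add: power_mult_distrib power2_eq_square algebra_simps)
  finally show "f (x (n + 1)) \<le>
           f (x n) - \<alpha> n * (1 - L * \<alpha> n / 2) * (tnorm M (w n) (grad M f (w n)))\<^sup>2
           + L * (\<mu>til n)\<^sup>2 / 2 * (rdist M (x n) (x (n - 1)))\<^sup>2"
    using 1 by simp
qed

end
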